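(* Let $k$ be an algebraically closed field of characteristic $p>0$ and $G=\mathrm{SL}_2(k)$. Let $\lambda=\lambda_0+p\lambda_1+\dots+p^n\lambda_n$ and $\mu=\mu_0+p\mu_1+\dots+p^n\mu_n$ be dominant weights with $\lambda_i,\mu_i$ $p$-restricted dominant weights for all $i\in\{0,\dots,n\}$. Then $L(\lambda)\otimes L(\mu)$ is multiplicity-free if and only if $\lambda_i+\mu_i$ is $p$-restricted for all $i\in\{0,\dots,n\}$.
   Context: All modules are finite-dimensional rational $G$-modules. Weights of $\mathrm{SL}_2$ are identified with integers (the fundamental weight corresponds to $1$), and dominant weights with $\mathbb{N}=\{0,1,2,\dots\}$. A dominant weight $m\in\mathbb{N}$ is $p$-restricted if $m<p$. $L(\nu)$ is the simple $G$-module of highest weight $\nu$. A module $M$ is multiplicity-free if $[M:L(\nu)]\le 1$ for all dominant weights $\nu$, where $[M:L(\nu)]$ is the composition multiplicity. *)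

theory Defs
  imports
    "Jordan_Normal_Form.Determinant"
    "Jordan_Normal_Form.VS_Connect"
begin

section \<open>Rational modules for SL2\<close>

definition SL2 :: "'k::field mat monoid" where
  "SL2 = \<lparr>carrier = {g \<in> carrier_mat 2 2. det g = 1}, mult = (*), one = 1\<^sub>m 2\<rparr>"

abbreviation GL :: "nat \<Rightarrow> 'k::field mat monoid" where
  "GL n \<equiv> units_of (ring_mat TYPE('k) n ())"

text \<open>The coordinate ring of SL2 is generated as an algebra by the four matrix entries. The
  elements below are the polynomials in the entries; only their values on SL2 are ever used.\<close>

inductive_set regular_functions :: "('k::field mat \<Rightarrow> 'k) set" where
  const: "(\<lambda>_. c) \<in> regular_functions"
| entry: "\<lbrakk>i < 2; j < 2\<rbrakk> \<Longrightarrow> (\<lambda>g. g $$ (i, j)) \<in> regular_functions"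
| add: "\<lbrakk>f \<in> regular_functions; h \<in> regular_functions\<rbrakk> \<Longrightarrow> (\<lambda>g. f g + h g) \<in> regular_functions"
| mult: "\<lbrakk>f \<in> regular_functions; h \<in> regular_functions\<rbrakk> \<Longrightarrow> (\<lambda>g. f g * h g) \<in> regular_functions"

text \<open>A finite-dimensional rational module is presented, after a choice of basis, as the space
  \<open>carrier_vec n\<close> with an action by matrices, that is, as a homomorphism of algebraic groups from
  SL2 to GL n. The values of the action outside SL2 are irrelevant.\<close>

record 'k gmodule =
  gdim :: nat
  act :: "'k mat \<Rightarrow> 'k mat"

definition rational_module :: "'k::field gmodule \<Rightarrow> bool" where
  "rational_module M \<longleftrightarrow>
     act M \<in> hom SL2 (GL (gdim M)) \<and>
     (\<forall>i<gdim M. \<forall>j<gdim M. \<exists>f\<in>regular_functions.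
        \<forall>g\<in>carrier SL2. act M g $$ (i, j) = f g)"

definition gsubmodule :: "'k::field gmodule \<Rightarrow> 'k vec set \<Rightarrow> bool" where
  "gsubmodule M W \<longleftrightarrow>
     subspace class_ring W (module_vec TYPE('k) (gdim M)) \<and>
     (\<forall>g\<in>carrier SL2. \<forall>w\<in>W. act M g *\<^sub>v w \<in> W)"

definition simple_module :: "'k::field gmodule \<Rightarrow> bool" where
  "simple_module M \<longleftrightarrow>
     rational_module M \<and> gdim M > 0 \<and>
     (\<forall>W. gsubmodule M W \<longrightarrow> W = {0\<^sub>v (gdim M)} \<or> W = carrier_vec (gdim M))"

section \<open>Weights\<close>

definition torus :: "'k::field \<Rightarrow> 'k mat" where
  "torus t = mat_of_rows_list 2 [[t, 0], [0, inverse t]]"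

definition weight_space :: "'k::field gmodule \<Rightarrow> int \<Rightarrow> 'k vec set" where
  "weight_space M m =
     {v \<in> carrier_vec (gdim M). \<forall>t. t \<noteq> 0 \<longrightarrow> act M (torus t) *\<^sub>v v = (t powi m) \<cdot>\<^sub>v v}"

definition is_weight :: "'k::field gmodule \<Rightarrow> int \<Rightarrow> bool" where
  "is_weight M m \<longleftrightarrow> weight_space M m \<noteq> {0\<^sub>v (gdim M)}"

text \<open>The positive root is twice the fundamental weight.\<close>

definition dominance_le :: "int \<Rightarrow> int \<Rightarrow> bool" where
  "dominance_le m m' \<longleftrightarrow> (\<exists>j::nat. m' - m = 2 * int j)"

definition highest_weight :: "'k::field gmodule \<Rightarrow> nat \<Rightarrow> bool" where
  "highest_weight M \<nu> \<longleftrightarrow>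
     is_weight M (int \<nu>) \<and> (\<forall>m. is_weight M m \<longrightarrow> dominance_le m (int \<nu>))"

text \<open>The simple module of highest weight \<open>\<nu>\<close> is unique up to isomorphism; we fix one.\<close>

definition L :: "nat \<Rightarrow> 'k::field gmodule" where
  "L \<nu> = (SOME M. simple_module M \<and> highest_weight M \<nu>)"

definition restricted :: "nat \<Rightarrow> nat \<Rightarrow> bool" where
  "restricted p m \<longleftrightarrow> m < p"

section \<open>Composition multiplicities\<close>

text \<open>For submodules \<open>U \<subseteq> W\<close> of \<open>M\<close>, the quotient \<open>W/U\<close> is isomorphic to \<open>S\<close> iff there is an
  equivariant linear surjection from \<open>W\<close> onto \<open>S\<close> with kernel \<open>U\<close>. Every linear map on \<open>W\<close> extends
  to the ambient space, so it is the restriction of a matrix.\<close>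

definition quotient_iso :: "'k::field gmodule \<Rightarrow> 'k vec set \<Rightarrow> 'k vec set \<Rightarrow> 'k gmodule \<Rightarrow> bool" where
  "quotient_iso M W U S \<longleftrightarrow>
     (\<exists>A \<in> carrier_mat (gdim S) (gdim M).
        (\<lambda>w. A *\<^sub>v w) ` W = carrier_vec (gdim S) \<and>
        {w \<in> W. A *\<^sub>v w = 0\<^sub>v (gdim S)} = U \<and>
        (\<forall>g\<in>carrier SL2. \<forall>w\<in>W. A *\<^sub>v (act M g *\<^sub>v w) = act S g *\<^sub>v (A *\<^sub>v w)))"

definition composition_series :: "'k::field gmodule \<Rightarrow> 'k vec set list \<Rightarrow> bool" where
  "composition_series M Ws \<longleftrightarrow>
     Ws \<noteq> [] \<and> hd Ws = {0\<^sub>v (gdim M)} \<and> last Ws = carrier_vec (gdim M) \<and>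
     (\<forall>W\<in>set Ws. gsubmodule M W) \<and>
     (\<forall>i. Suc i < length Ws \<longrightarrow>
        (\<exists>S. simple_module S \<and> quotient_iso M (Ws ! Suc i) (Ws ! i) S))"

text \<open>By the Jordan-Hoelder theorem the number does not depend on the series.\<close>

definition composition_multiplicity :: "'k::field gmodule \<Rightarrow> 'k gmodule \<Rightarrow> nat" where
  "composition_multiplicity M S =
     (SOME c. \<exists>Ws. composition_series M Ws \<and>
        c = card {i. Suc i < length Ws \<and> quotient_iso M (Ws ! Suc i) (Ws ! i) S})"

definition multiplicity_free :: "'k::field gmodule \<Rightarrow> bool" where
  "multiplicity_free M \<longleftrightarrow> (\<forall>\<nu>. composition_multiplicity M (L \<nu>) \<le> 1)"

section \<open>Tensor products\<close>

definition kronecker :: "'k::semiring_1 mat \<Rightarrow> 'k mat \<Rightarrow> 'k mat" where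
  "kronecker A B = mat (dim_row A * dim_row B) (dim_col A * dim_col B)
     (\<lambda>(i, j). A $$ (i div dim_row B, j div dim_col B) * B $$ (i mod dim_row B, j mod dim_col B))"

text \<open>Coordinates are taken with respect to the basis of the \<open>e\<^sub>i \<otimes> f\<^sub>j\<close>, ordered lexicographically.\<close>

definition tensor :: "'k::field gmodule \<Rightarrow> 'k gmodule \<Rightarrow> 'k gmodule" where
  "tensor M N = \<lparr>gdim = gdim M * gdim N, act = (\<lambda>g. kronecker (act M g) (act N g))\<rparr>"

end

theory Submission
  imports Defs
begin

text \<open>The theorem is a statement about characters once the simple modules are known explicitly.

Let \<open>k\<close> have characteristic \<open>p\<close>. In the SL2-module of binary forms of degree \<open>\<nu>\<close>, the monomials
\<open>x\<^sup>\<nu>\<^sup>-\<^sup>i y\<^sup>i\<close> whose binomial coefficient \<open>\<nu> choose i\<close> is nonzero in \<open>k\<close> span the submodule generated by \<open>x\<^sup>\<nu>\<close>.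
This \<open>simple_model \<nu>\<close> is simple (\<open>simple_simple_model\<close>), because any nonzero submodule contains \<open>x\<^sup>\<nu>\<close>.
Conversely, every simple subquotient of a rational module is one of these
(\<open>simple_subquotient_is_model\<close>): a functional of extremal weight that is invariant under a unipotent
subgroup turns each vector into a semi-invariant function on SL2, and such functions are binary forms.
Hence \<open>L \<nu>\<close> is \<open>simple_model \<nu>\<close> (\<open>L_iso_model\<close>), every rational module has a composition series, and
all weights of \<open>L \<nu>\<close> have multiplicity one. They are the numbers \<open>\<nu> - 2 i\<close>, where, by Lucas' theorem,
the base \<open>p\<close> digits of \<open>i\<close> are bounded by those of \<open>\<nu>\<close>. For the characters \<open>\<chi> \<nu>\<close> of
the \<open>L \<nu>\<close> this gives Steinberg's factorisation \<open>\<chi> (r + p n) x = \<chi> r x * \<chi> n (x\<^sup>p)\<close> with \<open>r < p\<close> (\<open>simple_char_digit\<close>).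

Weight multiplicities add up along a composition series, and the characters of the simple modules are
linearly independent since their leading terms differ (\<open>total_char_inject\<close>). So the composition
multiplicities of \<open>L \<lambda> \<otimes> L \<mu>\<close> can be read off from any expression of \<open>\<chi> \<lambda> * \<chi> \<mu>\<close> as a sum of simple
characters. Treat one digit at a time, with digits \<open>r\<close> of \<open>\<lambda>\<close> and \<open>s\<close> of \<open>\<mu>\<close>. By Clebsch and Gordan the
product of their characters is the sum of the characters of binary forms of the degrees \<open>r + s - 2 c\<close>,
\<open>c \<le> min r s\<close>.

If \<open>r + s < p\<close>, all these degrees are below \<open>p\<close>, so the summands are distinct simple characters. If this
holds for every digit, then recombining the digits gives distinct simple characters for the whole
product, which is therefore multiplicity-free (\<open>multiplicity_free_no_carry\<close>). If \<open>r + s \<ge> p\<close>, the summand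
of degree \<open>r + s\<close> is not simple and contains the simple character of \<open>2 p - 2 - (r + s)\<close>, which is also
a summand of its own. This repetition survives multiplication by the contributions of the other digits,
as these are again nonnegative sums of simple characters (\<open>double_factor_exists\<close>).\<close>

section \<open>Linear algebra\<close>

definition lin_subspace :: "nat \<Rightarrow> 'k::field vec set \<Rightarrow> bool" where
  "lin_subspace n W \<longleftrightarrow> W \<subseteq> carrier_vec n \<and> 0\<^sub>v n \<in> W \<and>
     (\<forall>v\<in>W. \<forall>w\<in>W. v + w \<in> W) \<and> (\<forall>c. \<forall>v\<in>W. c \<cdot>\<^sub>v v \<in> W)"

lemma subspace_iff_lin_subspace:
  "subspace class_ring W (module_vec TYPE('k::field) n) \<longleftrightarrow> lin_subspace n W"
proof
  assume "subspace class_ring W (module_vec TYPE('k) n)"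
  then interpret submodule class_ring W "module_vec TYPE('k) n"
    by (simp add: subspace_def)
  show "lin_subspace n W"
    using subset m_closed zero_closed smult_closed
    by (auto simp: lin_subspace_def module_vec_simps class_ring_simps)
next
  assume "lin_subspace n W"
  then show "subspace class_ring W (module_vec TYPE('k) n)"
    by (auto simp: subspace_def vec_vs lin_subspace_def module_vec_simps class_ring_simps
        intro!: submodule.intro vec_module)
qed

lemma lin_subspaceD:
  assumes "lin_subspace n W"
  shows "v \<in> W \<Longrightarrow> v \<in> carrier_vec n" "0\<^sub>v n \<in> W"
    "v \<in> W \<Longrightarrow> w \<in> W \<Longrightarrow> v + w \<in> W" "v \<in> W \<Longrightarrow> c \<cdot>\<^sub>v v \<in> W"
  using assms by (auto simp: lin_subspace_def)

lemma lin_subspace_carrier: "lin_subspace n (carrier_vec n)"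
  by (auto simp: lin_subspace_def)

lemma lin_subspace_zero: "lin_subspace n {0\<^sub>v n}"
  by (auto simp: lin_subspace_def)

lemma lin_subspace_Int:
  "lin_subspace n X \<Longrightarrow> lin_subspace n Y \<Longrightarrow> lin_subspace n (X \<inter> Y)"
  by (auto simp: lin_subspace_def)

lemma lin_subspace_kernel:
  assumes "lin_subspace n X" "A \<in> carrier_mat d n"
  shows "lin_subspace n {x \<in> X. A *\<^sub>v x = 0\<^sub>v d}"
  using assms unfolding lin_subspace_def
  by (auto simp: subset_iff mult_add_distrib_mat_vec[OF assms(2)] mult_mat_vec[OF assms(2)])

lemma lin_subspace_image:
  assumes "lin_subspace n X" "A \<in> carrier_mat d n"
  shows "lin_subspace d ((\<lambda>x. A *\<^sub>v x) ` X)"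
  unfolding lin_subspace_def
proof (intro conjI ballI allI)
  show "(\<lambda>x. A *\<^sub>v x) ` X \<subseteq> carrier_vec d"
    using assms by (auto simp: lin_subspace_def)
  have "A *\<^sub>v 0\<^sub>v n = 0\<^sub>v d" using assms(2) by auto
  then show "0\<^sub>v d \<in> (\<lambda>x. A *\<^sub>v x) ` X"
    using lin_subspaceD(2)[OF assms(1)] by (metis image_eqI)
next
  fix v w assume "v \<in> (\<lambda>x. A *\<^sub>v x) ` X" "w \<in> (\<lambda>x. A *\<^sub>v x) ` X"
  then obtain x y where "x \<in> X" "y \<in> X" "v = A *\<^sub>v x" "w = A *\<^sub>v y" by auto
  then show "v + w \<in> (\<lambda>x. A *\<^sub>v x) ` X"
    using lin_subspaceD[OF assms(1)] mult_add_distrib_mat_vec[OF assms(2), of x y]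
    by (metis image_eqI)
next
  fix c v assume "v \<in> (\<lambda>x. A *\<^sub>v x) ` X"
  then obtain x where "x \<in> X" "v = A *\<^sub>v x" by auto
  then show "c \<cdot>\<^sub>v v \<in> (\<lambda>x. A *\<^sub>v x) ` X"
    using lin_subspaceD[OF assms(1)] mult_mat_vec[OF assms(2), of x c]
    by (metis image_eqI)
qed

text \<open>Induction on the number of coordinates: a vector of \<open>W\<close> that is nonzero in the last coordinate
  is used to clear that coordinate, after which the last entry of the functional is forced.\<close>

lemma separating_functional_aux:
  fixes W :: "(nat \<Rightarrow> 'k::field) set"
  assumes "\<And>v w. v \<in> W \<Longrightarrow> w \<in> W \<Longrightarrow> (\<lambda>i. v i + w i) \<in> W"
    and "\<And>c v. v \<in> W \<Longrightarrow> (\<lambda>i. c * v i) \<in> W"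
    and "(\<lambda>i. 0) \<in> W"
    and "\<And>w i. w \<in> W \<Longrightarrow> i \<ge> n \<Longrightarrow> w i = 0" "\<And>i. i \<ge> n \<Longrightarrow> v i = 0"
    and "v \<notin> W"
  shows "\<exists>y. (\<forall>w\<in>W. (\<Sum>i<n. y i * w i) = 0) \<and> (\<Sum>i<n. y i * v i) \<noteq> 0"
  using assms
proof (induction n arbitrary: W v)
  case 0
  then have "v = (\<lambda>i. 0)" by auto
  with 0 show ?case by auto
next
  case (Suc n)
  note add = Suc.prems(1) and smult = Suc.prems(2) and zero = Suc.prems(3)
  show ?case
  proof (cases "\<exists>w\<in>W. w n \<noteq> 0")
    case True
    then obtain w' where w': "w' \<in> W" "w' n \<noteq> 0" by auto
    define w0 where "w0 = (\<lambda>i. inverse (w' n) * w' i)"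
    have w0: "w0 \<in> W" "w0 n = 1"
      using w' smult by (auto simp: w0_def)
    define W0 where "W0 = {w \<in> W. w n = 0}"
    define v0 where "v0 = (\<lambda>i. v i + (- v n) * w0 i)"
    have red: "(\<lambda>i. w i + (- w n) * w0 i) \<in> W0" if "w \<in> W" for w
      using add[OF that smult[OF w0(1), of "- w n"]] w0 by (auto simp: W0_def)
    have "v0 \<notin> W0"
    proof
      assume "v0 \<in> W0"
      then have "(\<lambda>i. v0 i + v n * w0 i) \<in> W"
        using add[OF _ smult[OF w0(1)]] by (auto simp: W0_def)
      then show False using Suc.prems(6) by (simp add: v0_def)
    qed
    moreover have "w i = 0" if "w \<in> W0" "i \<ge> n" for w i
      using that Suc.prems(4)[of w i] by (cases "i = n") (auto simp: W0_def)
    moreover have "v0 i = 0" if "i \<ge> n" for i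
      using that Suc.prems(5)[of i] Suc.prems(4)[OF w0(1), of i] w0(2)
      by (cases "i = n") (auto simp: v0_def)
    moreover have "(\<lambda>i. a i + b i) \<in> W0" if "a \<in> W0" "b \<in> W0" for a b
      using add[of a b] that by (simp add: W0_def)
    moreover have "(\<lambda>i. c * a i) \<in> W0" if "a \<in> W0" for a c
      using smult[of a c] that by (simp add: W0_def)
    moreover have "(\<lambda>i. 0) \<in> W0" using zero by (simp add: W0_def)
    ultimately have "\<exists>y. (\<forall>w\<in>W0. (\<Sum>i<n. y i * w i) = 0) \<and> (\<Sum>i<n. y i * v0 i) \<noteq> 0"
      by (intro Suc.IH)
    then obtain y where y: "\<And>w. w \<in> W0 \<Longrightarrow> (\<Sum>i<n. y i * w i) = 0"
        "(\<Sum>i<n. y i * v0 i) \<noteq> 0"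
      by auto
    define y' where "y' = y(n := - (\<Sum>i<n. y i * w0 i))"
    have y': "(\<Sum>i<Suc n. y' i * u i) = (\<Sum>i<n. y i * (u i + (- u n) * w0 i))" for u
      by (simp add: y'_def algebra_simps sum.distrib sum_subtractf sum_distrib_left)
    show ?thesis
    proof (intro exI[of _ y'] conjI ballI)
      fix w assume "w \<in> W"
      from y(1)[OF red[OF this]] show "(\<Sum>i<Suc n. y' i * w i) = 0" unfolding y' .
    next
      show "(\<Sum>i<Suc n. y' i * v i) \<noteq> 0" using y(2) unfolding y' v0_def .
    qed
  next
    case False
    then have W: "w n = 0" if "w \<in> W" for w using that by auto
    show ?thesis
    proof (cases "v n = 0")
      case True
      have "w i = 0" if "w \<in> W" "i \<ge> n" for w i
        using that Suc.prems(4)[of w i] W by (cases "i = n") auto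
      moreover have "v i = 0" if "i \<ge> n" for i
        using that Suc.prems(5)[of i] True by (cases "i = n") auto
      ultimately have "\<exists>y. (\<forall>w\<in>W. (\<Sum>i<n. y i * w i) = 0) \<and> (\<Sum>i<n. y i * v i) \<noteq> 0"
        by (intro Suc.IH add smult zero Suc.prems(6))
      then obtain y where y: "\<And>w. w \<in> W \<Longrightarrow> (\<Sum>i<n. y i * w i) = 0"
          "(\<Sum>i<n. y i * v i) \<noteq> 0"
        by auto
      then show ?thesis using W True by (intro exI[of _ y]) auto
    next
      case False
      then show ?thesis using W by (intro exI[of _ "\<lambda>i. if i = n then 1 else 0"]) auto
    qed
  qed
qed

text \<open>Functionals are represented by vectors, through the standard scalar product. This lemma is the main tool
below: membership in a submodule is tested by scalar functions, which are polynomials.\<close>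

lemma separating_functional:
  fixes W :: "'k::field vec set"
  assumes W: "lin_subspace n W" and v: "v \<in> carrier_vec n" "v \<notin> W"
  obtains y where "y \<in> carrier_vec n" "\<And>w. w \<in> W \<Longrightarrow> y \<bullet> w = 0" "y \<bullet> v \<noteq> 0"
proof -
  define f where "f = (\<lambda>(w::'k vec) i. if i < n then w $ i else 0)"
  have f_add: "(\<lambda>i. f a i + f b i) = f (a + b)" if "a \<in> W" "b \<in> W" for a b
    using that[THEN lin_subspaceD(1)[OF W]] by (auto simp: f_def fun_eq_iff)
  have f_smult: "(\<lambda>i. c * f a i) = f (c \<cdot>\<^sub>v a)" if "a \<in> W" for a c
    using that[THEN lin_subspaceD(1)[OF W]] by (auto simp: f_def fun_eq_iff)
  have inj: "a = b" if "f a = f b" "a \<in> carrier_vec n" "b \<in> carrier_vec n" for a b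
    using that by (intro eq_vecI) (auto simp: f_def fun_eq_iff, metis)
  have "\<exists>y. (\<forall>w\<in>f ` W. (\<Sum>i<n. y i * w i) = 0) \<and> (\<Sum>i<n. y i * f v i) \<noteq> 0"
  proof (rule separating_functional_aux)
    show "(\<lambda>i. 0) \<in> f ` W"
      using lin_subspaceD(2)[OF W] by (intro image_eqI[of _ _ "0\<^sub>v n"]) (auto simp: f_def)
    show "f v \<notin> f ` W" using v inj lin_subspaceD(1)[OF W] by blast
  qed (use lin_subspaceD[OF W] f_add f_smult in \<open>auto simp: f_def\<close>)
  then obtain y where y: "\<And>w. w \<in> W \<Longrightarrow> (\<Sum>i<n. y i * f w i) = 0" "(\<Sum>i<n. y i * f v i) \<noteq> 0"
    by auto
  have eq: "vec n y \<bullet> w = (\<Sum>i<n. y i * f w i)" if "w \<in> carrier_vec n" for w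
    using that by (auto simp: scalar_prod_def f_def atLeast0LessThan)
  show thesis
    using y v by (intro that[of "vec n y"]) (auto simp: eq lin_subspaceD(1)[OF W])
qed

subsection \<open>Dimension of a subspace\<close>

definition sdim :: "nat \<Rightarrow> 'k::field vec set \<Rightarrow> nat" where
  "sdim n X = vectorspace.dim class_ring ((module_vec TYPE('k) n)\<lparr>carrier := X\<rparr>)"

lemma vectorspace_lin_subspace:
  fixes X :: "'k::field vec set"
  assumes "lin_subspace n X"
  shows "vectorspace class_ring ((module_vec TYPE('k) n)\<lparr>carrier := X\<rparr>)"
  by (rule vectorspace.subspace_is_vs[OF vec_vs]) (simp add: subspace_iff_lin_subspace assms)

text \<open>Linearly independent subsets of \<open>X\<close> have at most \<open>n\<close> elements, so there is a maximal one.\<close>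

lemma lin_subspace_finite_basis:
  fixes X :: "'k::field vec set"
  assumes "lin_subspace n X"
  shows "vectorspace.fin_dim class_ring ((module_vec TYPE('k) n)\<lparr>carrier := X\<rparr>)"
proof -
  interpret V: vec_space "TYPE('k)" n .
  let ?X = "(module_vec TYPE('k) n)\<lparr>carrier := X\<rparr>"
  interpret X: vectorspace class_ring ?X by (rule vectorspace_lin_subspace[OF assms])
  have sub: "submodule class_ring X (module_vec TYPE('k) n)"
    using assms subspace_iff_lin_subspace[of X n] by (simp add: subspace_def)
  have li: "finite S \<and> card S \<le> n" if "S \<subseteq> carrier ?X \<and> X.lin_indpt S" for S
  proof -
    have S: "S \<subseteq> carrier_vec n" "V.lin_indpt S"
      using that assms V.span_li_not_depend(2)[OF _ sub, of S] by (auto simp: lin_subspace_def)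
    show ?thesis using V.li_le_dim[OF V.fin_dim S] by (simp add: V.dim_is_n)
  qed
  have "X.lin_indpt {}" by (simp add: X.lin_dep_def)
  then obtain A where A: "finite A" "maximal A (\<lambda>S. S \<subseteq> carrier ?X \<and> X.lin_indpt S)"
    using maximal_exists[of "\<lambda>S. S \<subseteq> carrier ?X \<and> X.lin_indpt S" n "{}"] li by auto
  show ?thesis
    unfolding X.fin_dim_def using X.max_li_is_basis[OF A(2)] A(1) by (auto simp: X.basis_def)
qed

lemma sdim_rank_nullity:
  fixes X :: "'k::field vec set"
  assumes X: "lin_subspace n X" and A: "A \<in> carrier_mat d n"
  shows "sdim n X = sdim n {x \<in> X. A *\<^sub>v x = 0\<^sub>v d} + sdim d ((\<lambda>x. A *\<^sub>v x) ` X)"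
proof -
  let ?X = "(module_vec TYPE('k) n)\<lparr>carrier := X\<rparr>" and ?D = "module_vec TYPE('k) d"
  interpret linear_map class_ring ?X ?D "\<lambda>x. A *\<^sub>v x"
  proof (intro linear_map.intro vectorspace_lin_subspace[OF X] vec_vs mod_hom.intro
        mod_hom_axioms.intro)
    show "module class_ring ?X" "module class_ring ?D"
      using vectorspace_lin_subspace[OF X] vec_vs by (auto simp: vectorspace_def)
    show "(\<lambda>x. A *\<^sub>v x) \<in> LinearCombinations.module_hom class_ring ?X ?D"
      using A X by (auto simp: LinearCombinations.module_hom_def module_vec_simps class_ring_simps lin_subspace_def
          subset_iff mult_add_distrib_mat_vec[OF A] mult_mat_vec[OF A])
  qed
  have "kerT = {x \<in> X. A *\<^sub>v x = 0\<^sub>v d}" by (auto simp: ker_def module_vec_simps)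
  moreover have "imT = (\<lambda>x. A *\<^sub>v x) ` X" by (auto simp: im_def)
  ultimately show ?thesis
    using rank_nullity[OF lin_subspace_finite_basis[OF X]] by (simp add: sdim_def add.commute)
qed

lemma sdim_eq_0_iff:
  fixes X :: "'k::field vec set"
  assumes X: "lin_subspace n X"
  shows "sdim n X = 0 \<longleftrightarrow> X = {0\<^sub>v n}"
proof -
  interpret X: vectorspace class_ring "(module_vec TYPE('k) n)\<lparr>carrier := X\<rparr>"
    by (rule vectorspace_lin_subspace[OF assms])
  have e: "X.span {} = {0\<^sub>v n}" using X.span_empty by (simp add: module_vec_simps)
  show ?thesis
  proof
    assume "sdim n X = 0"
    moreover obtain B where B: "finite B" "X.basis B"
      using X.finite_basis_exists[OF lin_subspace_finite_basis[OF X]] by auto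
    ultimately have "B = {}" using X.dim_basis[of B] by (auto simp: sdim_def)
    then show "X = {0\<^sub>v n}" using B(2) e by (auto simp: X.basis_def)
  next
    assume *: "X = {0\<^sub>v n}"
    have "X.span {} = X" unfolding e using * by (rule sym)
    then have "X.basis {}" by (simp add: X.basis_def X.lin_dep_def)
    then show "sdim n X = 0" using X.dim_basis[of "{}"] by (simp add: sdim_def)
  qed
qed

lemma sdim_carrier: "sdim n (carrier_vec n :: 'k::field vec set) = n"
proof -
  interpret V: vec_space "TYPE('k)" n .
  have *: "(module_vec TYPE('k) n)\<lparr>carrier := carrier_vec n\<rparr> = module_vec TYPE('k) n"
    by (simp add: module_vec_def)
  show ?thesis unfolding sdim_def * by (rule V.dim_is_n)
qed

lemma sdim_strict_mono:
  fixes X Y :: "'k::field vec set"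
  assumes X: "lin_subspace n X" and Y: "lin_subspace n Y" and XY: "X \<subset> Y"
  shows "sdim n X < sdim n Y"
proof -
  interpret X: vectorspace class_ring "(module_vec TYPE('k) n)\<lparr>carrier := X\<rparr>"
    by (rule vectorspace_lin_subspace[OF X])
  interpret Y: vectorspace class_ring "(module_vec TYPE('k) n)\<lparr>carrier := Y\<rparr>"
    by (rule vectorspace_lin_subspace[OF Y])
  have sub: "submodule class_ring X ((module_vec TYPE('k) n)\<lparr>carrier := Y\<rparr>)"
    using X XY by (intro submodule.intro Y.module_axioms)
      (auto simp: lin_subspace_def module_vec_simps class_ring_simps)
  obtain B where B: "finite B" "X.basis B"
    using X.finite_basis_exists[OF lin_subspace_finite_basis[OF X]] by auto
  have BX: "B \<subseteq> X" using B(2) by (auto simp: X.basis_def)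
  have li: "Y.lin_indpt B"
    using Y.span_li_not_depend(2)[OF BX sub] B(2) by (auto simp: X.basis_def)
  have span: "Y.span B = X"
    using Y.span_li_not_depend(1)[OF BX sub] B(2) by (auto simp: X.basis_def)
  have BY: "B \<subseteq> carrier ((module_vec TYPE('k) n)\<lparr>carrier := Y\<rparr>)" using BX XY by auto
  have fd: "Y.fin_dim" by (rule lin_subspace_finite_basis[OF Y])
  show ?thesis
  proof (rule ccontr)
    assume "\<not> ?thesis"
    then have "Y.dim \<le> card B" using X.dim_basis[OF B] by (simp add: sdim_def)
    then have "Y.basis B" by (intro Y.dim_li_is_basis fd B(1) BY li)
    then show False using span XY by (auto simp: Y.basis_def)
  qed
qed

text \<open>Restriction to the coordinates in \<open>J\<close> identifies the subspace with the space of all vectors of length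
\<open>card J\<close>.\<close>

lemma sdim_coordinate_subspace:
  assumes J: "J \<subseteq> {..<n}"
  shows "sdim n {v \<in> carrier_vec n. \<forall>i<n. i \<notin> J \<longrightarrow> v $ i = (0::'k::field)} = card J"
    (is "sdim n ?X = _")
proof -
  have "finite J" using J finite_subset by auto
  then obtain e where e: "bij_betw e {..<card J} J"
    using ex_bij_betw_nat_finite atLeast0LessThan by metis
  have e_lt: "e i < n" if "i < card J" for i using e that J by (auto simp: bij_betw_def)
  define A where "A = mat (card J) n (\<lambda>(i, j). if j = e i then 1 else (0::'k))"
  have A: "A \<in> carrier_mat (card J) n" by (simp add: A_def)
  have Av: "(A *\<^sub>v v) $ i = v $ e i" if "v \<in> carrier_vec n" "i < card J" for v i
  proof -
    have "(A *\<^sub>v v) $ i = (\<Sum>j<n. (if j = e i then 1 else 0) * v $ j)"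
      using that by (simp add: A_def scalar_prod_def atLeast0LessThan)
    also have "\<dots> = (\<Sum>j<n. if j = e i then v $ j else 0)" by (intro sum.cong) auto
    finally show ?thesis using e_lt[OF that(2)] by simp
  qed
  have X: "lin_subspace n ?X" by (auto simp: lin_subspace_def)
  have "{x \<in> ?X. A *\<^sub>v x = 0\<^sub>v (card J)} = {0\<^sub>v n}"
  proof (intro equalityI subsetI)
    fix x assume x: "x \<in> {x \<in> ?X. A *\<^sub>v x = 0\<^sub>v (card J)}"
    have "x $ j = 0" if "j < n" for j
    proof (cases "j \<in> J")
      case True
      then obtain i where i: "i < card J" "e i = j" using e by (force simp: bij_betw_def)
      have "x \<in> carrier_vec n" "A *\<^sub>v x = 0\<^sub>v (card J)" using x by auto
      with Av[of x i] i show ?thesis by simp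
    qed (use x that in auto)
    then show "x \<in> {0\<^sub>v n}" using x by (auto intro!: eq_vecI)
  qed (use A in auto)
  moreover have "(\<lambda>x. A *\<^sub>v x) ` ?X = carrier_vec (card J)"
  proof (intro equalityI subsetI)
    fix y :: "'k vec" assume y: "y \<in> carrier_vec (card J)"
    define x where "x = vec n (\<lambda>j. if j \<in> J then y $ (the_inv_into {..<card J} e j) else 0)"
    have "x \<in> ?X" by (auto simp: x_def)
    moreover have "A *\<^sub>v x = y"
    proof (rule eq_vecI)
      fix i assume i: "i < dim_vec y"
      then have "(A *\<^sub>v x) $ i = x $ e i" using Av[of x i] y by (simp add: x_def)
      also have "\<dots> = y $ i"
        using i y e e_lt[of i] the_inv_into_f_f[of e "{..<card J}" i]
        by (auto simp: x_def bij_betw_def)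
      finally show "(A *\<^sub>v x) $ i = y $ i" .
    qed (use A y in auto)
    ultimately show "y \<in> (\<lambda>x. A *\<^sub>v x) ` ?X" by auto
  qed (use A in auto)
  moreover have "sdim n {0\<^sub>v n :: 'k vec} = 0"
    using sdim_eq_0_iff[OF lin_subspace_zero] by blast
  ultimately show ?thesis
    using sdim_rank_nullity[OF X A] by (simp add: sdim_carrier)
qed

section \<open>Polynomial and Laurent polynomial functions\<close>

text \<open>If the field were finite, one plus the product of all \<open>X - a\<close> would have no root.\<close>

lemma infinite_UNIV_alg_closed_field: "infinite (UNIV :: 'k::alg_closed_field set)"
proof
  assume fin: "finite (UNIV :: 'k set)"
  define q :: "'k poly" where "q = (\<Prod>a\<in>UNIV. [:-a, 1:])"
  have "poly q x = 0" for x using fin by (auto simp: q_def poly_prod)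
  then have "poly (q + 1) x \<noteq> 0" for x by simp
  moreover have "degree q = card (UNIV :: 'k set)"
    unfolding q_def by (subst degree_prod_sum_eq) auto
  then have "degree q > 0" using fin by (simp add: card_gt_0_iff)
  then have "degree (q + 1) > 0" by (simp add: degree_add_eq_left)
  ultimately show False using alg_closed_imp_poly_has_root by blast
qed

lemma poly_eqI_nonzero:
  fixes q r :: "'k::alg_closed_field poly"
  assumes "\<And>x. x \<noteq> 0 \<Longrightarrow> poly q x = poly r x"
  shows "q = r"
proof (rule ccontr)
  assume "q \<noteq> r"
  then have "finite {x. poly (q - r) x = 0}" by (intro poly_roots_finite) auto
  moreover have "UNIV - {0} \<subseteq> {x. poly (q - r) x = 0}" using assms by auto
  ultimately have "finite (UNIV - {0::'k})" using finite_subset by blast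
  then show False using infinite_UNIV_alg_closed_field by auto
qed

lemma inverse_square_power:
  "inverse (t * t) ^ i = t powi (- 2 * int i)" for t :: "'k::field"
  by (simp add: power_int_minus power_inverse power_int_mult power_mult_distrib power2_eq_square flip: power_mult)

text \<open>Linear independence of the characters of the torus. Multiplying by a power of \<open>t\<close> reduces it to
polynomials.\<close>

lemma laurent_eqI:
  fixes a b :: "int \<Rightarrow> 'k::alg_closed_field"
  assumes J: "finite I" "\<And>m. m \<notin> I \<Longrightarrow> a m = 0" "finite J" "\<And>m. m \<notin> J \<Longrightarrow> b m = 0"
    and eq: "\<And>t. t \<noteq> 0 \<Longrightarrow> (\<Sum>m\<in>I. t powi m * a m) = (\<Sum>m\<in>J. t powi m * b m)"
  shows "a = b"
proof
  fix m
  define H where "H = insert m (I \<union> J)"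
  have H: "finite H" using J by (simp add: H_def)
  define K where "K = Max ((\<lambda>j. nat (- j)) ` H)"
  have K: "j + int K \<ge> 0" if "j \<in> H" for j
  proof -
    have "nat (- j) \<le> K" unfolding K_def using H that by (intro Max_ge) auto
    then show ?thesis by linarith
  qed
  define P where "P = (\<lambda>c::int \<Rightarrow> 'k. \<Sum>j\<in>H. monom (c j) (nat (j + int K)))"
  have P: "poly (P c) t = t ^ K * (\<Sum>j\<in>H. t powi j * c j)" if "t \<noteq> 0" for c t
  proof -
    have "t ^ nat (j + int K) = t ^ K * t powi j" if "j \<in> H" for j
    proof -
      have "t ^ nat (j + int K) = t powi (j + int K)"
        using K[OF that] by (simp add: power_int_def)
      then show ?thesis using \<open>t \<noteq> 0\<close> by (simp add: power_int_add)
    qed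
    then show ?thesis
      by (simp add: P_def poly_sum poly_monom sum_distrib_left mult_ac)
  qed
  have coeff_P: "coeff (P c) (nat (m + int K)) = c m" for c
  proof -
    have "nat (j + int K) = nat (m + int K) \<longleftrightarrow> j = m" if "j \<in> H" for j
      using K[OF that] K[of m] by (auto simp: H_def)
    then have "coeff (P c) (nat (m + int K)) = (\<Sum>j\<in>H. if j = m then c j else 0)"
      unfolding P_def coeff_sum coeff_monom by (intro sum.cong) auto
    also have "\<dots> = c m" using H by (simp add: H_def)
    finally show ?thesis .
  qed
  have "(\<Sum>j\<in>H. t powi j * a j) = (\<Sum>j\<in>H. t powi j * b j)" if "t \<noteq> 0" for t
  proof -
    have "(\<Sum>j\<in>H. t powi j * a j) = (\<Sum>j\<in>I. t powi j * a j)"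
      using H J by (intro sum.mono_neutral_right) (auto simp: H_def)
    moreover have "(\<Sum>j\<in>H. t powi j * b j) = (\<Sum>j\<in>J. t powi j * b j)"
      using H J by (intro sum.mono_neutral_right) (auto simp: H_def)
    ultimately show ?thesis using eq[OF that] by simp
  qed
  then have "P a = P b" by (intro poly_eqI_nonzero) (simp add: P)
  then show "a m = b m" using coeff_P by metis
qed

section \<open>Elements of SL2 and rational modules\<close>

definition mat2 :: "'k \<Rightarrow> 'k \<Rightarrow> 'k \<Rightarrow> 'k \<Rightarrow> 'k::field mat" where
  "mat2 a b c d = mat_of_rows_list 2 [[a, b], [c, d]]"

lemma mat2_index [simp]:
  "mat2 a b c d $$ (0, 0) = a" "mat2 a b c d $$ (0, Suc 0) = b"
  "mat2 a b c d $$ (Suc 0, 0) = c" "mat2 a b c d $$ (Suc 0, Suc 0) = d"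
  "mat2 a b c d $$ (0, 1) = b" "mat2 a b c d $$ (1, 0) = c" "mat2 a b c d $$ (1, 1) = d"
  by (auto simp: mat2_def mat_of_rows_list_def)

lemma mat2_carrier [simp]: "mat2 a b c d \<in> carrier_mat 2 2"
  by (auto simp: mat2_def mat_of_rows_list_def numeral_2_eq_2)

lemma mat2_dim [simp]: "dim_row (mat2 a b c d) = 2" "dim_col (mat2 a b c d) = 2"
  using mat2_carrier by blast+

lemma sum_less_2: "(\<Sum>i<(2::nat). f i) = f 0 + f 1" "(\<Sum>i = 0..<(2::nat). f i) = f 0 + f 1"
  by (simp_all add: numeral_2_eq_2)

lemma less_2_iff: "(i::nat) < 2 \<longleftrightarrow> i = 0 \<or> i = 1" by auto

lemma mat2_eqI:
  assumes "g \<in> carrier_mat 2 2" "g $$ (0, 0) = a" "g $$ (0, 1) = b" "g $$ (1, 0) = c" "g $$ (1, 1) = d"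
  shows "g = mat2 a b c d"
  using assms by (intro eq_matI) (auto simp: less_2_iff)

lemma mat2_cong:
  "a = a' \<Longrightarrow> b = b' \<Longrightarrow> c = c' \<Longrightarrow> d = d' \<Longrightarrow> mat2 a b c d = mat2 a' b' c' d'"
  by simp

lemma mat2_mult:
  "mat2 a b c d * mat2 a' b' c' d' =
     mat2 (a * a' + b * c') (a * b' + b * d') (c * a' + d * c') (c * b' + d * d')"
  by (rule mat2_eqI) (auto simp: scalar_prod_def sum_less_2 intro!: mult_carrier_mat)

lemma det_mat2: "det (mat2 a b c d) = a * d - b * (c::'k::field)"
proof -
  have "det (mat2 a b c d) = (\<Sum>i<2. mat2 a b c d $$ (i, 0) * cofactor (mat2 a b c d) i 0)"
    by (rule laplace_expansion_column) auto
  also have "\<dots> = a * d - b * c"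
    by (simp add: sum_less_2 cofactor_def mat_delete_def det_single algebra_simps)
  finally show ?thesis .
qed

lemma mat2_in_SL2: "mat2 a b c d \<in> carrier SL2 \<longleftrightarrow> a * d - b * c = 1"
  by (simp add: SL2_def det_mat2)

lemma SL2_cases:
  assumes "g \<in> carrier SL2"
  obtains a b c d where "g = mat2 a b c d" "a * d - b * c = 1"
proof -
  have g: "g \<in> carrier_mat 2 2" using assms by (simp add: SL2_def)
  have *: "g = mat2 (g $$ (0, 0)) (g $$ (0, 1)) (g $$ (1, 0)) (g $$ (1, 1))"
    by (rule mat2_eqI) (use g in auto)
  show thesis by (rule that[OF *]) (use assms * mat2_in_SL2 in metis)
qed

lemma SL2_simps: "mult SL2 = (*)" "one SL2 = 1\<^sub>m 2" by (auto simp: SL2_def)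

lemma one_mat2: "1\<^sub>m 2 = mat2 1 0 0 1"
  by (rule mat2_eqI) auto

lemma SL2_mult_closed: "g \<in> carrier SL2 \<Longrightarrow> h \<in> carrier SL2 \<Longrightarrow> g * h \<in> carrier SL2"
  by (auto simp: SL2_def det_mult)

lemma SL2_one_closed: "1\<^sub>m 2 \<in> carrier SL2"
  by (auto simp: SL2_def)

lemma SL2_inverse:
  assumes "g \<in> carrier SL2"
  obtains h where "h \<in> carrier SL2" "g * h = 1\<^sub>m 2" "h * g = 1\<^sub>m 2"
proof -
  obtain a b c d where g: "g = mat2 a b c d" "a * d - b * c = 1" using SL2_cases[OF assms] .
  show thesis
    by (rule that[of "mat2 d (- b) (- c) a"])
      (use g in \<open>auto simp: mat2_in_SL2 mat2_mult one_mat2 algebra_simps\<close>)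
qed

lemma torus_eq: "torus t = mat2 t 0 0 (inverse t)"
  by (simp add: torus_def mat2_def)

lemma torus_in_SL2: "t \<noteq> 0 \<Longrightarrow> torus t \<in> carrier SL2"
  by (simp add: torus_eq mat2_in_SL2)

lemma torus_mult: "torus (s * t) = torus s * torus (t::'k::field)"
  by (simp add: torus_eq mat2_mult)

lemma torus_one: "torus 1 = (1\<^sub>m 2 :: 'k::field mat)"
  by (simp add: torus_eq one_mat2)

subsection \<open>Scalar products and matrices\<close>

lemma scalar_prod_mult_mat_vec:
  assumes "A \<in> carrier_mat n m" "v \<in> carrier_vec m"
  shows "y \<bullet> (A *\<^sub>v v) = (\<Sum>i<n. \<Sum>j<m. y $ i * A $$ (i, j) * v $ j)"
  using assms
  by (auto simp: scalar_prod_def atLeast0LessThan sum_distrib_left mult_ac intro!: sum.cong)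

lemma scalar_prod_transpose:
  fixes A :: "'k::field mat"
  assumes "A \<in> carrier_mat n m" "v \<in> carrier_vec m" "y \<in> carrier_vec n"
  shows "y \<bullet> (A *\<^sub>v v) = (A\<^sup>T *\<^sub>v y) \<bullet> v"
  using transpose_vec_mult_scalar[OF assms] by simp

lemma vec_eqI_scalar_prod:
  fixes u v :: "'k::field vec"
  assumes "u \<in> carrier_vec n" "v \<in> carrier_vec n" "\<And>y. y \<in> carrier_vec n \<Longrightarrow> y \<bullet> u = y \<bullet> v"
  shows "u = v"
proof (rule eq_vecI)
  fix i assume "i < dim_vec v"
  then show "u $ i = v $ i"
    using assms(1,2) assms(3)[of "unit_vec n i"] by (simp add: scalar_prod_left_unit)
qed (use assms in auto)

subsection \<open>Rational modules\<close>

text \<open>The homomorphism takes values in the group of units, so it sends the identity to an invertible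
idempotent, the identity matrix.\<close>

lemma rational_moduleD:
  assumes "rational_module M"
  shows "g \<in> carrier SL2 \<Longrightarrow> act M g \<in> carrier_mat (gdim M) (gdim M)"
    and "g \<in> carrier SL2 \<Longrightarrow> h \<in> carrier SL2 \<Longrightarrow> act M (g * h) = act M g * act M h"
    and "act M (1\<^sub>m 2) = 1\<^sub>m (gdim M)"
proof -
  have hom: "act M \<in> hom SL2 (GL (gdim M))" using assms by (simp add: rational_module_def)
  have U: "act M g \<in> Units (ring_mat TYPE('a) (gdim M) ())" if "g \<in> carrier SL2" for g
    using hom that by (auto simp: hom_def units_of_def)
  show C: "act M g \<in> carrier_mat (gdim M) (gdim M)" if "g \<in> carrier SL2" for g
    using U[OF that] by (auto simp: Units_def ring_mat_simps)
  show mult: "act M (g * h) = act M g * act M h" if "g \<in> carrier SL2" "h \<in> carrier SL2" for g h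
    using hom that by (auto simp: hom_def units_of_def SL2_simps ring_mat_simps)
  let ?e = "act M (1\<^sub>m 2)"
  have e: "?e \<in> carrier_mat (gdim M) (gdim M)" by (rule C[OF SL2_one_closed])
  obtain h where h: "h \<in> carrier_mat (gdim M) (gdim M)" "h * ?e = 1\<^sub>m (gdim M)"
    using U[OF SL2_one_closed] by (auto simp: Units_def ring_mat_simps)
  have "?e * ?e = ?e" using mult[OF SL2_one_closed SL2_one_closed] by simp
  then have "h * ?e = (h * ?e) * ?e" using h(1) e by (simp add: assoc_mult_mat[of _ "gdim M" "gdim M" _ "gdim M" _ "gdim M"])
  then show "?e = 1\<^sub>m (gdim M)" using h e by simp
qed

lemma rational_moduleI:
  assumes C: "\<And>g. g \<in> carrier SL2 \<Longrightarrow> act M g \<in> carrier_mat (gdim M) (gdim M)"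
    and mult: "\<And>g h. g \<in> carrier SL2 \<Longrightarrow> h \<in> carrier SL2 \<Longrightarrow> act M (g * h) = act M g * act M h"
    and one: "act M (1\<^sub>m 2) = 1\<^sub>m (gdim M)"
    and reg: "\<And>i j. i < gdim M \<Longrightarrow> j < gdim M \<Longrightarrow>
      \<exists>f\<in>regular_functions. \<forall>g\<in>carrier SL2. act M g $$ (i, j) = f g"
  shows "rational_module (M :: 'k::field gmodule)"
proof -
  have "act M g \<in> Units (ring_mat TYPE('k) (gdim M) ())" if g: "g \<in> carrier SL2" for g
  proof -
    obtain h where h: "h \<in> carrier SL2" "g * h = 1\<^sub>m 2" "h * g = 1\<^sub>m 2" using SL2_inverse[OF g] .
    have "act M h * act M g = 1\<^sub>m (gdim M)" "act M g * act M h = 1\<^sub>m (gdim M)"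
      using mult[OF g h(1)] mult[OF h(1) g] h one by auto
    then show ?thesis using C[OF g] C[OF h(1)] by (auto simp: Units_def ring_mat_simps)
  qed
  then show ?thesis
    using mult reg by (auto simp: rational_module_def hom_def units_of_def SL2_simps ring_mat_simps)
qed

lemma act_act:
  assumes "rational_module M" "g \<in> carrier SL2" "h \<in> carrier SL2" "v \<in> carrier_vec (gdim M)"
  shows "act M g *\<^sub>v (act M h *\<^sub>v v) = act M (g * h) *\<^sub>v v"
  using assms rational_moduleD[OF assms(1)]
  by (simp add: assoc_mult_mat_vec[of _ "gdim M" "gdim M" _ "gdim M"])

lemma act_carrier:
  assumes "rational_module M" "g \<in> carrier SL2" "v \<in> carrier_vec (gdim M)"
  shows "act M g *\<^sub>v v \<in> carrier_vec (gdim M)"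
  using assms rational_moduleD(1)[OF assms(1,2)] by auto

lemma regular_sum:
  "finite I \<Longrightarrow> (\<And>i. i \<in> I \<Longrightarrow> f i \<in> regular_functions) \<Longrightarrow>
     (\<lambda>g. \<Sum>i\<in>I. f i g) \<in> regular_functions"
  by (induction I rule: finite_induct) (auto intro: regular_functions.intros)

text \<open>Functionals composed with orbit maps are regular. The arguments about rational modules below restrict
such a function to the torus or to a unipotent subgroup, where it becomes a Laurent polynomial or a polynomial.\<close>

lemma matrix_coefficient_regular:
  fixes M :: "'k::field gmodule"
  assumes M: "rational_module M" and v: "v \<in> carrier_vec (gdim M)"
  obtains f where "f \<in> regular_functions" "\<And>g. g \<in> carrier SL2 \<Longrightarrow> y \<bullet> (act M g *\<^sub>v v) = f g"
proof -
  have "\<forall>i j. \<exists>f. i < gdim M \<longrightarrow> j < gdim M \<longrightarrow> f \<in> regular_functions \<and>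
      (\<forall>g\<in>carrier SL2. act M g $$ (i, j) = f g)"
    using M unfolding rational_module_def by blast
  then obtain f where f: "\<And>i j. i < gdim M \<Longrightarrow> j < gdim M \<Longrightarrow> f i j \<in> regular_functions"
    "\<And>i j g. i < gdim M \<Longrightarrow> j < gdim M \<Longrightarrow> g \<in> carrier SL2 \<Longrightarrow> act M g $$ (i, j) = f i j g"
    by metis
  show thesis
  proof (rule that)
    show "(\<lambda>g. \<Sum>i<gdim M. \<Sum>j<gdim M. y $ i * f i j g * v $ j) \<in> regular_functions"
      by (intro regular_sum regular_functions.mult regular_functions.const f) auto
    show "y \<bullet> (act M g *\<^sub>v v) = (\<Sum>i<gdim M. \<Sum>j<gdim M. y $ i * f i j g * v $ j)"
      if "g \<in> carrier SL2" for g
      using that v f(2) by (simp add: scalar_prod_mult_mat_vec[OF rational_moduleD(1)[OF M]])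
  qed
qed

lemma regular_along_polynomial_curve:
  fixes f :: "'k::field mat \<Rightarrow> 'k"
  assumes "f \<in> regular_functions" "\<And>i j. i < 2 \<Longrightarrow> j < 2 \<Longrightarrow> \<exists>P. \<forall>x. c x $$ (i, j) = poly P x"
  shows "\<exists>P. \<forall>x. f (c x) = poly P x"
  using assms(1)
proof induction
  case (const a)
  show ?case by (intro exI[of _ "[:a:]"]) simp
next
  case (add f h)
  then show ?case by (metis poly_add)
next
  case (mult f h)
  then show ?case by (metis poly_mult)
qed (use assms(2) in auto)

abbreviation lower :: "'k::field \<Rightarrow> 'k mat" where "lower s \<equiv> mat2 1 0 s 1"
abbreviation upper :: "'k::field \<Rightarrow> 'k mat" where "upper s \<equiv> mat2 1 s 0 1"

lemma lower_SL2: "lower s \<in> carrier SL2" and upper_SL2: "upper s \<in> carrier SL2"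
  by (simp_all add: mat2_in_SL2)

lemma regular_along_mat2:
  fixes f :: "'k::field mat \<Rightarrow> 'k"
  assumes "f \<in> regular_functions"
  obtains P where "\<And>x. f (mat2 (poly a x) (poly b x) (poly c x) (poly d x)) = poly P x"
proof -
  have "\<exists>P. \<forall>x. f (mat2 (poly a x) (poly b x) (poly c x) (poly d x)) = poly P x"
    by (rule regular_along_polynomial_curve[OF assms]) (auto simp: less_2_iff)
  then show thesis using that by auto
qed

lemma regular_along_unipotent:
  fixes f :: "'k::field mat \<Rightarrow> 'k"
  assumes "f \<in> regular_functions"
  shows "\<exists>P. \<forall>x. f (lower x) = poly P x" and "\<exists>P. \<forall>x. f (upper x) = poly P x"
    and "\<exists>P. \<forall>x. f (mat2 x 1 (- 1) 0) = poly P x"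
  using regular_along_mat2[OF assms, where a = 1 and b = 0 and c = "[:0, 1:]" and d = 1]
    regular_along_mat2[OF assms, where a = 1 and b = "[:0, 1:]" and c = 0 and d = 1]
    regular_along_mat2[OF assms, where a = "[:0, 1:]" and b = 1 and c = "- 1" and d = 0]
  by (simp_all, metis+)

lemma regular_along_torus:
  fixes f :: "'k::field mat \<Rightarrow> 'k"
  assumes "f \<in> regular_functions"
  shows "\<exists>J a. finite J \<and> (\<forall>m. m \<notin> J \<longrightarrow> a m = 0) \<and>
     (\<forall>t. t \<noteq> 0 \<longrightarrow> f (torus t) = (\<Sum>m\<in>J. t powi m * a m))"
proof -
  have "\<exists>P K. \<forall>t. t \<noteq> 0 \<longrightarrow> f (torus t) * t ^ K = poly P t"
    using assms
  proof induction
    case (const a)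
    show ?case by (intro exI[of _ "[:a:]"] exI[of _ 0]) simp
  next
    case (entry i j)
    consider "i = 0" "j = 0" | "i = 1" "j = 1" | "i \<noteq> j" using entry by (auto simp: less_2_iff)
    then show ?case
    proof cases
      case 1
      show ?thesis by (intro exI[of _ "[:0, 1:]"] exI[of _ 0]) (simp add: 1 torus_eq)
    next
      case 2
      show ?thesis by (intro exI[of _ 1] exI[of _ 1]) (simp add: 2 torus_eq)
    next
      case 3
      then show ?thesis using entry
        by (intro exI[of _ 0] exI[of _ 0]) (auto simp: less_2_iff torus_eq)
    qed
  next
    case (add f h)
    then obtain P K Q L where
      "\<And>t. t \<noteq> 0 \<Longrightarrow> f (torus t) * t ^ K = poly P t" "\<And>t. t \<noteq> 0 \<Longrightarrow> h (torus t) * t ^ L = poly Q t"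
      by metis
    note * = this[symmetric]
    show ?case
      by (intro exI[of _ "P * monom 1 L + Q * monom 1 K"] exI[of _ "K + L"])
        (simp add: power_add * poly_monom algebra_simps)
  next
    case (mult f h)
    then obtain P K Q L where
      "\<And>t. t \<noteq> 0 \<Longrightarrow> f (torus t) * t ^ K = poly P t" "\<And>t. t \<noteq> 0 \<Longrightarrow> h (torus t) * t ^ L = poly Q t"
      by metis
    note * = this[symmetric]
    show ?case
      by (intro exI[of _ "P * Q"] exI[of _ "K + L"]) (simp add: power_add * mult_ac)
  qed
  then obtain P K where P: "\<And>t. t \<noteq> 0 \<Longrightarrow> f (torus t) * t ^ K = poly P t" by auto
  define J where "J = (\<lambda>i. int i - int K) ` {..degree P}"
  define a where "a = (\<lambda>m. if m \<in> J then coeff P (nat (m + int K)) else 0)"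
  have "f (torus t) = (\<Sum>m\<in>J. t powi m * a m)" if t: "t \<noteq> 0" for t
  proof -
    have "(\<Sum>m\<in>J. t powi m * a m) = (\<Sum>i\<le>degree P. t powi (int i - int K) * a (int i - int K))"
      unfolding J_def by (subst sum.reindex) (auto simp: inj_on_def)
    also have "\<dots> = (\<Sum>i\<le>degree P. coeff P i * t ^ i) / t ^ K"
      unfolding sum_divide_distrib
      by (intro sum.cong refl) (use t in \<open>auto simp: a_def J_def power_int_diff\<close>)
    also have "\<dots> = poly P t / t ^ K" by (simp add: poly_altdef)
    also have "\<dots> = f (torus t)" using P[OF t] t by (simp add: field_simps)
    finally show ?thesis ..
  qed
  moreover have "finite J" by (simp add: J_def)
  moreover have "a m = 0" if "m \<notin> J" for m using that by (simp add: a_def)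
  ultimately show ?thesis by blast
qed

section \<open>Weight spaces\<close>

lemma gsubmodule_iff:
  "gsubmodule M W \<longleftrightarrow> lin_subspace (gdim M) W \<and> (\<forall>g\<in>carrier SL2. \<forall>w\<in>W. act M g *\<^sub>v w \<in> W)"
  by (simp add: gsubmodule_def subspace_iff_lin_subspace)

lemma gsubmoduleD:
  assumes "gsubmodule M W"
  shows "lin_subspace (gdim M) W" "g \<in> carrier SL2 \<Longrightarrow> w \<in> W \<Longrightarrow> act M g *\<^sub>v w \<in> W"
    "w \<in> W \<Longrightarrow> w \<in> carrier_vec (gdim M)"
  using assms by (auto simp: gsubmodule_iff dest: lin_subspaceD(1))

lemma zero_mat_mult_vec:
  "v \<in> carrier_vec m \<Longrightarrow> 0\<^sub>m n m *\<^sub>v v = 0\<^sub>v n"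
  by (intro eq_vecI) (auto simp: scalar_prod_def)

lemma mult_mat_zero_vec:
  "A \<in> carrier_mat n m \<Longrightarrow> A *\<^sub>v 0\<^sub>v m = 0\<^sub>v n"
  by (intro eq_vecI) auto

lemma lin_subspace_weight_space:
  fixes M :: "'k::field gmodule"
  assumes M: "rational_module M"
  shows "lin_subspace (gdim M) (weight_space M m)"
proof -
  have C: "act M (torus t) \<in> carrier_mat (gdim M) (gdim M)" if "t \<noteq> 0" for t
    by (rule rational_moduleD(1)[OF M torus_in_SL2[OF that]])
  show ?thesis
    unfolding lin_subspace_def weight_space_def
    by (auto simp: mult_add_distrib_mat_vec[OF C] smult_add_distrib_vec[of _ "gdim M"]
        mult_mat_vec[OF C] smult_smult_assoc mult.commute mult_mat_zero_vec[OF C])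
qed

text \<open>The matrices \<open>P m\<close> are the projections onto the weight spaces: they are the coefficients of the
  Laurent polynomial \<open>t \<mapsto> act M (torus t)\<close>.\<close>

definition weight_projections :: "'k::field gmodule \<Rightarrow> int set \<Rightarrow> (int \<Rightarrow> 'k mat) \<Rightarrow> bool" where
  "weight_projections M J P \<longleftrightarrow> finite J \<and> (\<forall>m. P m \<in> carrier_mat (gdim M) (gdim M)) \<and>
     (\<forall>m. m \<notin> J \<longrightarrow> P m = 0\<^sub>m (gdim M) (gdim M)) \<and>
     (\<forall>t. \<forall>y\<in>carrier_vec (gdim M). \<forall>v\<in>carrier_vec (gdim M). t \<noteq> 0 \<longrightarrow>
        y \<bullet> (act M (torus t) *\<^sub>v v) = (\<Sum>m\<in>J. t powi m * (y \<bullet> (P m *\<^sub>v v))))"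

lemma weight_projections_exist:
  fixes M :: "'k::field gmodule"
  assumes M: "rational_module M"
  obtains J P where "weight_projections M J P"
proof -
  define n where "n = gdim M"
  have "\<forall>i j. \<exists>J a. i < n \<longrightarrow> j < n \<longrightarrow> finite J \<and> (\<forall>m. m \<notin> J \<longrightarrow> a m = 0) \<and>
     (\<forall>t. t \<noteq> 0 \<longrightarrow> act M (torus t) $$ (i, j) = (\<Sum>m\<in>J. t powi m * a m))"
  proof (intro allI)
    fix i j
    show "\<exists>J a. i < n \<longrightarrow> j < n \<longrightarrow> finite J \<and> (\<forall>m. m \<notin> J \<longrightarrow> a m = 0) \<and>
     (\<forall>t. t \<noteq> 0 \<longrightarrow> act M (torus t) $$ (i, j) = (\<Sum>m\<in>J. t powi m * a m))"
    proof (cases "i < n \<and> j < n")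
      case True
      then obtain f where f: "f \<in> regular_functions" "\<And>g. g \<in> carrier SL2 \<Longrightarrow> act M g $$ (i, j) = f g"
        using M unfolding rational_module_def n_def by blast
      show ?thesis using regular_along_torus[OF f(1)] f(2)[OF torus_in_SL2] by simp
    qed auto
  qed
  then obtain J a where "\<forall>i j. i < n \<longrightarrow> j < n \<longrightarrow> finite (J i j) \<and> (\<forall>m. m \<notin> J i j \<longrightarrow> a i j m = 0) \<and>
     (\<forall>t. t \<noteq> 0 \<longrightarrow> act M (torus t) $$ (i, j) = (\<Sum>m\<in>J i j. t powi m * a i j m))"
    unfolding choice_iff by blast
  then have Ja: "\<And>i j. i < n \<Longrightarrow> j < n \<Longrightarrow> finite (J i j)"
    "\<And>i j m. i < n \<Longrightarrow> j < n \<Longrightarrow> m \<notin> J i j \<Longrightarrow> a i j m = 0"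
    "\<And>i j t. i < n \<Longrightarrow> j < n \<Longrightarrow> t \<noteq> 0 \<Longrightarrow>
      act M (torus t) $$ (i, j) = (\<Sum>m\<in>J i j. t powi m * a i j m)"
    by blast+
  define I where "I = (\<Union>i<n. \<Union>j<n. J i j)"
  define P where "P = (\<lambda>m. mat n n (\<lambda>(i, j). a i j m))"
  have I: "finite I" using Ja(1) by (auto simp: I_def)
  have P: "P m \<in> carrier_mat n n" for m by (simp add: P_def)
  have ent: "act M (torus t) $$ (i, j) = (\<Sum>m\<in>I. t powi m * P m $$ (i, j))"
    if "i < n" "j < n" "t \<noteq> 0" for i j t
  proof -
    have "(\<Sum>m\<in>I. t powi m * P m $$ (i, j)) = (\<Sum>m\<in>I. t powi m * a i j m)"
      using that by (simp add: P_def)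
    also have "\<dots> = (\<Sum>m\<in>J i j. t powi m * a i j m)"
      using that I Ja(2) by (intro sum.mono_neutral_right) (auto simp: I_def)
    finally show ?thesis using Ja(3)[OF that] by simp
  qed
  have "y \<bullet> (act M (torus t) *\<^sub>v v) = (\<Sum>m\<in>I. t powi m * (y \<bullet> (P m *\<^sub>v v)))"
    if t: "t \<noteq> 0" and v: "v \<in> carrier_vec n" for t y v
  proof -
    have "y \<bullet> (act M (torus t) *\<^sub>v v) =
        (\<Sum>i<n. \<Sum>j<n. y $ i * (\<Sum>m\<in>I. t powi m * P m $$ (i, j)) * v $ j)"
      using scalar_prod_mult_mat_vec[OF rational_moduleD(1)[OF M torus_in_SL2[OF t]]] v t ent
      by (simp add: n_def)
    also have "\<dots> = (\<Sum>i<n. \<Sum>j<n. \<Sum>m\<in>I. t powi m * (y $ i * P m $$ (i, j) * v $ j))"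
      unfolding sum_distrib_left sum_distrib_right by (intro sum.cong refl) (simp only: mult_ac)
    also have "\<dots> = (\<Sum>i<n. \<Sum>m\<in>I. \<Sum>j<n. t powi m * (y $ i * P m $$ (i, j) * v $ j))"
      by (intro sum.cong refl sum.swap)
    also have "\<dots> = (\<Sum>m\<in>I. \<Sum>i<n. \<Sum>j<n. t powi m * (y $ i * P m $$ (i, j) * v $ j))"
      by (rule sum.swap)
    also have "\<dots> = (\<Sum>m\<in>I. t powi m * (y \<bullet> (P m *\<^sub>v v)))"
      by (simp add: scalar_prod_mult_mat_vec[OF P v] sum_distrib_left)
    finally show ?thesis .
  qed
  moreover have "P m = 0\<^sub>m n n" if "m \<notin> I" for m
    using that Ja(2) by (intro eq_matI) (auto simp: P_def I_def)
  ultimately have "weight_projections M I P"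
    using I P by (simp add: weight_projections_def n_def)
  then show thesis by (rule that)
qed

context
  fixes M :: "'k::alg_closed_field gmodule" and J P
  assumes M: "rational_module M" and JP: "weight_projections M J P"
begin

lemma projection_carrier: "P m \<in> carrier_mat (gdim M) (gdim M)"
  using JP by (simp add: weight_projections_def)

lemma projection_vec_carrier: "v \<in> carrier_vec (gdim M) \<Longrightarrow> P m *\<^sub>v v \<in> carrier_vec (gdim M)"
  using projection_carrier by (metis mult_mat_vec_carrier)

lemma torus_expansion:
  "t \<noteq> 0 \<Longrightarrow> y \<in> carrier_vec (gdim M) \<Longrightarrow> v \<in> carrier_vec (gdim M) \<Longrightarrow>
     y \<bullet> (act M (torus t) *\<^sub>v v) = (\<Sum>m\<in>J. t powi m * (y \<bullet> (P m *\<^sub>v v)))"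
  using JP by (simp add: weight_projections_def)

lemma projection_outside:
  "m \<notin> J \<Longrightarrow> y \<in> carrier_vec (gdim M) \<Longrightarrow> v \<in> carrier_vec (gdim M) \<Longrightarrow> y \<bullet> (P m *\<^sub>v v) = 0"
  using JP by (simp add: weight_projections_def zero_mat_mult_vec)

lemma projection_sum:
  assumes "y \<in> carrier_vec (gdim M)" "v \<in> carrier_vec (gdim M)"
  shows "y \<bullet> v = (\<Sum>m\<in>J. y \<bullet> (P m *\<^sub>v v))"
  using torus_expansion[of 1 y v] assms rational_moduleD(3)[OF M] by (simp add: torus_one)

text \<open>Comparison of coefficients: the entries \<open>y \<bullet> P m v\<close> are determined by the values of the Laurent
polynomial \<open>t \<mapsto> y \<bullet> torus t v\<close>.\<close>

lemma torus_coefficients: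
  assumes y: "y \<in> carrier_vec (gdim M)" and v: "v \<in> carrier_vec (gdim M)"
    and I: "finite I" "\<And>m. m \<notin> I \<Longrightarrow> b m = 0"
    and eq: "\<And>t. t \<noteq> 0 \<Longrightarrow> y \<bullet> (act M (torus t) *\<^sub>v v) = (\<Sum>m\<in>I. t powi m * b m)"
  shows "y \<bullet> (P m *\<^sub>v v) = b m"
proof -
  have "(\<lambda>m. y \<bullet> (P m *\<^sub>v v)) = b"
  proof (rule laurent_eqI[of J _ I])
    show "finite J" using JP by (simp add: weight_projections_def)
    show "y \<bullet> (P m *\<^sub>v v) = 0" if "m \<notin> J" for m using projection_outside[OF that y v] .
    show "(\<Sum>m\<in>J. t powi m * (y \<bullet> (P m *\<^sub>v v))) = (\<Sum>m\<in>I. t powi m * b m)" if "t \<noteq> 0" for t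
      using torus_expansion[OF that y v] eq[OF that] by simp
  qed (use I in auto)
  then show ?thesis by (rule fun_cong)
qed

text \<open>Compare coefficients of \<open>t\<close> in \<open>torus s (torus t v) = torus (s t) v\<close>.\<close>

lemma projection_in_weight_space:
  assumes v: "v \<in> carrier_vec (gdim M)"
  shows "P m *\<^sub>v v \<in> weight_space M m"
  unfolding weight_space_def
proof (intro CollectI conjI allI impI)
  show PmV: "P m *\<^sub>v v \<in> carrier_vec (gdim M)" by (rule projection_vec_carrier[OF v])
  fix s :: 'k assume s: "s \<noteq> 0"
  have As: "act M (torus s) \<in> carrier_mat (gdim M) (gdim M)"
    by (rule rational_moduleD(1)[OF M torus_in_SL2[OF s]])
  show "act M (torus s) *\<^sub>v (P m *\<^sub>v v) = s powi m \<cdot>\<^sub>v (P m *\<^sub>v v)"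
  proof (rule vec_eqI_scalar_prod[of _ "gdim M"])
    fix y :: "'k vec" assume y: "y \<in> carrier_vec (gdim M)"
    have Ty: "(act M (torus s))\<^sup>T *\<^sub>v y \<in> carrier_vec (gdim M)" using As y by auto
    have "((act M (torus s))\<^sup>T *\<^sub>v y) \<bullet> (P m *\<^sub>v v) = s powi m * (y \<bullet> (P m *\<^sub>v v))"
    proof (rule torus_coefficients[OF Ty v, of J])
      fix t :: 'k assume t: "t \<noteq> 0"
      have "((act M (torus s))\<^sup>T *\<^sub>v y) \<bullet> (act M (torus t) *\<^sub>v v) =
          y \<bullet> (act M (torus s) *\<^sub>v (act M (torus t) *\<^sub>v v))"
        using scalar_prod_transpose[OF As act_carrier[OF M torus_in_SL2[OF t] v] y] by simp
      also have "\<dots> = y \<bullet> (act M (torus (s * t)) *\<^sub>v v)"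
        using act_act[OF M torus_in_SL2[OF s] torus_in_SL2[OF t] v] by (simp add: torus_mult)
      also have "\<dots> = (\<Sum>m\<in>J. (s * t) powi m * (y \<bullet> (P m *\<^sub>v v)))"
        by (rule torus_expansion) (use s t y v in auto)
      also have "\<dots> = (\<Sum>m\<in>J. t powi m * (s powi m * (y \<bullet> (P m *\<^sub>v v))))"
        by (simp add: power_int_mult_distrib mult_ac)
      finally show "((act M (torus s))\<^sup>T *\<^sub>v y) \<bullet> (act M (torus t) *\<^sub>v v) =
        (\<Sum>m\<in>J. t powi m * (s powi m * (y \<bullet> (P m *\<^sub>v v))))" .
    qed (use JP projection_outside[OF _ y v] in \<open>auto simp: weight_projections_def\<close>)
    then show "y \<bullet> (act M (torus s) *\<^sub>v (P m *\<^sub>v v)) = y \<bullet> (s powi m \<cdot>\<^sub>v (P m *\<^sub>v v))"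
      using scalar_prod_transpose[OF As PmV y] y PmV by simp
  qed (use As PmV in auto)
qed

lemma projection_weight_vector:
  assumes v: "v \<in> weight_space M m"
  shows "P m *\<^sub>v v = v" and "j \<noteq> m \<Longrightarrow> P j *\<^sub>v v = 0\<^sub>v (gdim M)"
proof -
  have vC: "v \<in> carrier_vec (gdim M)" using v by (simp add: weight_space_def)
  have *: "y \<bullet> (P j *\<^sub>v v) = (if j = m then y \<bullet> v else 0)" if y: "y \<in> carrier_vec (gdim M)" for y j
    by (rule torus_coefficients[OF y vC, of "{m}"])
      (use v vC y in \<open>auto simp: weight_space_def\<close>)
  show "P m *\<^sub>v v = v"
    by (rule vec_eqI_scalar_prod[of _ "gdim M"]) (use * vC projection_vec_carrier in auto)
  show "P j *\<^sub>v v = 0\<^sub>v (gdim M)" if "j \<noteq> m"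
    by (rule vec_eqI_scalar_prod[of _ "gdim M"]) (use * that vC projection_vec_carrier in auto)
qed

text \<open>The same identity as for \<open>projection_in_weight_space\<close>, now read as a Laurent polynomial in the outer
parameter.\<close>

lemma projection_torus:
  assumes v: "v \<in> carrier_vec (gdim M)" and t: "t \<noteq> 0"
  shows "P m *\<^sub>v (act M (torus t) *\<^sub>v v) = t powi m \<cdot>\<^sub>v (P m *\<^sub>v v)"
proof (rule vec_eqI_scalar_prod[of _ "gdim M"])
  have tv: "act M (torus t) *\<^sub>v v \<in> carrier_vec (gdim M)"
    by (rule act_carrier[OF M torus_in_SL2[OF t] v])
  then show "P m *\<^sub>v (act M (torus t) *\<^sub>v v) \<in> carrier_vec (gdim M)" by (rule projection_vec_carrier)
  show "t powi m \<cdot>\<^sub>v (P m *\<^sub>v v) \<in> carrier_vec (gdim M)" using projection_vec_carrier[OF v] by simp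
  fix y :: "'k vec" assume y: "y \<in> carrier_vec (gdim M)"
  have "y \<bullet> (P m *\<^sub>v (act M (torus t) *\<^sub>v v)) = t powi m * (y \<bullet> (P m *\<^sub>v v))"
  proof (rule torus_coefficients[OF y tv, of J])
    fix s :: 'k assume s: "s \<noteq> 0"
    have "y \<bullet> (act M (torus s) *\<^sub>v (act M (torus t) *\<^sub>v v)) = y \<bullet> (act M (torus (s * t)) *\<^sub>v v)"
      using act_act[OF M torus_in_SL2[OF s] torus_in_SL2[OF t] v] by (simp add: torus_mult)
    also have "\<dots> = (\<Sum>m\<in>J. (s * t) powi m * (y \<bullet> (P m *\<^sub>v v)))"
      by (rule torus_expansion) (use s t y v in auto)
    also have "\<dots> = (\<Sum>m\<in>J. s powi m * (t powi m * (y \<bullet> (P m *\<^sub>v v))))"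
      by (simp add: power_int_mult_distrib mult_ac)
    finally show "y \<bullet> (act M (torus s) *\<^sub>v (act M (torus t) *\<^sub>v v)) =
      (\<Sum>m\<in>J. s powi m * (t powi m * (y \<bullet> (P m *\<^sub>v v))))" .
  qed (use JP projection_outside[OF _ y v] in \<open>auto simp: weight_projections_def\<close>)
  then show "y \<bullet> (P m *\<^sub>v (act M (torus t) *\<^sub>v v)) = y \<bullet> (t powi m \<cdot>\<^sub>v (P m *\<^sub>v v))"
    using y projection_vec_carrier[OF v] by simp
qed

text \<open>If \<open>P m w\<close> were outside \<open>W\<close>, a functional killing \<open>W\<close> but not \<open>P m w\<close> would give a nonzero
  Laurent polynomial \<open>t \<mapsto> y \<bullet> act M (torus t) w\<close> that vanishes identically.\<close>

lemma projection_submodule: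
  assumes W: "gsubmodule M W" and w: "w \<in> W"
  shows "P m *\<^sub>v w \<in> W"
proof (rule ccontr)
  assume n: "P m *\<^sub>v w \<notin> W"
  have wC: "w \<in> carrier_vec (gdim M)" using gsubmoduleD(3)[OF W w] .
  obtain y where y: "y \<in> carrier_vec (gdim M)" "\<And>w. w \<in> W \<Longrightarrow> y \<bullet> w = 0" "y \<bullet> (P m *\<^sub>v w) \<noteq> 0"
    using separating_functional[OF gsubmoduleD(1)[OF W] projection_vec_carrier[OF wC] n] by blast
  have "y \<bullet> (P m *\<^sub>v w) = 0"
    by (rule torus_coefficients[OF y(1) wC, of "{}"])
      (use y(2) gsubmoduleD(2)[OF W torus_in_SL2 w] in auto)
  then show False using y(3) by simp
qed

lemma finite_weights: "finite {m. is_weight M m}"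
proof -
  have "{m. is_weight M m} \<subseteq> J"
  proof
    fix m assume "m \<in> {m. is_weight M m}"
    then obtain v where v: "v \<in> weight_space M m" "v \<noteq> 0\<^sub>v (gdim M)"
      using lin_subspaceD(2)[OF lin_subspace_weight_space[OF M]] by (auto simp: is_weight_def)
    have vC: "v \<in> carrier_vec (gdim M)" using v by (simp add: weight_space_def)
    show "m \<in> J"
    proof (rule ccontr)
      assume "m \<notin> J"
      then have "P m *\<^sub>v v = 0\<^sub>v (gdim M)" using JP vC by (auto simp: weight_projections_def)
      then show False using projection_weight_vector(1)[OF v(1)] v(2) by simp
    qed
  qed
  then show ?thesis using JP finite_subset by (auto simp: weight_projections_def)
qed

end

subsection \<open>Additivity of weight multiplicities\<close>

definition wdim :: "'k::field gmodule \<Rightarrow> 'k vec set \<Rightarrow> int \<Rightarrow> nat" where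
  "wdim M W m = sdim (gdim M) (W \<inter> weight_space M m)"

text \<open>A weight vector of the quotient lifts to a weight vector: project any preimage onto the weight space.\<close>

lemma quotient_iso_weight_space_image:
  fixes M :: "'k::alg_closed_field gmodule"
  assumes M: "rational_module M" and W: "gsubmodule M W" and A: "A \<in> carrier_mat (gdim S) (gdim M)"
    and im: "(\<lambda>w. A *\<^sub>v w) ` W = carrier_vec (gdim S)"
    and eq: "\<forall>g\<in>carrier SL2. \<forall>w\<in>W. A *\<^sub>v (act M g *\<^sub>v w) = act S g *\<^sub>v (A *\<^sub>v w)"
  shows "(\<lambda>w. A *\<^sub>v w) ` (W \<inter> weight_space M m) = weight_space S m"
proof (intro equalityI subsetI)
  fix s assume "s \<in> (\<lambda>w. A *\<^sub>v w) ` (W \<inter> weight_space M m)"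
  then obtain w where w: "w \<in> W" "w \<in> weight_space M m" "s = A *\<^sub>v w" by auto
  have wC: "w \<in> carrier_vec (gdim M)" using w by (simp add: weight_space_def)
  have "act S (torus t) *\<^sub>v s = t powi m \<cdot>\<^sub>v s" if t: "t \<noteq> 0" for t
  proof -
    have "act S (torus t) *\<^sub>v s = A *\<^sub>v (act M (torus t) *\<^sub>v w)"
      using eq w torus_in_SL2[OF t] by simp
    also have "\<dots> = A *\<^sub>v (t powi m \<cdot>\<^sub>v w)" using w t by (simp add: weight_space_def)
    also have "\<dots> = t powi m \<cdot>\<^sub>v s" using mult_mat_vec[OF A wC] w by simp
    finally show ?thesis .
  qed
  then show "s \<in> weight_space S m" using im w by (auto simp: weight_space_def)
next
  fix s assume s: "s \<in> weight_space S m"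
  then have sC: "s \<in> carrier_vec (gdim S)" by (simp add: weight_space_def)
  then obtain w where w: "w \<in> W" "s = A *\<^sub>v w" using im by (metis imageE)
  have wC: "w \<in> carrier_vec (gdim M)" using gsubmoduleD(3)[OF W w(1)] .
  obtain J P where JP: "weight_projections M J P" using weight_projections_exist[OF M] .
  note PC = projection_vec_carrier[OF M JP wC]
  have "A *\<^sub>v (P m *\<^sub>v w) = s"
  proof (rule vec_eqI_scalar_prod[of _ "gdim S"])
    fix y :: "'k vec" assume y: "y \<in> carrier_vec (gdim S)"
    have Ty: "A\<^sup>T *\<^sub>v y \<in> carrier_vec (gdim M)" using A y by auto
    have "(A\<^sup>T *\<^sub>v y) \<bullet> (P m *\<^sub>v w) = (if m = m then y \<bullet> s else 0)"
    proof (rule torus_coefficients[OF M JP Ty wC,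
          where I = "{m}" and b = "\<lambda>j. if j = m then y \<bullet> s else 0"])
      fix t :: 'k assume t: "t \<noteq> 0"
      have "(A\<^sup>T *\<^sub>v y) \<bullet> (act M (torus t) *\<^sub>v w) = y \<bullet> (A *\<^sub>v (act M (torus t) *\<^sub>v w))"
        using scalar_prod_transpose[OF A act_carrier[OF M torus_in_SL2[OF t] wC] y] by simp
      also have "\<dots> = y \<bullet> (t powi m \<cdot>\<^sub>v s)"
        using eq torus_in_SL2[OF t] w s t by (simp add: weight_space_def)
      also have "\<dots> = t powi m * (y \<bullet> s)" using y sC by simp
      finally show "(A\<^sup>T *\<^sub>v y) \<bullet> (act M (torus t) *\<^sub>v w) =
        (\<Sum>j\<in>{m}. t powi j * (if j = m then y \<bullet> s else 0))" by simp
    qed auto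
    then show "y \<bullet> (A *\<^sub>v (P m *\<^sub>v w)) = y \<bullet> s"
      using scalar_prod_transpose[OF A PC y] by simp
  qed (use A PC sC in auto)
  moreover have "P m *\<^sub>v w \<in> W \<inter> weight_space M m"
    using projection_submodule[OF M JP W w(1)] projection_in_weight_space[OF M JP wC] by auto
  ultimately show "s \<in> (\<lambda>w. A *\<^sub>v w) ` (W \<inter> weight_space M m)" by (metis image_eqI)
qed

text \<open>Rank and nullity for the quotient map restricted to a weight space.\<close>

lemma wdim_quotient:
  fixes M :: "'k::alg_closed_field gmodule"
  assumes M: "rational_module M" and W: "gsubmodule M W" and Q: "quotient_iso M W U S"
  shows "wdim M W m = wdim M U m + wdim S (carrier_vec (gdim S)) m"
proof -
  obtain A where A: "A \<in> carrier_mat (gdim S) (gdim M)"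
    "(\<lambda>w. A *\<^sub>v w) ` W = carrier_vec (gdim S)" "{w \<in> W. A *\<^sub>v w = 0\<^sub>v (gdim S)} = U"
    "\<forall>g\<in>carrier SL2. \<forall>w\<in>W. A *\<^sub>v (act M g *\<^sub>v w) = act S g *\<^sub>v (A *\<^sub>v w)"
    using Q unfolding quotient_iso_def by blast
  have "{x \<in> W \<inter> weight_space M m. A *\<^sub>v x = 0\<^sub>v (gdim S)} = U \<inter> weight_space M m"
    using A(3) by auto
  moreover have "carrier_vec (gdim S) \<inter> weight_space S m = weight_space S m"
    by (auto simp: weight_space_def)
  ultimately show ?thesis
    using sdim_rank_nullity[OF lin_subspace_Int[OF gsubmoduleD(1)[OF W] lin_subspace_weight_space[OF M]] A(1)]
      quotient_iso_weight_space_image[OF M W A(1,2,4)]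
    by (simp add: wdim_def)
qed

lemma wdim_zero:
  "rational_module M \<Longrightarrow> wdim M {0\<^sub>v (gdim M)} m = 0"
proof -
  assume M: "rational_module M"
  have "{0\<^sub>v (gdim M)} \<inter> weight_space M m = {0\<^sub>v (gdim M)}"
    using lin_subspaceD(2)[OF lin_subspace_weight_space[OF M]] by auto
  then show ?thesis using sdim_eq_0_iff[OF lin_subspace_zero, of "gdim M"] by (simp add: wdim_def)
qed

lemma is_weight_iff_wdim:
  assumes M: "rational_module M"
  shows "is_weight M m \<longleftrightarrow> wdim M (carrier_vec (gdim M)) m > 0"
proof -
  have "carrier_vec (gdim M) \<inter> weight_space M m = weight_space M m"
    by (auto simp: weight_space_def)
  then show ?thesis
    using sdim_eq_0_iff[OF lin_subspace_weight_space[OF M], of m] by (auto simp: wdim_def is_weight_def)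
qed

section \<open>An explicit model of the simple modules\<close>

subsection \<open>Binary forms\<close>

text \<open>The binary form of degree \<open>n\<close> whose dehomogenisation at \<open>x = 1\<close> is \<open>q\<close>, for \<open>q\<close> of degree at most \<open>n\<close>.\<close>

definition homog :: "nat \<Rightarrow> 'k::comm_ring_1 poly \<Rightarrow> 'k \<Rightarrow> 'k \<Rightarrow> 'k" where
  "homog n q x y = (\<Sum>i\<le>n. coeff q i * x ^ (n - i) * y ^ i)"

lemma homog_linear_mult:
  assumes "degree q \<le> n"
  shows "homog (Suc n) ([:a, c:] * q) x y = (a * x + c * y) * homog n q x y"
proof -
  have c1: "coeff q (Suc n) = 0" using assms by (simp add: coeff_eq_0)
  have "homog (Suc n) ([:a, c:] * q) x y =
      (\<Sum>i\<le>Suc n. a * (coeff q i * x ^ (Suc n - i) * y ^ i)) +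
      (\<Sum>i\<le>Suc n. c * (coeff (pCons 0 q) i * x ^ (Suc n - i) * y ^ i))"
    by (simp only: homog_def sum.distrib [symmetric])
      (intro sum.cong refl, simp add: algebra_simps coeff_pCons split: nat.split)
  also have "(\<Sum>i\<le>Suc n. a * (coeff q i * x ^ (Suc n - i) * y ^ i)) = a * x * homog n q x y"
    using c1 by (simp add: homog_def sum_distrib_left Suc_diff_le mult_ac)
  also have "(\<Sum>i\<le>Suc n. c * (coeff (pCons 0 q) i * x ^ (Suc n - i) * y ^ i)) = c * y * homog n q x y"
    by (subst sum.atMost_Suc_shift) (simp add: homog_def sum_distrib_left mult_ac)
  finally show ?thesis by (simp add: algebra_simps)
qed

text \<open>The group acts on binary forms by substitution; this is the dehomogenised image of the monomial
\<open>x\<^sup>\<nu>\<^sup>-\<^sup>j y\<^sup>j\<close> under \<open>g\<close>.\<close>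

definition form_poly :: "nat \<Rightarrow> 'k::comm_ring_1 mat \<Rightarrow> nat \<Rightarrow> 'k poly" where
  "form_poly \<nu> g j = [:g $$ (0, 0), g $$ (1, 0):] ^ (\<nu> - j) * [:g $$ (0, 1), g $$ (1, 1):] ^ j"

lemma degree_linear_power_mult:
  "degree ([:a, c:] ^ m * [:b, d:] ^ l) \<le> m + (l::nat)"
proof -
  have "degree ([:a, c:] ^ m) \<le> m * 1" "degree ([:b, d:] ^ l) \<le> l * 1"
    by (rule order_trans[OF degree_power_le], simp)+
  then show ?thesis using degree_mult_le[of "[:a, c:] ^ m" "[:b, d:] ^ l"] by linarith
qed

text \<open>Homogenisation is multiplicative, provided that the degrees are added formally.\<close>

lemma homog_linear_power_mult:
  "homog (m + l) ([:a, c:] ^ m * [:b, d:] ^ l) x y = (a * x + c * y) ^ m * (b * x + d * y) ^ (l::nat)"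
proof (induction m)
  case 0
  show ?case
  proof (induction l)
    case (Suc l)
    have "degree ([:b, d:] ^ l) \<le> l" using degree_linear_power_mult[of a c 0 b d l] by simp
    from homog_linear_mult[OF this, of b d x y] Suc show ?case
      by (simp only: power_Suc power_0 add_0 mult_1)
  qed (simp add: homog_def)
next
  case (Suc m)
  have "degree ([:a, c:] ^ m * [:b, d:] ^ l) \<le> m + l" by (rule degree_linear_power_mult)
  from homog_linear_mult[OF this, of a c x y] Suc show ?case
    by (simp only: power_Suc add_Suc mult.assoc)
qed

lemma homog_form_poly:
  assumes "j \<le> \<nu>"
  shows "homog \<nu> (form_poly \<nu> g j) x y =
    (g $$ (0, 0) * x + g $$ (1, 0) * y) ^ (\<nu> - j) * (g $$ (0, 1) * x + g $$ (1, 1) * y) ^ j"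
  using homog_linear_power_mult[of "\<nu> - j" j "g $$ (0, 0)" "g $$ (1, 0)" "g $$ (0, 1)" "g $$ (1, 1)" x y] assms
  by (simp add: form_poly_def)

text \<open>Both sides are the coefficient of \<open>x\<^sup>i y\<^sup>j\<close> in \<open>((g\<^sub>0\<^sub>0 + g\<^sub>1\<^sub>0 x) + y (g\<^sub>0\<^sub>1 + g\<^sub>1\<^sub>1 x))\<^sup>\<nu>\<close>. The identity
  is why the monomials with nonvanishing binomial coefficient span a submodule of the binary forms.\<close>

lemma form_poly_transpose:
  fixes g h :: "'k::alg_closed_field mat"
  assumes ij: "i \<le> \<nu>" "j \<le> \<nu>"
    and h: "h $$ (0, 0) = g $$ (0, 0)" "h $$ (1, 0) = g $$ (0, 1)" "h $$ (0, 1) = g $$ (1, 0)" "h $$ (1, 1) = g $$ (1, 1)"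
  shows "of_nat (\<nu> choose j) * coeff (form_poly \<nu> g j) i = of_nat (\<nu> choose i) * coeff (form_poly \<nu> h i) j"
proof -
  define L where "L = (\<Sum>j\<le>\<nu>. monom (of_nat (\<nu> choose j) * coeff (form_poly \<nu> g j) i) j)"
  define R where "R = Polynomial.smult (of_nat (\<nu> choose i)) (form_poly \<nu> h i)"
  have pull: "of_nat k * (Polynomial.smult y Q) ^ j * P ^ m = Polynomial.smult (of_nat k * y ^ j) (P ^ m * Q ^ j)"
    for P Q :: "'k poly" and y k j m
    by (simp add: smult_power of_nat_poly mult_ac)
  have "poly L y = poly R y" for y
  proof -
    have "[:g $$ (0, 0) + g $$ (0, 1) * y, g $$ (1, 0) + g $$ (1, 1) * y:] =
        Polynomial.smult y [:g $$ (0, 1), g $$ (1, 1):] + [:g $$ (0, 0), g $$ (1, 0):]"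
      by (simp add: algebra_simps)
    then have "[:g $$ (0, 0) + g $$ (0, 1) * y, g $$ (1, 0) + g $$ (1, 1) * y:] ^ \<nu> =
        (\<Sum>j\<le>\<nu>. of_nat (\<nu> choose j) * (Polynomial.smult y [:g $$ (0, 1), g $$ (1, 1):]) ^ j *
           [:g $$ (0, 0), g $$ (1, 0):] ^ (\<nu> - j))"
      by (simp only: binomial_ring)
    also have "\<dots> = (\<Sum>j\<le>\<nu>. Polynomial.smult (of_nat (\<nu> choose j) * y ^ j) (form_poly \<nu> g j))"
      by (intro sum.cong refl) (simp only: pull form_poly_def)
    finally have "coeff ([:g $$ (0, 0) + g $$ (0, 1) * y, g $$ (1, 0) + g $$ (1, 1) * y:] ^ \<nu>) i = poly L y"
      by (simp add: L_def coeff_sum poly_sum poly_monom mult_ac)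
    moreover have "coeff ([:g $$ (0, 0) + g $$ (0, 1) * y, g $$ (1, 0) + g $$ (1, 1) * y:] ^ \<nu>) i = poly R y"
      using ij h by (simp add: coeff_linear_poly_power R_def form_poly_def mult_ac)
    ultimately show ?thesis by simp
  qed
  then have "L = R" by (intro poly_eqI_nonzero)
  then have "coeff L j = coeff R j" by simp
  moreover have "coeff L j = of_nat (\<nu> choose j) * coeff (form_poly \<nu> g j) i"
    using ij by (simp add: L_def coeff_sum)
  ultimately show ?thesis by (simp add: R_def)
qed

subsection \<open>The module\<close>

definition expts :: "nat \<Rightarrow> nat \<Rightarrow> nat list" where
  "expts p \<nu> = filter (\<lambda>i. \<not> p dvd (\<nu> choose i)) [0..<Suc \<nu>]"

text \<open>In characteristic \<open>p\<close> the simple module of highest weight \<open>\<nu>\<close> is the subspace of the space of binary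
  forms \<open>x\<^sup>\<nu>, x\<^sup>\<nu>\<^sup>-\<^sup>1 y, \<dots>, y\<^sup>\<nu>\<close> that is spanned by the monomials whose binomial coefficient does not vanish;
  it is generated by \<open>x\<^sup>\<nu>\<close>. A form is dehomogenised by putting \<open>x = 1\<close>.\<close>

definition simple_model :: "nat \<Rightarrow> 'k::field gmodule" where
  "simple_model \<nu> = \<lparr>gdim = length (expts CHAR('k) \<nu>),
     act = (\<lambda>g. mat (length (expts CHAR('k) \<nu>)) (length (expts CHAR('k) \<nu>))
       (\<lambda>(r, c). coeff (form_poly \<nu> g (expts CHAR('k) \<nu> ! c)) (expts CHAR('k) \<nu> ! r)))\<rparr>"

lemma set_expts: "set (expts p \<nu>) = {i. i \<le> \<nu> \<and> \<not> p dvd (\<nu> choose i)}"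
  by (auto simp: expts_def)

lemma distinct_expts: "distinct (expts p \<nu>)"
  by (simp add: expts_def)

lemma sum_expts: "(\<Sum>r<length (expts p \<nu>). f (expts p \<nu> ! r)) = (\<Sum>i\<in>set (expts p \<nu>). f i)"
  by (rule sum.reindex_bij_betw[OF bij_betw_nth]) (auto simp: distinct_expts atLeast0LessThan)

lemma expts_nth_le: "r < length (expts p \<nu>) \<Longrightarrow> expts p \<nu> ! r \<le> \<nu>"
  using nth_mem[of r "expts p \<nu>"] by (simp add: set_expts)

lemma expts_nth_eq_iff:
  "r < length (expts p \<nu>) \<Longrightarrow> s < length (expts p \<nu>) \<Longrightarrow> expts p \<nu> ! r = expts p \<nu> ! s \<longleftrightarrow> r = s"
  by (simp add: distinct_expts nth_eq_iff_index_eq)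

lemma form_poly_coeff_outside:
  fixes g :: "'k::alg_closed_field mat"
  assumes "i \<le> \<nu>" "i \<notin> set (expts CHAR('k) \<nu>)" "j \<in> set (expts CHAR('k) \<nu>)"
  shows "coeff (form_poly \<nu> g j) i = 0"
proof -
  have "of_nat (\<nu> choose j) * coeff (form_poly \<nu> g j) i =
      of_nat (\<nu> choose i) * coeff (form_poly \<nu> (mat2 (g $$ (0, 0)) (g $$ (1, 0)) (g $$ (0, 1)) (g $$ (1, 1))) i) j"
    by (rule form_poly_transpose) (use assms in \<open>auto simp: set_expts\<close>)
  moreover have "of_nat (\<nu> choose i) = (0::'k)" "of_nat (\<nu> choose j) \<noteq> (0::'k)"
    using assms by (auto simp: set_expts of_nat_eq_0_iff_char_dvd)
  ultimately show ?thesis by simp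
qed

text \<open>The form with the given coordinates, as a function of two variables.\<close>

definition form_eval :: "nat \<Rightarrow> 'k::field vec \<Rightarrow> 'k \<Rightarrow> 'k \<Rightarrow> 'k" where
  "form_eval \<nu> v x y = (\<Sum>r<length (expts CHAR('k) \<nu>).
     v $ r * x ^ (\<nu> - expts CHAR('k) \<nu> ! r) * y ^ (expts CHAR('k) \<nu> ! r))"

lemma gdim_simple_model: "gdim (simple_model \<nu> :: 'k::field gmodule) = length (expts CHAR('k) \<nu>)"
  by (simp add: simple_model_def)

lemma act_simple_model_carrier:
  "act (simple_model \<nu> :: 'k::field gmodule) g \<in> carrier_mat (gdim (simple_model \<nu> :: 'k gmodule)) (gdim (simple_model \<nu> :: 'k gmodule))"
  by (simp add: simple_model_def)

lemma act_simple_model_index: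
  assumes "r < gdim (simple_model \<nu> :: 'k::field gmodule)" "c < gdim (simple_model \<nu> :: 'k gmodule)"
  shows "act (simple_model \<nu> :: 'k gmodule) g $$ (r, c) =
    coeff (form_poly \<nu> g (expts CHAR('k) \<nu> ! c)) (expts CHAR('k) \<nu> ! r)"
  using assms by (simp add: simple_model_def)

text \<open>The truncated matrix really is substitution, because the coefficients it drops vanish by
\<open>form_poly_coeff_outside\<close>. That the action is multiplicative follows from this formula.\<close>

lemma form_eval_act:
  fixes v :: "'k::alg_closed_field vec"
  assumes v: "v \<in> carrier_vec (gdim (simple_model \<nu> :: 'k gmodule))"
  shows "form_eval \<nu> (act (simple_model \<nu>) g *\<^sub>v v) x y =
    form_eval \<nu> v (g $$ (0, 0) * x + g $$ (1, 0) * y) (g $$ (0, 1) * x + g $$ (1, 1) * y)"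
proof -
  define e where "e = expts CHAR('k) \<nu>"
  define d where "d = length e"
  have dim: "gdim (simple_model \<nu> :: 'k gmodule) = d" by (simp add: simple_model_def d_def e_def)
  have inner: "(\<Sum>r<d. coeff (form_poly \<nu> g (e ! c)) (e ! r) * x ^ (\<nu> - e ! r) * y ^ (e ! r)) =
      (g $$ (0, 0) * x + g $$ (1, 0) * y) ^ (\<nu> - e ! c) * (g $$ (0, 1) * x + g $$ (1, 1) * y) ^ (e ! c)"
    if "c < d" for c
  proof -
    have "(\<Sum>r<d. coeff (form_poly \<nu> g (e ! c)) (e ! r) * x ^ (\<nu> - e ! r) * y ^ (e ! r)) =
        (\<Sum>i\<in>set e. coeff (form_poly \<nu> g (e ! c)) i * x ^ (\<nu> - i) * y ^ i)"
      unfolding d_def e_def by (rule sum_expts)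
    also have "\<dots> = homog \<nu> (form_poly \<nu> g (e ! c)) x y"
      unfolding homog_def
    proof (intro sum.mono_neutral_left ballI)
      fix i assume "i \<in> {..\<nu>} - set e"
      moreover have "e ! c \<in> set e" using that by (simp add: d_def)
      ultimately have "coeff (form_poly \<nu> g (e ! c)) i = 0"
        unfolding e_def by (intro form_poly_coeff_outside) auto
      then show "coeff (form_poly \<nu> g (e ! c)) i * x ^ (\<nu> - i) * y ^ i = 0" by simp
    qed (auto simp: e_def set_expts)
    finally show ?thesis
      using homog_form_poly[of "e ! c" \<nu> g x y] expts_nth_le[of c "CHAR('k)" \<nu>] that
      by (simp add: d_def e_def)
  qed
  have "form_eval \<nu> (act (simple_model \<nu>) g *\<^sub>v v) x y =
      (\<Sum>r<d. (\<Sum>c<d. coeff (form_poly \<nu> g (e ! c)) (e ! r) * v $ c) * x ^ (\<nu> - e ! r) * y ^ (e ! r))"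
    unfolding form_eval_def e_def[symmetric] d_def[symmetric]
    using v dim by (intro sum.cong refl)
      (simp add: simple_model_def scalar_prod_def atLeast0LessThan flip: e_def d_def)
  also have "\<dots> = (\<Sum>r<d. \<Sum>c<d. v $ c * (coeff (form_poly \<nu> g (e ! c)) (e ! r) * x ^ (\<nu> - e ! r) * y ^ (e ! r)))"
    unfolding sum_distrib_right by (intro sum.cong refl) (simp only: mult_ac)
  also have "\<dots> = (\<Sum>c<d. v $ c * (\<Sum>r<d. coeff (form_poly \<nu> g (e ! c)) (e ! r) * x ^ (\<nu> - e ! r) * y ^ (e ! r)))"
    unfolding sum_distrib_left by (rule sum.swap)
  also have "\<dots> = form_eval \<nu> v (g $$ (0, 0) * x + g $$ (1, 0) * y) (g $$ (0, 1) * x + g $$ (1, 1) * y)"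
    unfolding form_eval_def e_def[symmetric] d_def[symmetric]
    by (intro sum.cong refl) (subst inner, simp, simp only: mult.assoc)
  finally show ?thesis .
qed

text \<open>The exponents are distinct, so a vector of coordinates is determined by its values as a polynomial
function.\<close>

lemma expts_coeff_eqI:
  fixes a b :: "nat \<Rightarrow> 'k::alg_closed_field"
  assumes eq: "\<And>y. (\<Sum>r<length (expts p \<nu>). a r * y ^ (expts p \<nu> ! r)) =
      (\<Sum>r<length (expts p \<nu>). b r * y ^ (expts p \<nu> ! r))"
    and s: "s < length (expts p \<nu>)"
  shows "a s = b s"
proof -
  define e where "e = expts p \<nu>"
  define Q where "Q = (\<lambda>a::nat \<Rightarrow> 'k. \<Sum>r<length e. monom (a r) (e ! r))"
  have "coeff (Q a) (e ! s) = a s" for a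
  proof -
    have "coeff (Q a) (e ! s) = (\<Sum>r<length e. if r = s then a r else 0)"
      unfolding Q_def coeff_sum coeff_monom
      using s expts_nth_eq_iff[of _ p \<nu>] by (intro sum.cong refl) (auto simp: e_def)
    then show ?thesis using s by (simp add: e_def)
  qed
  moreover have "Q a = Q b"
    using eq by (intro poly_eqI_nonzero) (simp add: Q_def e_def poly_sum poly_monom)
  ultimately show ?thesis by metis
qed

lemma form_eval_inject:
  fixes u v :: "'k::alg_closed_field vec"
  assumes u: "u \<in> carrier_vec (gdim (simple_model \<nu> :: 'k gmodule))"
    and v: "v \<in> carrier_vec (gdim (simple_model \<nu> :: 'k gmodule))"
    and eq: "\<And>y. form_eval \<nu> u 1 y = form_eval \<nu> v 1 y"
  shows "u = v"
proof (rule eq_vecI)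
  fix s assume "s < dim_vec v"
  then have "s < length (expts CHAR('k) \<nu>)" using v by (simp add: gdim_simple_model)
  from expts_coeff_eqI[where a = "vec_index u" and b = "vec_index v", OF _ this] eq show "u $ s = v $ s" by (simp add: form_eval_def)
qed (use u v in simp)

lemma mat_eqI_mult_vec:
  fixes A B :: "'k::field mat"
  assumes A: "A \<in> carrier_mat n m" and B: "B \<in> carrier_mat n m"
    and eq: "\<And>v. v \<in> carrier_vec m \<Longrightarrow> A *\<^sub>v v = B *\<^sub>v v"
  shows "A = B"
proof (rule eq_matI)
  fix i j assume ij: "i < dim_row B" "j < dim_col B"
  have "(A *\<^sub>v unit_vec m j) $ i = (B *\<^sub>v unit_vec m j) $ i" using eq by simp
  then show "A $$ (i, j) = B $$ (i, j)"
    using ij A B by (simp add: scalar_prod_right_unit)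
qed (use A B in auto)

lemma regular_coeff_mult:
  assumes "\<And>i. (\<lambda>g. coeff (P g) i) \<in> regular_functions" "\<And>i. (\<lambda>g. coeff (Q g) i) \<in> regular_functions"
  shows "(\<lambda>g. coeff (P g * Q g) i) \<in> regular_functions"
  unfolding coeff_mult by (intro regular_sum regular_functions.mult assms) auto

lemma regular_coeff_power:
  assumes "\<And>i. (\<lambda>g. coeff (P g) i) \<in> regular_functions"
  shows "(\<lambda>g. coeff (P g ^ n) i) \<in> regular_functions"
proof (induction n arbitrary: i)
  case 0
  show ?case by (simp add: regular_functions.const)
next
  case (Suc n)
  then show ?case using regular_coeff_mult[OF assms] by simp
qed

lemma regular_coeff_linear:
  assumes "i < 2" "j < 2" "i' < 2" "j' < 2"
  shows "(\<lambda>g. coeff [:g $$ (i, j), g $$ (i', j'):] k) \<in> regular_functions"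
proof -
  consider "k = 0" | "k = 1" | l where "k = Suc (Suc l)" by (metis One_nat_def not0_implies_Suc)
  then show ?thesis
    by cases (use assms in \<open>auto simp: coeff_pCons intro: regular_functions.intros\<close>)
qed

theorem rational_simple_model: "rational_module (simple_model \<nu> :: 'k::alg_closed_field gmodule)"
proof (rule rational_moduleI)
  let ?E = "simple_model \<nu> :: 'k gmodule"
  note C = act_simple_model_carrier[of \<nu>, where ?'k = 'k]
  show "act ?E g \<in> carrier_mat (gdim ?E) (gdim ?E)" for g by (rule C)
  show "act ?E (g * h) = act ?E g * act ?E h" if g: "g \<in> carrier SL2" and h: "h \<in> carrier SL2" for g h
  proof (rule mat_eqI_mult_vec[OF C mult_carrier_mat[OF C C]])
    fix v :: "'k vec" assume v: "v \<in> carrier_vec (gdim ?E)"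
    obtain a b c d where g': "g = mat2 a b c d" using SL2_cases[OF g] by metis
    obtain a' b' c' d' where h': "h = mat2 a' b' c' d'" using SL2_cases[OF h] by metis
    have hv: "act ?E h *\<^sub>v v \<in> carrier_vec (gdim ?E)" by (rule mult_mat_vec_carrier[OF C v])
    have "act ?E (g * h) *\<^sub>v v = act ?E g *\<^sub>v (act ?E h *\<^sub>v v)"
      by (rule form_eval_inject)
        (use v hv in \<open>auto simp: form_eval_act g' h' mat2_mult algebra_simps
           intro!: mult_mat_vec_carrier[OF C]\<close>)
    then show "act ?E (g * h) *\<^sub>v v = act ?E g * act ?E h *\<^sub>v v"
      using assoc_mult_mat_vec[OF C C v] by simp
  qed
  show "act ?E (1\<^sub>m 2) = 1\<^sub>m (gdim ?E)"
  proof (rule mat_eqI_mult_vec[OF C])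
    fix v :: "'k vec" assume v: "v \<in> carrier_vec (gdim ?E)"
    show "act ?E (1\<^sub>m 2) *\<^sub>v v = 1\<^sub>m (gdim ?E) *\<^sub>v v"
      by (rule form_eval_inject)
        (use v in \<open>auto simp: form_eval_act one_mat2 intro!: mult_mat_vec_carrier[OF C]\<close>)
  qed auto
  show "\<exists>f\<in>regular_functions. \<forall>g\<in>carrier SL2. act ?E g $$ (i, j) = f g"
    if "i < gdim ?E" "j < gdim ?E" for i j
  proof (rule bexI)
    show "\<forall>g\<in>carrier SL2. act ?E g $$ (i, j) =
        coeff (form_poly \<nu> g (expts CHAR('k) \<nu> ! j)) (expts CHAR('k) \<nu> ! i)"
      using act_simple_model_index[OF that] by blast
    show "(\<lambda>g. coeff (form_poly \<nu> g (expts CHAR('k) \<nu> ! j)) (expts CHAR('k) \<nu> ! i)) \<in> regular_functions"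
      unfolding form_poly_def
      by (intro regular_coeff_mult regular_coeff_power regular_coeff_linear) auto
  qed
qed

subsection \<open>Modules on which the torus acts diagonally\<close>

lemma powi_eq_imp_eq:
  fixes a :: "'k::alg_closed_field"
  assumes "\<And>t. t \<noteq> 0 \<Longrightarrow> t powi i * a = t powi j * a" "a \<noteq> 0"
  shows "i = j"
proof -
  have "(\<lambda>m. if m = i then a else 0) = (\<lambda>m. if m = j then a else 0)"
    by (rule laurent_eqI[of "{i}" _ "{j}"]) (use assms(1) in auto)
  from fun_cong[OF this, of i] show ?thesis using assms(2) by (simp split: if_splits)
qed

text \<open>Over an infinite field distinct integers are distinct characters of the torus, so a weight space is a
coordinate subspace.\<close>

lemma wdim_diagonal:
  fixes M :: "'k::alg_closed_field gmodule"
  assumes diag: "\<And>t v r. t \<noteq> 0 \<Longrightarrow> v \<in> carrier_vec (gdim M) \<Longrightarrow> r < gdim M \<Longrightarrow>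
      (act M (torus t) *\<^sub>v v) $ r = t powi w r * v $ r"
    and M: "rational_module M"
  shows "wdim M (carrier_vec (gdim M)) m = card {r. r < gdim M \<and> w r = m}"
proof -
  have "weight_space M m = {v \<in> carrier_vec (gdim M). \<forall>r<gdim M. r \<notin> {r. r < gdim M \<and> w r = m} \<longrightarrow> v $ r = 0}"
  proof (intro equalityI subsetI)
    fix v :: "'k vec" assume v: "v \<in> weight_space M m"
    then have vC: "v \<in> carrier_vec (gdim M)" by (simp add: weight_space_def)
    have "v $ r = 0" if "r < gdim M" "w r \<noteq> m" for r
    proof (rule ccontr)
      assume "v $ r \<noteq> 0"
      moreover have "t powi w r * v $ r = t powi m * v $ r" if "t \<noteq> 0" for t
        using diag[OF that vC \<open>r < gdim M\<close>] v \<open>r < gdim M\<close> vC that by (auto simp: weight_space_def)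
      ultimately show False using powi_eq_imp_eq that(2) by blast
    qed
    then show "v \<in> {v \<in> carrier_vec (gdim M). \<forall>r<gdim M. r \<notin> {r. r < gdim M \<and> w r = m} \<longrightarrow> v $ r = 0}"
      using vC by auto
  next
    fix v :: "'k vec" assume v: "v \<in> {v \<in> carrier_vec (gdim M). \<forall>r<gdim M. r \<notin> {r. r < gdim M \<and> w r = m} \<longrightarrow> v $ r = 0}"
    have "act M (torus t) *\<^sub>v v = t powi m \<cdot>\<^sub>v v" if t: "t \<noteq> 0" for t
    proof (rule eq_vecI)
      fix r assume "r < dim_vec (t powi m \<cdot>\<^sub>v v)"
      then have "r < gdim M" using v by auto
      then show "(act M (torus t) *\<^sub>v v) $ r = (t powi m \<cdot>\<^sub>v v) $ r"
        using diag[OF t _ \<open>r < gdim M\<close>, of v] v by auto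
    qed (use v rational_moduleD(1)[OF M torus_in_SL2[OF t]] in auto)
    then show "v \<in> weight_space M m" using v by (simp add: weight_space_def)
  qed
  then have "carrier_vec (gdim M) \<inter> weight_space M m =
      {v \<in> carrier_vec (gdim M). \<forall>r<gdim M. r \<notin> {r. r < gdim M \<and> w r = m} \<longrightarrow> v $ r = 0}"
    by auto
  then show ?thesis
    unfolding wdim_def using sdim_coordinate_subspace[of "{r. r < gdim M \<and> w r = m}" "gdim M", where ?'k = 'k]
    by auto
qed

lemma projection_diagonal:
  fixes M :: "'k::alg_closed_field gmodule"
  assumes M: "rational_module M" and JP: "weight_projections M J P"
    and diag: "\<And>t v r. t \<noteq> 0 \<Longrightarrow> v \<in> carrier_vec (gdim M) \<Longrightarrow> r < gdim M \<Longrightarrow>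
      (act M (torus t) *\<^sub>v v) $ r = t powi w r * v $ r"
    and v: "v \<in> carrier_vec (gdim M)" and r: "r < gdim M"
  shows "(P m *\<^sub>v v) $ r = (if w r = m then v $ r else 0)"
proof -
  have "unit_vec (gdim M) r \<bullet> (P m *\<^sub>v v) = (if m = w r then v $ r else 0)"
  proof (rule torus_coefficients[OF M JP unit_vec_carrier v, where I = "{w r}"
        and b = "\<lambda>m. if m = w r then v $ r else 0"])
    fix t :: 'k assume t: "t \<noteq> 0"
    have "unit_vec (gdim M) r \<bullet> (act M (torus t) *\<^sub>v v) = (act M (torus t) *\<^sub>v v) $ r"
      by (rule scalar_prod_left_unit[OF act_carrier[OF M torus_in_SL2[OF t] v] r])
    then show "unit_vec (gdim M) r \<bullet> (act M (torus t) *\<^sub>v v) =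
        (\<Sum>m\<in>{w r}. t powi m * (if m = w r then v $ r else 0))"
      using diag[OF t v r] by simp
  qed auto
  then show ?thesis
    using scalar_prod_left_unit[OF projection_vec_carrier[OF M JP v] r, of m] by auto
qed

subsection \<open>The model is simple\<close>

lemma expts_first:
  assumes "p \<noteq> 1"
  shows "expts p \<nu> \<noteq> []" "expts p \<nu> ! 0 = 0"
  using assms by (simp_all add: expts_def upt_conv_Cons del: upt_Suc)

lemma simple_model_first:
  shows "0 < gdim (simple_model \<nu> :: 'k::field gmodule)" "expts CHAR('k) \<nu> ! 0 = 0"
  using expts_first[of "CHAR('k)" \<nu>] CHAR_not_1 by (auto simp: gdim_simple_model)

lemma act_torus_simple_model:
  fixes v :: "'k::alg_closed_field vec"
  assumes t: "t \<noteq> 0" and v: "v \<in> carrier_vec (gdim (simple_model \<nu> :: 'k gmodule))"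
    and r: "r < gdim (simple_model \<nu> :: 'k gmodule)"
  shows "(act (simple_model \<nu>) (torus t) *\<^sub>v v) $ r =
    t powi (int \<nu> - 2 * int (expts CHAR('k) \<nu> ! r)) * v $ r"
proof -
  define u where "u = vec (gdim (simple_model \<nu> :: 'k gmodule))
    (\<lambda>r. t powi (int \<nu> - 2 * int (expts CHAR('k) \<nu> ! r)) * v $ r)"
  have "act (simple_model \<nu>) (torus t) *\<^sub>v v = u"
  proof (rule form_eval_inject)
    show "act (simple_model \<nu>) (torus t) *\<^sub>v v \<in> carrier_vec (gdim (simple_model \<nu> :: 'k gmodule))"
      by (rule act_carrier[OF rational_simple_model torus_in_SL2[OF t] v])
    show "u \<in> carrier_vec (gdim (simple_model \<nu> :: 'k gmodule))" by (simp add: u_def)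
    fix y
    have "t ^ (\<nu> - i) * (inverse t * y) ^ i = t powi (int \<nu> - 2 * int i) * y ^ i" if "i \<le> \<nu>" for i
    proof -
      have "t powi (int \<nu> - 2 * int i) = t powi (int (\<nu> - i) - int i)" using that by (simp add: of_nat_diff)
      also have "\<dots> = t ^ (\<nu> - i) / t ^ i" using t by (subst power_int_diff) auto
      finally show ?thesis by (simp add: power_mult_distrib divide_inverse power_inverse)
    qed
    from this[OF expts_nth_le]
    show "form_eval \<nu> (act (simple_model \<nu>) (torus t) *\<^sub>v v) 1 y = form_eval \<nu> u 1 y"
      unfolding form_eval_act[OF v] unfolding form_eval_def
      by (intro sum.cong refl) (simp add: torus_eq u_def gdim_simple_model mult_ac)
  qed
  then show ?thesis using r by (simp add: u_def)
qed

lemma wdim_simple_model: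
  "wdim (simple_model \<nu> :: 'k::alg_closed_field gmodule) (carrier_vec (gdim (simple_model \<nu> :: 'k gmodule))) m =
     card {i \<in> set (expts CHAR('k) \<nu>). int \<nu> - 2 * int i = m}"
proof -
  let ?e = "expts CHAR('k) \<nu>"
  have "wdim (simple_model \<nu> :: 'k gmodule) (carrier_vec (gdim (simple_model \<nu> :: 'k gmodule))) m =
      card {r. r < gdim (simple_model \<nu> :: 'k gmodule) \<and> int \<nu> - 2 * int (?e ! r) = m}"
    by (rule wdim_diagonal[OF act_torus_simple_model rational_simple_model])
  also have "\<dots> = card {r. r < length ?e \<and> int \<nu> - 2 * int (?e ! r) = m}"
    by (simp add: gdim_simple_model)
  also have "\<dots> = card ((\<lambda>r. ?e ! r) ` {r. r < length ?e \<and> int \<nu> - 2 * int (?e ! r) = m})"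
    by (intro card_image [symmetric]) (auto simp: inj_on_def expts_nth_eq_iff)
  also have "(\<lambda>r. ?e ! r) ` {r. r < length ?e \<and> int \<nu> - 2 * int (?e ! r) = m} =
      {i \<in> set ?e. int \<nu> - 2 * int i = m}"
    by (auto simp: in_set_conv_nth)
  finally show ?thesis .
qed

text \<open>The coordinates of \<open>(x + s y)\<^sup>\<nu>\<close> are the \<open>(\<nu> choose i) s\<^sup>i\<close>, all of them nonzero polynomials in \<open>s\<close> of
  different degrees.\<close>

lemma lower_orbit_spans:
  fixes X :: "'k::alg_closed_field vec set"
  assumes X: "lin_subspace (gdim (simple_model \<nu> :: 'k gmodule)) X"
    and orb: "\<And>s. act (simple_model \<nu>) (lower s) *\<^sub>v unit_vec (gdim (simple_model \<nu> :: 'k gmodule)) 0 \<in> X"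
  shows "X = carrier_vec (gdim (simple_model \<nu> :: 'k gmodule))"
proof (rule ccontr)
  let ?E = "simple_model \<nu> :: 'k gmodule" and ?e = "expts CHAR('k) \<nu>"
  assume "X \<noteq> carrier_vec (gdim ?E)"
  then obtain v where v: "v \<in> carrier_vec (gdim ?E)" "v \<notin> X" using lin_subspaceD(1)[OF X] by blast
  obtain y where y: "y \<in> carrier_vec (gdim ?E)" "\<And>w. w \<in> X \<Longrightarrow> y \<bullet> w = 0" "y \<bullet> v \<noteq> 0"
    using separating_functional[OF X v] by blast
  have ind: "(act ?E (lower s) *\<^sub>v unit_vec (gdim ?E) 0) $ r = of_nat (\<nu> choose (?e ! r)) * s ^ (?e ! r)"
    if r: "r < length ?e" for r s
  proof -
    have "(act ?E (lower s) *\<^sub>v unit_vec (gdim ?E) 0) $ r = act ?E (lower s) $$ (r, 0)"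
      using r act_simple_model_carrier[of \<nu> "lower s"] simple_model_first(1)[of \<nu>, where ?'k = 'k]
      by (simp add: scalar_prod_right_unit gdim_simple_model)
    also have "\<dots> = coeff ([:1, s:] ^ \<nu>) (?e ! r)"
      using r act_simple_model_index[of r \<nu> 0 "lower s"] simple_model_first[of \<nu>, where ?'k = 'k]
      by (simp add: gdim_simple_model form_poly_def)
    also have "\<dots> = of_nat (\<nu> choose (?e ! r)) * s ^ (?e ! r)"
      using coeff_linear_poly_power[OF expts_nth_le[OF r], of 1 s] by simp
    finally show ?thesis .
  qed
  have "y $ r = 0" if r: "r < length ?e" for r
  proof -
    have "y $ r * of_nat (\<nu> choose (?e ! r)) = 0"
    proof (rule expts_coeff_eqI[where a = "\<lambda>r. y $ r * of_nat (\<nu> choose (?e ! r))" and b = "\<lambda>_. 0", OF _ r])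
      fix s
      have "(\<Sum>r<length ?e. y $ r * of_nat (\<nu> choose (?e ! r)) * s ^ (?e ! r)) =
          y \<bullet> (act ?E (lower s) *\<^sub>v unit_vec (gdim ?E) 0)"
        using act_simple_model_carrier[of \<nu> "lower s"]
        by (simp add: scalar_prod_def gdim_simple_model atLeast0LessThan ind[unfolded gdim_simple_model] mult.assoc del: index_mult_mat_vec)
      then show "(\<Sum>r<length ?e. y $ r * of_nat (\<nu> choose (?e ! r)) * s ^ (?e ! r)) =
          (\<Sum>r<length ?e. 0 * s ^ (?e ! r))"
        using y(2)[OF orb] by simp
    qed
    moreover have "of_nat (\<nu> choose (?e ! r)) \<noteq> (0::'k)"
      using nth_mem[OF r] by (simp add: set_expts of_nat_eq_0_iff_char_dvd)
    ultimately show ?thesis by simp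
  qed
  then have "y \<bullet> v = 0" using y(1) v(1) by (simp add: scalar_prod_def gdim_simple_model)
  then show False using y(3) by simp
qed

text \<open>A nonzero form \<open>f\<close> does not vanish at some point \<open>(1, a)\<close>, which means that a unipotent translate of \<open>f\<close>
has a nonzero coefficient at \<open>x\<^sup>\<nu>\<close>. Projecting to the weight \<open>\<nu>\<close> shows that the submodule generated by
\<open>f\<close> contains \<open>x\<^sup>\<nu>\<close>, and \<open>x\<^sup>\<nu>\<close> generates everything.\<close>

theorem simple_simple_model: "simple_module (simple_model \<nu> :: 'k::alg_closed_field gmodule)"
  unfolding simple_module_def
proof (intro conjI allI impI)
  let ?E = "simple_model \<nu> :: 'k gmodule" and ?e = "expts CHAR('k) \<nu>"
  show "rational_module ?E" by (rule rational_simple_model)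
  show "0 < gdim ?E" by (rule simple_model_first)
  fix X assume X: "gsubmodule ?E X"
  note Xsub = gsubmoduleD(1)[OF X]
  show "X = {0\<^sub>v (gdim ?E)} \<or> X = carrier_vec (gdim ?E)"
  proof (subst disj_commute, rule disjCI)
    assume "X \<noteq> {0\<^sub>v (gdim ?E)}"
    then obtain f where f: "f \<in> X" "f \<noteq> 0\<^sub>v (gdim ?E)" using lin_subspaceD(2)[OF Xsub] by blast
    have fC: "f \<in> carrier_vec (gdim ?E)" by (rule gsubmoduleD(3)[OF X f(1)])
    have zC: "0\<^sub>v (gdim ?E) \<in> carrier_vec (gdim ?E)" by simp
    have "\<exists>x. form_eval \<nu> f 1 x \<noteq> 0"
    proof (rule ccontr)
      assume "\<not> ?thesis"
      moreover have "form_eval \<nu> (0\<^sub>v (gdim ?E)) 1 x = (0::'k)" for x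
        by (simp add: form_eval_def gdim_simple_model)
      ultimately show False using form_eval_inject[OF fC zC] f(2) by simp
    qed
    then obtain x where x: "form_eval \<nu> f 1 x \<noteq> 0" ..
    define u where "u = act ?E (upper x) *\<^sub>v f"
    have u: "u \<in> X" "u \<in> carrier_vec (gdim ?E)"
      using gsubmoduleD(2)[OF X upper_SL2 f(1)] gsubmoduleD(3)[OF X] by (auto simp: u_def)
    have "form_eval \<nu> u 1 0 = form_eval \<nu> f 1 x"
      unfolding u_def form_eval_act[OF fC] by simp
    moreover have "form_eval \<nu> u 1 0 = u $ 0"
    proof -
      have "form_eval \<nu> u 1 0 = (\<Sum>r<length ?e. if r = 0 then u $ r else 0)"
        unfolding form_eval_def
      proof (intro sum.cong refl)
        fix r assume "r \<in> {..<length ?e}"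
        then show "u $ r * 1 ^ (\<nu> - ?e ! r) * 0 ^ (?e ! r) = (if r = 0 then u $ r else 0)"
          using expts_nth_eq_iff[of r "CHAR('k)" \<nu> 0] simple_model_first[of \<nu>, where ?'k = 'k]
          by (auto simp: gdim_simple_model)
      qed
      then show ?thesis using simple_model_first(1)[of \<nu>, where ?'k = 'k] by (simp add: gdim_simple_model)
    qed
    ultimately have u0: "u $ 0 \<noteq> 0" using x by simp
    obtain J P where JP: "weight_projections ?E J P"
      using weight_projections_exist[OF rational_simple_model] .
    have "P (int \<nu>) *\<^sub>v u = u $ 0 \<cdot>\<^sub>v unit_vec (gdim ?E) 0"
    proof (rule eq_vecI)
      fix r assume "r < dim_vec (u $ 0 \<cdot>\<^sub>v unit_vec (gdim ?E) 0)"
      then have r: "r < gdim ?E" by simp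
      then show "(P (int \<nu>) *\<^sub>v u) $ r = (u $ 0 \<cdot>\<^sub>v unit_vec (gdim ?E) 0) $ r"
        using projection_diagonal[OF rational_simple_model JP act_torus_simple_model u(2) r]
          expts_nth_eq_iff[of r "CHAR('k)" \<nu> 0] simple_model_first[of \<nu>, where ?'k = 'k]
        by (auto simp: gdim_simple_model)
    qed (use projection_carrier[OF rational_simple_model JP] in auto)
    moreover have "P (int \<nu>) *\<^sub>v u \<in> X"
      by (rule projection_submodule[OF rational_simple_model JP X u(1)])
    ultimately have "inverse (u $ 0) \<cdot>\<^sub>v (u $ 0 \<cdot>\<^sub>v unit_vec (gdim ?E) 0) \<in> X"
      using lin_subspaceD(4)[OF Xsub] by metis
    then have "unit_vec (gdim ?E) 0 \<in> X" using u0 by (simp add: smult_smult_assoc)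
    then show "X = carrier_vec (gdim ?E)"
      by (intro lower_orbit_spans Xsub gsubmoduleD(2)[OF X lower_SL2])
  qed
qed

theorem highest_weight_simple_model: "highest_weight (simple_model \<nu> :: 'k::alg_closed_field gmodule) \<nu>"
proof -
  let ?E = "simple_model \<nu> :: 'k gmodule"
  have iff: "is_weight ?E m \<longleftrightarrow> (\<exists>i\<in>set (expts CHAR('k) \<nu>). int \<nu> - 2 * int i = m)" for m
    unfolding is_weight_iff_wdim[OF rational_simple_model] wdim_simple_model
    by (auto simp: card_gt_0_iff)
  have "0 \<in> set (expts CHAR('k) \<nu>)" using CHAR_not_1[where ?'a = 'k] by (simp add: set_expts)
  then show ?thesis unfolding highest_weight_def iff dominance_le_def by auto
qed

section \<open>Semi-invariant functions on SL2 are binary forms\<close>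

text \<open>By invariance, \<open>f g\<close> depends only on the first row of \<open>g\<close>. Where \<open>g\<^sub>0\<^sub>0 \<noteq> 0\<close> it is
\<open>g\<^sub>0\<^sub>0\<^sup>m Q(g\<^sub>0\<^sub>1 / g\<^sub>0\<^sub>0)\<close>, and where \<open>g\<^sub>0\<^sub>1 \<noteq> 0\<close> it is \<open>g\<^sub>0\<^sub>1\<^sup>m R(g\<^sub>0\<^sub>0 / g\<^sub>0\<^sub>1)\<close>, for polynomials \<open>Q\<close> and \<open>R\<close>.
That the two agree on the overlap bounds the degree of \<open>Q\<close> by \<open>m\<close>.\<close>

lemma semi_invariant_function_is_form:
  fixes f :: "'k::alg_closed_field mat \<Rightarrow> 'k"
  assumes f: "f \<in> regular_functions"
    and lower: "\<And>s g. g \<in> carrier SL2 \<Longrightarrow> f (lower s * g) = f g"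
    and torus: "\<And>t g. t \<noteq> 0 \<Longrightarrow> g \<in> carrier SL2 \<Longrightarrow> f (torus t * g) = t powi m * f g"
    and Q: "\<And>x. f (upper x) = poly Q x"
  shows "coeff Q i \<noteq> 0 \<Longrightarrow> int i \<le> m"
    and "g \<in> carrier SL2 \<Longrightarrow> f g = homog (nat m) Q (g $$ (0, 0)) (g $$ (0, 1))"
proof -
  obtain R where R: "\<And>x. f (mat2 x 1 (- 1) 0) = poly R x" using regular_along_unipotent(3)[OF f] by blast
  have F1: "f (mat2 a b c d) = a powi m * poly Q (b / a)" if "a \<noteq> 0" "a * d - b * c = 1" for a b c d
  proof -
    have "mat2 a b c d = lower (c / a) * (torus a * upper (b / a))"
      unfolding torus_eq mat2_mult by (intro mat2_cong) (use that in \<open>simp_all add: field_simps\<close>)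
    then show ?thesis
      using that lower torus Q by (simp add: SL2_mult_closed torus_in_SL2 lower_SL2 upper_SL2)
  qed
  have F2: "f (mat2 a b c d) = b powi m * poly R (a / b)" if "b \<noteq> 0" "a * d - b * c = 1" for a b c d
  proof -
    have "mat2 (a / b) 1 (- 1) 0 \<in> carrier SL2" by (simp add: mat2_in_SL2)
    moreover have "mat2 a b c d = lower (d / b) * (torus b * mat2 (a / b) 1 (- 1) 0)"
      unfolding torus_eq mat2_mult by (intro mat2_cong) (use that in \<open>simp_all add: field_simps\<close>)
    ultimately show ?thesis
      using that lower torus R by (simp add: SL2_mult_closed torus_in_SL2)
  qed
  define a where "a = (\<lambda>k. if k \<ge> 0 then coeff Q (nat k) else 0)"
  define b where "b = (\<lambda>k. if k \<le> m then coeff R (nat (m - k)) else 0)"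
  \<comment> \<open>The two cells \<open>g\<^sub>0\<^sub>0 \<noteq> 0\<close> and \<open>g\<^sub>0\<^sub>1 \<noteq> 0\<close> overlap, and there \<open>Q(x) = x\<^sup>m R(1/x)\<close>.\<close>
  have "a = b"
  proof (rule laurent_eqI[of "int ` {..degree Q}" _ "(\<lambda>j. m - int j) ` {..degree R}"])
    fix k assume "k \<notin> int ` {..degree Q}"
    then have "k < 0 \<or> nat k > degree Q" by (metis atMost_iff image_eqI int_nat_eq not_le)
    then show "a k = 0" by (auto simp: a_def coeff_eq_0)
  next
    fix k assume k: "k \<notin> (\<lambda>j. m - int j) ` {..degree R}"
    have "k > m \<or> nat (m - k) > degree R"
    proof (rule ccontr)
      assume "\<not> ?thesis"
      then have "k = m - int (nat (m - k))" "nat (m - k) \<in> {..degree R}" by auto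
      with k show False by blast
    qed
    then show "b k = 0" by (auto simp: b_def coeff_eq_0)
  next
    fix x :: 'k assume x: "x \<noteq> 0"
    have "(\<Sum>k\<in>int ` {..degree Q}. x powi k * a k) = poly Q x"
      by (subst sum.reindex) (auto simp: a_def poly_altdef mult.commute)
    also have "\<dots> = x powi m * poly R (1 / x)"
      using F2[where a = 1 and b = x and c = 0 and d = 1] x Q[of x] by simp
    also have "\<dots> = (\<Sum>j\<le>degree R. x powi (m - int j) * coeff R j)"
      unfolding poly_altdef sum_distrib_left
      by (intro sum.cong refl) (use x in \<open>simp add: power_int_diff power_divide\<close>)
    also have "\<dots> = (\<Sum>k\<in>(\<lambda>j. m - int j) ` {..degree R}. x powi k * b k)"
      by (subst sum.reindex) (auto simp: b_def inj_on_def)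
    finally show "(\<Sum>k\<in>int ` {..degree Q}. x powi k * a k) =
      (\<Sum>k\<in>(\<lambda>j. m - int j) ` {..degree R}. x powi k * b k)" .
  qed auto
  then have ab: "a k = b k" for k by simp
  show deg: "int i \<le> m" if "coeff Q i \<noteq> 0" for i
    using ab[of "int i"] that by (auto simp: a_def b_def split: if_splits)
  have Q0: "Q = 0" if "m < 0"
    using deg that by (intro poly_eqI) fastforce
  show "f g = homog (nat m) Q (g $$ (0, 0)) (g $$ (0, 1))" if g: "g \<in> carrier SL2"
  proof -
    obtain a' b' c d where g': "g = mat2 a' b' c d" "a' * d - b' * c = 1" using SL2_cases[OF g] .
    show ?thesis
    proof (cases "a' = 0")
      case False
      show ?thesis
      proof (cases "m < 0")
        case True
        then show ?thesis using F1[OF False g'(2)] g'(1) Q0 by (simp add: homog_def)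
      next
        case m: False
        have "poly Q (b' / a') = (\<Sum>i\<le>nat m. coeff Q i * (b' / a') ^ i)"
          unfolding poly_altdef
        proof (rule sum.mono_neutral_cong)
          show "coeff Q i * (b' / a') ^ i = 0" if "i \<in> {..nat m} - {..degree Q}" for i
            using that by (simp add: coeff_eq_0)
          show "coeff Q i * (b' / a') ^ i = 0" if "i \<in> {..degree Q} - {..nat m}" for i
            using that deg[of i] m by auto
        qed auto
        then have "f g = (\<Sum>i\<le>nat m. a' powi m * (coeff Q i * (b' / a') ^ i))"
          using F1[OF False g'(2)] g'(1) by (simp add: sum_distrib_left)
        also have "\<dots> = (\<Sum>i\<le>nat m. coeff Q i * a' ^ (nat m - i) * b' ^ i)"
        proof (intro sum.cong refl)
          fix i assume "i \<in> {..nat m}"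
          then have "a' ^ nat m = a' ^ (nat m - i) * a' ^ i" by (simp flip: power_add)
          moreover have "a' powi m = a' ^ nat m" using m by (simp add: power_int_def)
          ultimately show "a' powi m * (coeff Q i * (b' / a') ^ i) = coeff Q i * a' ^ (nat m - i) * b' ^ i"
            using False by (simp add: power_divide)
        qed
        finally show ?thesis using g'(1) by (simp add: homog_def)
      qed
    next
      case True
      then have b': "b' \<noteq> 0" using g'(2) by auto
      have fg: "f g = b' powi m * coeff R 0"
        using F2[OF b' g'(2)] g'(1) True by (simp add: poly_0_coeff_0)
      have "coeff R 0 = a m" using ab[of m] by (simp add: b_def)
      show ?thesis
      proof (cases "m < 0")
        case True
        then show ?thesis using fg \<open>coeff R 0 = a m\<close> Q0 by (simp add: a_def homog_def)
      next
        case False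
        have "homog (nat m) Q 0 b' = (\<Sum>i\<le>nat m. if i = nat m then coeff Q i * b' ^ i else 0)"
          unfolding homog_def by (intro sum.cong refl) auto
        then show ?thesis
          using fg False True g'(1) \<open>coeff R 0 = a m\<close> by (simp add: a_def power_int_def)
      qed
    qed
  qed
qed

section \<open>From a semi-invariant functional to the model\<close>

text \<open>The functional \<open>y\<close> of weight \<open>m\<close>, invariant under the lower unipotent subgroup, turns a vector \<open>v\<close>
  of \<open>W\<close> into the binary form \<open>g \<mapsto> y (g v)\<close>.\<close>

locale semi_invariant_functional =
  fixes M :: "'k::alg_closed_field gmodule" and W :: "'k vec set" and y :: "'k vec" and m :: int
  assumes M: "rational_module M" and W: "gsubmodule M W" and y: "y \<in> carrier_vec (gdim M)"
    and y_torus: "\<And>t v. t \<noteq> 0 \<Longrightarrow> v \<in> carrier_vec (gdim M) \<Longrightarrow>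
      y \<bullet> (act M (torus t) *\<^sub>v v) = t powi m * (y \<bullet> v)"
    and y_lower: "\<And>s v. v \<in> W \<Longrightarrow> y \<bullet> (act M (lower s) *\<^sub>v v) = y \<bullet> v"
begin

text \<open>The dehomogenised form, given by its values on the upper unipotent subgroup. Vectors outside \<open>W\<close>
need not give forms of degree \<open>m\<close>, but the polynomial exists for all vectors and depends linearly on them.\<close>

definition form :: "'k vec \<Rightarrow> 'k poly" where
  "form v = (THE Q. \<forall>x. y \<bullet> (act M (upper x) *\<^sub>v v) = poly Q x)"

lemma W_carrier: "v \<in> W \<Longrightarrow> v \<in> carrier_vec (gdim M)"
  by (rule gsubmoduleD(3)[OF W])

lemma formI: "(\<And>x. y \<bullet> (act M (upper x) *\<^sub>v v) = poly Q x) \<Longrightarrow> form v = Q"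
  unfolding form_def by (rule the_equality) (auto intro: poly_eqI_nonzero)

lemma poly_form:
  assumes v: "v \<in> carrier_vec (gdim M)"
  shows "y \<bullet> (act M (upper x) *\<^sub>v v) = poly (form v) x"
proof -
  obtain f where f: "f \<in> regular_functions" "\<And>g. g \<in> carrier SL2 \<Longrightarrow> y \<bullet> (act M g *\<^sub>v v) = f g"
    using matrix_coefficient_regular[OF M v] by metis
  obtain Q where "\<And>x. f (upper x) = poly Q x" using regular_along_unipotent(2)[OF f(1)] by blast
  then have *: "y \<bullet> (act M (upper x) *\<^sub>v v) = poly Q x" for x
    using f(2)[OF upper_SL2] by simp
  then show ?thesis using formI[of v Q] by simp
qed

lemma form_degree_and_eval:
  assumes v: "v \<in> W"
  shows "coeff (form v) i \<noteq> 0 \<Longrightarrow> int i \<le> m"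
    and "g \<in> carrier SL2 \<Longrightarrow> y \<bullet> (act M g *\<^sub>v v) = homog (nat m) (form v) (g $$ (0, 0)) (g $$ (0, 1))"
proof -
  note vC = W_carrier[OF v]
  obtain f where f: "f \<in> regular_functions" "\<And>g. g \<in> carrier SL2 \<Longrightarrow> y \<bullet> (act M g *\<^sub>v v) = f g"
    using matrix_coefficient_regular[OF M vC] by metis
  have 1: "f (lower s * g) = f g" if g: "g \<in> carrier SL2" for s g
    using f(2)[OF SL2_mult_closed[OF lower_SL2 g], symmetric] f(2)[OF g, symmetric]
      act_act[OF M lower_SL2 g vC] y_lower[OF gsubmoduleD(2)[OF W g v]] by simp
  have 2: "f (torus t * g) = t powi m * f g" if t: "t \<noteq> 0" and g: "g \<in> carrier SL2" for t g
    using f(2)[OF SL2_mult_closed[OF torus_in_SL2[OF t] g], symmetric] f(2)[OF g, symmetric]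
      act_act[OF M torus_in_SL2[OF t] g vC] y_torus[OF t act_carrier[OF M g vC]] by simp
  have 3: "f (upper x) = poly (form v) x" for x
    using poly_form[OF vC, of x] f(2)[OF upper_SL2] by simp
  show "coeff (form v) i \<noteq> 0 \<Longrightarrow> int i \<le> m"
    by (rule semi_invariant_function_is_form(1)[OF f(1) 1 2 3])
  show "y \<bullet> (act M g *\<^sub>v v) = homog (nat m) (form v) (g $$ (0, 0)) (g $$ (0, 1))" if "g \<in> carrier SL2"
    unfolding f(2)[OF that] by (rule semi_invariant_function_is_form(2)[OF f(1) 1 2 3 that])
qed

lemma form_add: "u \<in> carrier_vec (gdim M) \<Longrightarrow> v \<in> carrier_vec (gdim M) \<Longrightarrow> form (u + v) = form u + form v"
  using mult_add_distrib_mat_vec[OF rational_moduleD(1)[OF M upper_SL2], of u v]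
    act_carrier[OF M upper_SL2]
  by (intro formI) (simp add: poly_form[symmetric] scalar_prod_add_distrib[OF y])

lemma form_smult: "v \<in> carrier_vec (gdim M) \<Longrightarrow> form (c \<cdot>\<^sub>v v) = Polynomial.smult c (form v)"
  using mult_mat_vec[OF rational_moduleD(1)[OF M upper_SL2], of v]
    act_carrier[OF M upper_SL2] y
  by (intro formI) (simp add: poly_form[symmetric])

lemma form_unit_vecs:
  assumes v: "v \<in> carrier_vec (gdim M)"
  shows "form v = (\<Sum>i<gdim M. Polynomial.smult (v $ i) (form (unit_vec (gdim M) i)))"
proof (rule formI)
  fix x
  let ?A = "act M (upper x)"
  have A: "?A \<in> carrier_mat (gdim M) (gdim M)" by (rule rational_moduleD(1)[OF M upper_SL2])
  have Ty: "?A\<^sup>T *\<^sub>v y \<in> carrier_vec (gdim M)" using A y by auto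
  have *: "(?A\<^sup>T *\<^sub>v y) $ i = poly (form (unit_vec (gdim M) i)) x" if i: "i < gdim M" for i
  proof -
    have "(?A\<^sup>T *\<^sub>v y) $ i = (?A\<^sup>T *\<^sub>v y) \<bullet> unit_vec (gdim M) i"
      using scalar_prod_right_unit[OF i, of "?A\<^sup>T *\<^sub>v y"] by simp
    also have "\<dots> = y \<bullet> (?A *\<^sub>v unit_vec (gdim M) i)"
      using scalar_prod_transpose[OF A unit_vec_carrier y] by simp
    also have "\<dots> = poly (form (unit_vec (gdim M) i)) x" by (rule poly_form) simp
    finally show ?thesis .
  qed
  have "y \<bullet> (?A *\<^sub>v v) = (?A\<^sup>T *\<^sub>v y) \<bullet> v" by (rule scalar_prod_transpose[OF A v y])
  also have "\<dots> = (\<Sum>i<gdim M. (?A\<^sup>T *\<^sub>v y) $ i * v $ i)"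
    using v by (simp add: scalar_prod_def atLeast0LessThan del: index_mult_mat_vec)
  also have "\<dots> = poly (\<Sum>i<gdim M. Polynomial.smult (v $ i) (form (unit_vec (gdim M) i))) x"
    by (simp add: poly_sum * mult.commute del: index_mult_mat_vec)
  finally show "y \<bullet> (?A *\<^sub>v v) = poly (\<Sum>i<gdim M. Polynomial.smult (v $ i) (form (unit_vec (gdim M) i))) x" .
qed

text \<open>The map to binary forms is equivariant.\<close>

lemma form_act:
  assumes v: "v \<in> W" and h: "h \<in> carrier SL2"
  shows "form (act M h *\<^sub>v v) = (\<Sum>i\<le>nat m. Polynomial.smult (coeff (form v) i) (form_poly (nat m) h i))"
proof (rule formI)
  fix x
  obtain a b c d where h': "h = mat2 a b c d" using SL2_cases[OF h] by metis
  have "y \<bullet> (act M (upper x) *\<^sub>v (act M h *\<^sub>v v)) = y \<bullet> (act M (upper x * h) *\<^sub>v v)"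
    using act_act[OF M upper_SL2 h W_carrier[OF v]] by simp
  also have "\<dots> = homog (nat m) (form v) (a + x * c) (b + x * d)"
    using form_degree_and_eval(2)[OF v SL2_mult_closed[OF upper_SL2[of x] h]]
    by (simp add: h' mat2_mult)
  also have "\<dots> = poly (\<Sum>i\<le>nat m. Polynomial.smult (coeff (form v) i) (form_poly (nat m) h i)) x"
    unfolding homog_def poly_sum poly_smult form_poly_def poly_mult poly_power
    by (intro sum.cong refl) (simp add: h' mult.assoc)
  finally show "y \<bullet> (act M (upper x) *\<^sub>v (act M h *\<^sub>v v)) =
    poly (\<Sum>i\<le>nat m. Polynomial.smult (coeff (form v) i) (form_poly (nat m) h i)) x" .
qed

text \<open>Upper unipotent elements raise weights, and \<open>y\<close> sees only the weight \<open>m\<close>; hence a vector of weight \<open>m\<close>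
goes to a multiple of \<open>x\<^sup>m\<close>.\<close>

lemma form_weight_vector:
  assumes v: "v \<in> weight_space M m" and i: "i \<noteq> 0"
  shows "coeff (form v) i = 0"
proof (rule ccontr)
  assume nz: "coeff (form v) i \<noteq> 0"
  have vC: "v \<in> carrier_vec (gdim M)" using v by (simp add: weight_space_def)
  have "t powi (- 2 * int i) * coeff (form v) i = t powi 0 * coeff (form v) i" if t: "t \<noteq> 0" for t
  proof -
    have "form v = pcompose (form v) [:0, inverse (t * t):]"
    proof (rule formI)
      fix x
      have tv: "act M (torus t) *\<^sub>v v = t powi m \<cdot>\<^sub>v v" using v t by (simp add: weight_space_def)
      have uC: "act M (upper z) *\<^sub>v v \<in> carrier_vec (gdim M)" for z
        by (rule act_carrier[OF M upper_SL2 vC])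
      have "t powi m * (y \<bullet> (act M (upper x) *\<^sub>v v)) = y \<bullet> (act M (upper x) *\<^sub>v (act M (torus t) *\<^sub>v v))"
        using mult_mat_vec[OF rational_moduleD(1)[OF M upper_SL2] vC] tv uC y by simp
      also have "\<dots> = y \<bullet> (act M (upper x * torus t) *\<^sub>v v)"
        using act_act[OF M upper_SL2 torus_in_SL2[OF t] vC] by simp
      also have "upper x * torus t = torus t * upper (x * inverse (t * t))"
        using t by (simp add: torus_eq mat2_mult field_simps)
      also have "y \<bullet> (act M (torus t * upper (x * inverse (t * t))) *\<^sub>v v) =
          t powi m * (y \<bullet> (act M (upper (x * inverse (t * t))) *\<^sub>v v))"
        using act_act[OF M torus_in_SL2[OF t] upper_SL2 vC] y_torus[OF t uC] by simp
      also have "y \<bullet> (act M (upper (x * inverse (t * t))) *\<^sub>v v) = poly (form v) (x * inverse (t * t))"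
        by (rule poly_form[OF vC])
      finally show "y \<bullet> (act M (upper x) *\<^sub>v v) = poly (pcompose (form v) [:0, inverse (t * t):]) x"
        using t by (simp add: poly_pcompose mult_ac)
    qed
    then have "coeff (form v) i = inverse (t * t) ^ i * coeff (form v) i"
      by (metis coeff_pcompose_linear)
    moreover have "inverse (t * t) ^ i = t powi (- 2 * int i)"
      using inverse_square_power by simp
    ultimately show ?thesis by simp
  qed
  from powi_eq_imp_eq[OF this nz] show False using i by simp
qed

text \<open>The vectors of \<open>W\<close> whose form lies in the simple model constitute a submodule that contains \<open>U\<close> and \<open>v0\<close>,
so by maximality of \<open>U\<close> it is \<open>W\<close>; likewise the kernel of the map to the model is \<open>U\<close>. The map is onto
since the image of \<open>v0\<close> is a nonzero multiple of the generator \<open>x\<^sup>m\<close>.\<close>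

theorem quotient_iso_model:
  assumes U: "gsubmodule M U" "U \<subseteq> W" and yU: "\<And>u. u \<in> U \<Longrightarrow> y \<bullet> u = 0"
    and v0: "v0 \<in> W" "v0 \<in> weight_space M m" "y \<bullet> v0 \<noteq> 0"
    and max: "\<And>X. gsubmodule M X \<Longrightarrow> U \<subseteq> X \<Longrightarrow> X \<subseteq> W \<Longrightarrow> X = U \<or> X = W"
  shows "quotient_iso M W U (simple_model (nat m))"
proof -
  define \<nu> where "\<nu> = nat m"
  let ?E = "simple_model \<nu> :: 'k gmodule" and ?e = "expts CHAR('k) \<nu>" and ?S = "set (expts CHAR('k) \<nu>)"
  have dimE: "gdim ?E = length ?e" by (rule gdim_simple_model)
  have one: "act M (1\<^sub>m 2) = 1\<^sub>m (gdim M)" by (rule rational_moduleD(3)[OF M])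
  have c0: "coeff (form v0) 0 = y \<bullet> v0"
    using poly_form[OF W_carrier[OF v0(1)], of 0] one W_carrier[OF v0(1)] by (simp add: poly_0_coeff_0 flip: one_mat2)
  have m: "int \<nu> = m" using form_degree_and_eval(1)[OF v0(1), of 0] c0 v0(3) by (simp add: \<nu>_def)
  have S0: "0 \<in> ?S" using CHAR_not_1[where ?'a = 'k] by (simp add: set_expts)
  \<comment> \<open>the preimage of the simple model\<close>
  define X where "X = {v \<in> W. \<forall>i. coeff (form v) i \<noteq> 0 \<longrightarrow> i \<in> ?S}"
  have X_W: "X \<subseteq> W" by (auto simp: X_def)
  note Wsub = gsubmoduleD(1)[OF W]
  have formU: "form u = 0" if "u \<in> U" for u
    by (rule formI) (use yU gsubmoduleD(2)[OF U(1) upper_SL2 that] in simp)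
  have "lin_subspace (gdim M) X"
    unfolding lin_subspace_def
  proof (intro conjI ballI allI)
    show "X \<subseteq> carrier_vec (gdim M)" using X_W W_carrier by auto
    have "0\<^sub>v (gdim M) \<in> U" by (rule lin_subspaceD(2)[OF gsubmoduleD(1)[OF U(1)]])
    then show "0\<^sub>v (gdim M) \<in> X" using formU U(2) by (auto simp: X_def)
    show "v + w \<in> X" if "v \<in> X" "w \<in> X" for v w
      using that lin_subspaceD(3)[OF Wsub] form_add[OF W_carrier W_carrier, of v w] unfolding X_def
      by (auto, metis add_0)
    show "c \<cdot>\<^sub>v v \<in> X" if "v \<in> X" for c v
      using that lin_subspaceD(4)[OF Wsub] form_smult[OF W_carrier, of v c] unfolding X_def by auto
  qed
  moreover have "act M h *\<^sub>v v \<in> X" if h: "h \<in> carrier SL2" and v: "v \<in> X" for h v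
    unfolding X_def
  proof (intro CollectI conjI allI impI)
    have vW: "v \<in> W" using v X_W by auto
    show hv: "act M h *\<^sub>v v \<in> W" by (rule gsubmoduleD(2)[OF W h vW])
    fix i assume i: "coeff (form (act M h *\<^sub>v v)) i \<noteq> 0"
    then have "int i \<le> m" by (rule form_degree_and_eval(1)[OF hv])
    show "i \<in> ?S"
    proof (rule ccontr)
      assume n: "i \<notin> ?S"
      have "coeff (form v) j * coeff (form_poly \<nu> h j) i = 0" for j
        using form_poly_coeff_outside[OF _ n, of j h] \<open>int i \<le> m\<close> m v by (auto simp: X_def)
      then have "coeff (form (act M h *\<^sub>v v)) i = 0"
        by (simp add: form_act[OF vW h] coeff_sum flip: \<nu>_def)
      then show False using i by simp
    qed
  qed
  ultimately have X: "gsubmodule M X" by (simp add: gsubmodule_iff)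
  have "U \<subseteq> X" using formU U(2) by (auto simp: X_def)
  moreover have "i \<in> ?S" if "coeff (form v0) i \<noteq> 0" for i
    using that form_weight_vector[OF v0(2), of i] S0 by (cases "i = 0") auto
  then have "v0 \<in> X" using v0(1) by (simp add: X_def)
  moreover have "v0 \<notin> U" using yU v0(3) by auto
  ultimately have XW: "X = W" using max[OF X] X_W by blast
  have supp: "i \<in> ?S" if "v \<in> W" "coeff (form v) i \<noteq> 0" for v i
    using that XW by (auto simp: X_def)
  define A where "A = mat (gdim ?E) (gdim M) (\<lambda>(r, i). coeff (form (unit_vec (gdim M) i)) (?e ! r))"
  have A: "A \<in> carrier_mat (gdim ?E) (gdim M)" by (simp add: A_def)
  have Av: "(A *\<^sub>v v) $ r = coeff (form v) (?e ! r)" if "v \<in> carrier_vec (gdim M)" "r < gdim ?E" for v r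
    using that form_unit_vecs[OF that(1)]
    by (simp add: A_def scalar_prod_def atLeast0LessThan coeff_sum mult.commute)
  have equiv: "A *\<^sub>v (act M h *\<^sub>v v) = act ?E h *\<^sub>v (A *\<^sub>v v)"
    if h: "h \<in> carrier SL2" and v: "v \<in> W" for h v
  proof (rule eq_vecI)
    note vC = W_carrier[OF v]
    fix r assume "r < dim_vec (act ?E h *\<^sub>v (A *\<^sub>v v))"
    then have r: "r < gdim ?E" using act_simple_model_carrier[of \<nu> h] by simp
    have "(A *\<^sub>v (act M h *\<^sub>v v)) $ r = coeff (form (act M h *\<^sub>v v)) (?e ! r)"
      by (rule Av[OF act_carrier[OF M h vC] r])
    also have "\<dots> = (\<Sum>i\<le>\<nu>. coeff (form v) i * coeff (form_poly \<nu> h i) (?e ! r))"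
      by (simp add: form_act[OF v h] coeff_sum flip: \<nu>_def)
    also have "\<dots> = (\<Sum>i\<in>?S. coeff (form v) i * coeff (form_poly \<nu> h i) (?e ! r))"
      by (intro sum.mono_neutral_right) (use supp[OF v] in \<open>auto simp: set_expts\<close>)
    also have "\<dots> = (\<Sum>c<length ?e. coeff (form v) (?e ! c) * coeff (form_poly \<nu> h (?e ! c)) (?e ! r))"
      by (rule sum_expts [symmetric])
    also have "\<dots> = (\<Sum>c<length ?e. act ?E h $$ (r, c) * (A *\<^sub>v v) $ c)"
      by (intro sum.cong refl) (use r Av[OF vC] act_simple_model_index[of r \<nu> _ h] in \<open>simp add: dimE del: index_mult_mat_vec\<close>)
    also have "\<dots> = (act ?E h *\<^sub>v (A *\<^sub>v v)) $ r"
      using r A act_simple_model_carrier[of \<nu> h] dimE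
      by (simp add: scalar_prod_def atLeast0LessThan)
    finally show "(A *\<^sub>v (act M h *\<^sub>v v)) $ r = (act ?E h *\<^sub>v (A *\<^sub>v v)) $ r" .
  qed (use A act_simple_model_carrier[of \<nu> h] in auto)
  define K where "K = {w \<in> W. A *\<^sub>v w = 0\<^sub>v (gdim ?E)}"
  have "gsubmodule M K"
    unfolding gsubmodule_iff
  proof (intro conjI ballI)
    show "lin_subspace (gdim M) K" unfolding K_def by (rule lin_subspace_kernel[OF Wsub A])
    show "act M h *\<^sub>v v \<in> K" if h: "h \<in> carrier SL2" and v: "v \<in> K" for h v
      using v equiv[OF h, of v] gsubmoduleD(2)[OF W h, of v] mult_mat_zero_vec[OF act_simple_model_carrier]
      by (simp add: K_def)
  qed
  moreover have "U \<subseteq> K"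
  proof
    fix u assume u: "u \<in> U"
    have uC: "u \<in> carrier_vec (gdim M)" by (rule gsubmoduleD(3)[OF U(1) u])
    have "A *\<^sub>v u = 0\<^sub>v (gdim ?E)"
      by (rule eq_vecI) (use A Av[OF uC] formU[OF u] in \<open>auto simp del: index_mult_mat_vec\<close>)
    then show "u \<in> K" using u U(2) by (auto simp: K_def)
  qed
  moreover have "v0 \<notin> K"
  proof
    assume "v0 \<in> K"
    then have "(A *\<^sub>v v0) $ 0 = 0" using simple_model_first(1)[of \<nu>, where ?'k = 'k] by (simp add: K_def)
    then show False
      using Av[OF W_carrier[OF v0(1)], of 0] simple_model_first[of \<nu>, where ?'k = 'k] c0 v0(3) by simp
  qed
  ultimately have KU: "K = U" using max[of K] v0(1) by (auto simp: K_def)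
  have Av0: "A *\<^sub>v v0 = (y \<bullet> v0) \<cdot>\<^sub>v unit_vec (gdim ?E) 0"
  proof (rule eq_vecI)
    fix r assume "r < dim_vec ((y \<bullet> v0) \<cdot>\<^sub>v unit_vec (gdim ?E) 0)"
    then have r: "r < gdim ?E" by simp
    have "?e ! r = 0 \<longleftrightarrow> r = 0"
      using r simple_model_first[of \<nu>, where ?'k = 'k] expts_nth_eq_iff[of r "CHAR('k)" \<nu> 0] by (simp add: dimE)
    then show "(A *\<^sub>v v0) $ r = ((y \<bullet> v0) \<cdot>\<^sub>v unit_vec (gdim ?E) 0) $ r"
      using Av[OF W_carrier[OF v0(1)] r] form_weight_vector[OF v0(2), of "?e ! r"] c0 r
      by (auto simp del: index_mult_mat_vec)
  qed (use A in auto)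
  have "(\<lambda>w. A *\<^sub>v w) ` W = carrier_vec (gdim ?E)"
  proof (rule lower_orbit_spans[OF lin_subspace_image[OF Wsub A]])
    fix s
    define w where "w = inverse (y \<bullet> v0) \<cdot>\<^sub>v v0"
    have w: "w \<in> W" using lin_subspaceD(4)[OF Wsub v0(1)] by (simp add: w_def)
    have "A *\<^sub>v w = unit_vec (gdim ?E) 0"
      using mult_mat_vec[OF A W_carrier[OF v0(1)]] v0(3) by (simp add: w_def Av0 smult_smult_assoc)
    then show "act ?E (lower s) *\<^sub>v unit_vec (gdim ?E) 0 \<in> (\<lambda>w. A *\<^sub>v w) ` W"
      using equiv[OF lower_SL2 w, of s] gsubmoduleD(2)[OF W lower_SL2 w]
      by (metis image_eqI)
  qed
  then show ?thesis
    unfolding quotient_iso_def \<nu>_def[symmetric] using A KU equiv by (intro bexI[of _ A]) (auto simp: K_def)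
qed

end

section \<open>Classification of simple subquotients\<close>

lemma torus_conj_lower:
  "t \<noteq> 0 \<Longrightarrow> lower (s * inverse (t * t)) = torus t * (lower s * torus (inverse t))"
  unfolding torus_eq mat2_mult by (intro mat2_cong) (auto simp: field_simps)

text \<open>The lower unipotent subgroup lowers weights: \<open>s \<mapsto> y (lower s v)\<close> is a polynomial that, by conjugation
with the torus, is homogeneous of degree \<open>(j - m) / 2\<close>. For \<open>j \<le> m\<close> it is therefore constant.\<close>

lemma lower_invariance_on_weight_vectors:
  fixes M :: "'k::alg_closed_field gmodule"
  assumes M: "rational_module M" and y: "y \<in> carrier_vec (gdim M)"
    and y_torus: "\<And>t v. t \<noteq> 0 \<Longrightarrow> v \<in> carrier_vec (gdim M) \<Longrightarrow>
      y \<bullet> (act M (torus t) *\<^sub>v v) = t powi m * (y \<bullet> v)"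
    and v: "v \<in> weight_space M j" and jm: "j \<le> m"
  shows "y \<bullet> (act M (lower s) *\<^sub>v v) = y \<bullet> v"
proof -
  have vC: "v \<in> carrier_vec (gdim M)" using v by (simp add: weight_space_def)
  obtain f where f: "f \<in> regular_functions" "\<And>g. g \<in> carrier SL2 \<Longrightarrow> y \<bullet> (act M g *\<^sub>v v) = f g"
    using matrix_coefficient_regular[OF M vC] by metis
  obtain P where P: "\<And>s. y \<bullet> (act M (lower s) *\<^sub>v v) = poly P s"
    using f(2)[OF lower_SL2] regular_along_unipotent(1)[OF f(1)] by auto
  have hom: "t powi (- 2 * int i) * coeff P i = t powi (m - j) * coeff P i" if t: "t \<noteq> 0" for t i
  proof -
    have "pcompose P [:0, inverse (t * t):] = Polynomial.smult (t powi (m - j)) P"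
    proof (rule poly_eqI_nonzero)
      fix s
      have t': "inverse t \<noteq> 0" using t by simp
      note C1 = act_carrier[OF M lower_SL2 vC, of s]
      have "y \<bullet> (act M (lower (s * inverse (t * t))) *\<^sub>v v) =
          y \<bullet> (act M (torus t) *\<^sub>v (act M (lower s) *\<^sub>v (act M (torus (inverse t)) *\<^sub>v v)))"
        using act_act[OF M lower_SL2 torus_in_SL2[OF t'] vC]
          act_act[OF M torus_in_SL2[OF t] SL2_mult_closed[OF lower_SL2 torus_in_SL2[OF t']] vC]
        by (simp only: torus_conj_lower[OF t])
      also have "act M (torus (inverse t)) *\<^sub>v v = inverse t powi j \<cdot>\<^sub>v v"
        using v t' by (simp add: weight_space_def)
      also have "act M (lower s) *\<^sub>v (inverse t powi j \<cdot>\<^sub>v v) = inverse t powi j \<cdot>\<^sub>v (act M (lower s) *\<^sub>v v)"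
        by (rule mult_mat_vec[OF rational_moduleD(1)[OF M lower_SL2] vC])
      also have "y \<bullet> (act M (torus t) *\<^sub>v (inverse t powi j \<cdot>\<^sub>v (act M (lower s) *\<^sub>v v))) =
          t powi m * (inverse t powi j * (y \<bullet> (act M (lower s) *\<^sub>v v)))"
        using y_torus[OF t, of "inverse t powi j \<cdot>\<^sub>v (act M (lower s) *\<^sub>v v)"] C1 y by simp
      also have "\<dots> = t powi (m - j) * (y \<bullet> (act M (lower s) *\<^sub>v v))"
        using t by (simp add: power_int_diff power_int_inverse divide_inverse)
      finally show "poly (pcompose P [:0, inverse (t * t):]) s = poly (Polynomial.smult (t powi (m - j)) P) s"
        by (simp add: poly_pcompose P)
    qed
    then have "inverse (t * t) ^ i * coeff P i = t powi (m - j) * coeff P i"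
      by (metis coeff_pcompose_linear coeff_smult)
    moreover have "inverse (t * t) ^ i = t powi (- 2 * int i)"
      using inverse_square_power by simp
    ultimately show ?thesis by simp
  qed
  have "coeff P i = 0" if "i \<noteq> 0" for i
  proof (rule ccontr)
    assume "coeff P i \<noteq> 0"
    from powi_eq_imp_eq[OF hom this] show False using jm that by simp
  qed
  then have "P = [:coeff P 0:]" by (intro poly_eqI) (simp add: coeff_pCons split: nat.split)
  then have "poly P s = poly P 0" by (metis poly_pCons poly_0 mult_zero_right)
  then show ?thesis
    using P[of s] P[of 0] rational_moduleD(3)[OF M] vC by (simp flip: one_mat2)
qed

text \<open>Take the highest weight \<open>m\<close> of \<open>W\<close> that does not already occur in \<open>U\<close> with full multiplicity, and a
  functional of weight \<open>m\<close> that kills \<open>U\<close> but not \<open>W\<close>. Modulo \<open>U\<close> there is no weight above \<open>m\<close>, so this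
  functional is invariant under the lower unipotent subgroup.\<close>

theorem simple_subquotient_is_model:
  fixes M :: "'k::alg_closed_field gmodule"
  assumes M: "rational_module M" and U: "gsubmodule M U" and W: "gsubmodule M W" and UW: "U \<subset> W"
    and max: "\<And>X. gsubmodule M X \<Longrightarrow> U \<subseteq> X \<Longrightarrow> X \<subseteq> W \<Longrightarrow> X = U \<or> X = W"
  shows "\<exists>\<nu>. quotient_iso M W U (simple_model \<nu>)"
proof -
  obtain J P where JP: "weight_projections M J P" using weight_projections_exist[OF M] .
  note Usub = gsubmoduleD(1)[OF U]
  \<comment> \<open>the weights of \<open>W / U\<close>\<close>
  define T where "T = {j. \<not> W \<inter> weight_space M j \<subseteq> U}"
  have "T \<subseteq> {j. is_weight M j}"
    using lin_subspaceD(2)[OF Usub] by (auto simp: T_def is_weight_def)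
  then have finT: "finite T" using finite_weights[OF M JP] finite_subset by auto
  have "T \<noteq> {}"
  proof
    assume T: "T = {}"
    obtain w where w: "w \<in> W" "w \<notin> U" using UW by auto
    have wC: "w \<in> carrier_vec (gdim M)" by (rule gsubmoduleD(3)[OF W w(1)])
    obtain z where z: "z \<in> carrier_vec (gdim M)" "\<And>u. u \<in> U \<Longrightarrow> z \<bullet> u = 0" "z \<bullet> w \<noteq> 0"
      using separating_functional[OF Usub wC w(2)] by blast
    have "P j *\<^sub>v w \<in> U" for j
      using T projection_submodule[OF M JP W w(1)] projection_in_weight_space[OF M JP wC] by (auto simp: T_def)
    then show False using projection_sum[OF M JP z(1) wC] z(2,3) by simp
  qed
  define m where "m = Max T"
  have mT: "m \<in> T" unfolding m_def by (rule Max_in[OF finT \<open>T \<noteq> {}\<close>])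
  have above: "v \<in> U" if "v \<in> W" "v \<in> weight_space M j" "j > m" for v j
    using that Max_ge[OF finT, of j] by (force simp: m_def T_def)
  obtain v0 where v0: "v0 \<in> W" "v0 \<in> weight_space M m" "v0 \<notin> U" using mT by (auto simp: T_def)
  have v0C: "v0 \<in> carrier_vec (gdim M)" by (rule gsubmoduleD(3)[OF W v0(1)])
  obtain z where z: "z \<in> carrier_vec (gdim M)" "\<And>u. u \<in> U \<Longrightarrow> z \<bullet> u = 0" "z \<bullet> v0 \<noteq> 0"
    using separating_functional[OF Usub v0C v0(3)] by blast
  \<comment> \<open>replace \<open>z\<close> by its component of weight \<open>m\<close>\<close>
  define y where "y = (P m)\<^sup>T *\<^sub>v z"
  note PC = projection_carrier[OF M JP]
  have y: "y \<in> carrier_vec (gdim M)" using z(1) PC[of m] by (auto simp: y_def)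
  have yv: "y \<bullet> v = z \<bullet> (P m *\<^sub>v v)" if "v \<in> carrier_vec (gdim M)" for v
    using scalar_prod_transpose[OF PC that z(1)] by (simp add: y_def)
  have y_torus: "y \<bullet> (act M (torus t) *\<^sub>v v) = t powi m * (y \<bullet> v)"
    if "t \<noteq> 0" "v \<in> carrier_vec (gdim M)" for t v
    using projection_torus[OF M JP that(2,1)] yv that act_carrier[OF M torus_in_SL2[OF that(1)] that(2)]
      projection_vec_carrier[OF M JP that(2)] z(1) by simp
  have yU: "y \<bullet> u = 0" if "u \<in> U" for u
    using yv[OF gsubmoduleD(3)[OF U that]] z(2)[OF projection_submodule[OF M JP U that]] by simp
  have yv0: "y \<bullet> v0 \<noteq> 0" using yv[OF v0C] projection_weight_vector(1)[OF M JP v0(2)] z(3) by simp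
  have inv: "y \<bullet> (act M (lower s) *\<^sub>v v) = y \<bullet> v" if v: "v \<in> W" for s v
  proof -
    let ?g = "lower s"
    have vC: "v \<in> carrier_vec (gdim M)" by (rule gsubmoduleD(3)[OF W v])
    have A: "act M ?g \<in> carrier_mat (gdim M) (gdim M)" by (rule rational_moduleD(1)[OF M lower_SL2])
    have Ty: "(act M ?g)\<^sup>T *\<^sub>v y \<in> carrier_vec (gdim M)" using A y by auto
    have "y \<bullet> (act M ?g *\<^sub>v v) = (\<Sum>j\<in>J. ((act M ?g)\<^sup>T *\<^sub>v y) \<bullet> (P j *\<^sub>v v))"
      using projection_sum[OF M JP Ty vC] scalar_prod_transpose[OF A vC y] by simp
    also have "\<dots> = (\<Sum>j\<in>J. y \<bullet> (act M ?g *\<^sub>v (P j *\<^sub>v v)))"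
      using scalar_prod_transpose[OF A projection_vec_carrier[OF M JP vC] y] by simp
    also have "\<dots> = (\<Sum>j\<in>J. y \<bullet> (P j *\<^sub>v v))"
    proof (intro sum.cong refl)
      fix j
      note Pj = projection_in_weight_space[OF M JP vC, of j]
      show "y \<bullet> (act M ?g *\<^sub>v (P j *\<^sub>v v)) = y \<bullet> (P j *\<^sub>v v)"
      proof (cases "j \<le> m")
        case True
        show ?thesis by (rule lower_invariance_on_weight_vectors[OF M y y_torus Pj True])
      next
        case False
        then have "P j *\<^sub>v v \<in> U" using above[OF projection_submodule[OF M JP W v] Pj] by simp
        then show ?thesis using yU gsubmoduleD(2)[OF U lower_SL2] by simp
      qed
    qed
    also have "\<dots> = y \<bullet> v" using projection_sum[OF M JP y vC] by simp
    finally show ?thesis .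
  qed
  interpret semi_invariant_functional M W y m
    by unfold_locales (use M W y y_torus inv in auto)
  show ?thesis using quotient_iso_model[OF U _ yU v0(1,2) yv0 max] UW by blast
qed

section \<open>Isomorphisms\<close>

abbreviation module_iso :: "'k::field gmodule \<Rightarrow> 'k gmodule \<Rightarrow> bool" where
  "module_iso M N \<equiv> quotient_iso M (carrier_vec (gdim M)) {0\<^sub>v (gdim M)} N"

lemma gsubmodule_carrier:
  assumes "rational_module M"
  shows "gsubmodule M (carrier_vec (gdim M))"
  using lin_subspace_carrier act_carrier[OF assms] by (auto simp: gsubmodule_iff)

lemma gsubmodule_zero:
  assumes "rational_module M"
  shows "gsubmodule M {0\<^sub>v (gdim M)}"
  using lin_subspace_zero mult_mat_zero_vec[OF rational_moduleD(1)[OF assms]] by (auto simp: gsubmodule_iff)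

lemma module_isoI:
  fixes M N :: "'k::field gmodule"
  assumes M: "rational_module M" and N: "rational_module N"
    and A: "A \<in> carrier_mat (gdim N) (gdim M)" and B: "B \<in> carrier_mat (gdim M) (gdim N)"
    and AB: "A * B = 1\<^sub>m (gdim N)" and BA: "B * A = 1\<^sub>m (gdim M)"
    and eq: "\<And>g. g \<in> carrier SL2 \<Longrightarrow> A * act M g = act N g * A"
  shows "module_iso M N"
  unfolding quotient_iso_def
proof (intro bexI[OF _ A] conjI ballI)
  have ABv: "A *\<^sub>v (B *\<^sub>v v) = v" if "v \<in> carrier_vec (gdim N)" for v
    using assoc_mult_mat_vec[OF A B that] AB that by simp
  have BAv: "B *\<^sub>v (A *\<^sub>v v) = v" if "v \<in> carrier_vec (gdim M)" for v
    using assoc_mult_mat_vec[OF B A that] BA that by simp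
  show "(\<lambda>w. A *\<^sub>v w) ` carrier_vec (gdim M) = carrier_vec (gdim N)"
  proof (intro equalityI subsetI)
    fix v :: "'k vec" assume v: "v \<in> carrier_vec (gdim N)"
    then have "B *\<^sub>v v \<in> carrier_vec (gdim M)" using B by auto
    then show "v \<in> (\<lambda>w. A *\<^sub>v w) ` carrier_vec (gdim M)" using ABv[OF v] by (metis image_eqI)
  qed (use A in auto)
  show "{w \<in> carrier_vec (gdim M). A *\<^sub>v w = 0\<^sub>v (gdim N)} = {0\<^sub>v (gdim M)}"
  proof (intro equalityI subsetI)
    fix w :: "'k vec" assume "w \<in> {w \<in> carrier_vec (gdim M). A *\<^sub>v w = 0\<^sub>v (gdim N)}"
    then show "w \<in> {0\<^sub>v (gdim M)}" using BAv[of w] mult_mat_zero_vec[OF B] by simp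
  qed (use mult_mat_zero_vec[OF A] in auto)
  fix g :: "'k mat" and w :: "'k vec" assume g: "g \<in> carrier SL2" and w: "w \<in> carrier_vec (gdim M)"
  show "A *\<^sub>v (act M g *\<^sub>v w) = act N g *\<^sub>v (A *\<^sub>v w)"
    using assoc_mult_mat_vec[OF A rational_moduleD(1)[OF M g] w]
      assoc_mult_mat_vec[OF rational_moduleD(1)[OF N g] A w] eq[OF g] by simp
qed

text \<open>The columns of the inverse matrix are preimages of the unit vectors.\<close>

lemma module_isoE:
  fixes M N :: "'k::field gmodule"
  assumes iso: "module_iso M N" and M: "rational_module M" and N: "rational_module N"
  obtains A B where "A \<in> carrier_mat (gdim N) (gdim M)" "B \<in> carrier_mat (gdim M) (gdim N)"
    "A * B = 1\<^sub>m (gdim N)" "B * A = 1\<^sub>m (gdim M)"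
    "\<And>g. g \<in> carrier SL2 \<Longrightarrow> A * act M g = act N g * A"
    "\<And>g. g \<in> carrier SL2 \<Longrightarrow> B * act N g = act M g * B"
proof -
  obtain A where A: "A \<in> carrier_mat (gdim N) (gdim M)"
    and im: "(\<lambda>w. A *\<^sub>v w) ` carrier_vec (gdim M) = carrier_vec (gdim N)"
    and ker: "{w \<in> carrier_vec (gdim M). A *\<^sub>v w = 0\<^sub>v (gdim N)} = {0\<^sub>v (gdim M)}"
    and eq: "\<forall>g\<in>carrier SL2. \<forall>w\<in>carrier_vec (gdim M). A *\<^sub>v (act M g *\<^sub>v w) = act N g *\<^sub>v (A *\<^sub>v w)"
    using iso unfolding quotient_iso_def by blast
  have "\<exists>x. x \<in> carrier_vec (gdim M) \<and> A *\<^sub>v x = unit_vec (gdim N) j" for j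
  proof -
    have "unit_vec (gdim N) j \<in> (\<lambda>w. A *\<^sub>v w) ` carrier_vec (gdim M)" unfolding im by simp
    then show ?thesis by (metis imageE)
  qed
  then obtain x where x: "\<And>j. x j \<in> carrier_vec (gdim M)" "\<And>j. A *\<^sub>v x j = unit_vec (gdim N) j" by metis
  define B where "B = mat (gdim M) (gdim N) (\<lambda>(i, j). x j $ i)"
  have B: "B \<in> carrier_mat (gdim M) (gdim N)" by (simp add: B_def)
  have AB: "A * B = 1\<^sub>m (gdim N)"
  proof (rule eq_matI)
    fix i j assume "i < dim_row (1\<^sub>m (gdim N))" "j < dim_col (1\<^sub>m (gdim N))"
    then have ij: "i < gdim N" "j < gdim N" by auto
    have "col B j = x j" using ij x(1)[of j] by (intro eq_vecI) (auto simp: B_def)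
    then have "(A * B) $$ (i, j) = (A *\<^sub>v x j) $ i" using ij A B by simp
    then show "(A * B) $$ (i, j) = 1\<^sub>m (gdim N) $$ (i, j)"
      using x(2)[of j] ij by (simp add: unit_vec_def del: index_mult_mat_vec)
  qed (use A B in auto)
  have "sdim (gdim M) {0\<^sub>v (gdim M) :: 'k vec} = 0" using sdim_eq_0_iff[OF lin_subspace_zero] by blast
  then have "gdim M = gdim N"
    using sdim_rank_nullity[OF lin_subspace_carrier A] unfolding im ker by (simp add: sdim_carrier)
  then have BA: "B * A = 1\<^sub>m (gdim M)" using mat_mult_left_right_inverse[OF _ _ AB] A B by simp
  have eqA: "A * act M g = act N g * A" if g: "g \<in> carrier SL2" for g
  proof (rule mat_eqI_mult_vec[of _ "gdim N" "gdim M"])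
    note Mg = rational_moduleD(1)[OF M g] and Ng = rational_moduleD(1)[OF N g]
    show "A * act M g \<in> carrier_mat (gdim N) (gdim M)" "act N g * A \<in> carrier_mat (gdim N) (gdim M)"
      using A Mg Ng by auto
    fix v :: "'k vec" assume v: "v \<in> carrier_vec (gdim M)"
    show "A * act M g *\<^sub>v v = act N g * A *\<^sub>v v"
      using assoc_mult_mat_vec[OF A Mg v] assoc_mult_mat_vec[OF Ng A v] eq g v by simp
  qed
  have eqB: "B * act N g = act M g * B" if g: "g \<in> carrier SL2" for g
  proof -
    note Mg = rational_moduleD(1)[OF M g] and Ng = rational_moduleD(1)[OF N g]
    have "B * act N g = B * (act N g * (A * B))" using AB Ng by simp
    also have "\<dots> = B * (A * act M g) * B"
      using eqA[OF g] A B Mg Ng by (simp add: assoc_mult_mat[of _ "gdim M" "gdim N" _ "gdim M" _ "gdim N"]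
          assoc_mult_mat[OF Ng A B])
    also have "\<dots> = act M g * B"
      using BA Mg by (simp add: assoc_mult_mat[OF B A Mg, symmetric])
    finally show ?thesis .
  qed
  show thesis by (rule that[OF A B AB BA eqA eqB])
qed

lemma module_iso_sym:
  fixes M N :: "'k::field gmodule"
  assumes "module_iso M N" "rational_module M" "rational_module N"
  shows "module_iso N M"
  using module_isoE[OF assms] module_isoI[OF assms(3,2)] by metis

lemma quotient_iso_trans:
  fixes M S T :: "'k::field gmodule"
  assumes Q: "quotient_iso M W U S" and iso: "module_iso S T" and sub: "gsubmodule M W"
  shows "quotient_iso M W U T"
proof -
  have W: "W \<subseteq> carrier_vec (gdim M)" using gsubmoduleD(3)[OF sub] by blast
  obtain A where A: "A \<in> carrier_mat (gdim S) (gdim M)"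
    "(\<lambda>w. A *\<^sub>v w) ` W = carrier_vec (gdim S)" "{w \<in> W. A *\<^sub>v w = 0\<^sub>v (gdim S)} = U"
    "\<forall>g\<in>carrier SL2. \<forall>w\<in>W. A *\<^sub>v (act M g *\<^sub>v w) = act S g *\<^sub>v (A *\<^sub>v w)"
    using Q unfolding quotient_iso_def by blast
  obtain B where B: "B \<in> carrier_mat (gdim T) (gdim S)"
    "(\<lambda>w. B *\<^sub>v w) ` carrier_vec (gdim S) = carrier_vec (gdim T)"
    "{w \<in> carrier_vec (gdim S). B *\<^sub>v w = 0\<^sub>v (gdim T)} = {0\<^sub>v (gdim S)}"
    "\<forall>g\<in>carrier SL2. \<forall>w\<in>carrier_vec (gdim S). B *\<^sub>v (act S g *\<^sub>v w) = act T g *\<^sub>v (B *\<^sub>v w)"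
    using iso unfolding quotient_iso_def by blast
  have BA: "(B * A) *\<^sub>v w = B *\<^sub>v (A *\<^sub>v w)" if "w \<in> carrier_vec (gdim M)" for w
    by (rule assoc_mult_mat_vec[OF B(1) A(1) that])
  have AC: "A *\<^sub>v w \<in> carrier_vec (gdim S)" if "w \<in> W" for w using A(2) that by blast
  obtain C where C: "C = B * A" by simp
  show ?thesis
    unfolding quotient_iso_def
  proof (intro bexI[of _ C] conjI ballI)
    show "C \<in> carrier_mat (gdim T) (gdim M)" using A(1) B(1) C by auto
    have "(\<lambda>w. C *\<^sub>v w) ` W = (\<lambda>w. B *\<^sub>v w) ` (\<lambda>w. A *\<^sub>v w) ` W"
      using W BA C by (auto simp: image_image subset_iff intro!: image_cong)
    then show "(\<lambda>w. C *\<^sub>v w) ` W = carrier_vec (gdim T)" using A(2) B(2) by simp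
    have "B *\<^sub>v (A *\<^sub>v w) = 0\<^sub>v (gdim T) \<longleftrightarrow> A *\<^sub>v w = 0\<^sub>v (gdim S)" if "w \<in> W" for w
      using B(3) AC[OF that] by blast
    then show "{w \<in> W. C *\<^sub>v w = 0\<^sub>v (gdim T)} = U"
      using W BA C A(3) mult_mat_zero_vec[OF B(1)] by (auto simp: subset_iff)
    fix g :: "'k mat" and w :: "'k vec" assume g: "g \<in> carrier SL2" and w: "w \<in> W"
    have "C *\<^sub>v (act M g *\<^sub>v w) = B *\<^sub>v (A *\<^sub>v (act M g *\<^sub>v w))"
      unfolding C by (rule BA) (use gsubmoduleD(2)[OF sub g w] W in auto)
    then show "C *\<^sub>v (act M g *\<^sub>v w) = act T g *\<^sub>v (C *\<^sub>v w)"
      using A(4) B(4) g w AC[OF w] BA[of w] W C by auto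
  qed
qed

section \<open>The modules L\<close>

lemma simple_module_rational: "simple_module M \<Longrightarrow> rational_module M"
  by (simp add: simple_module_def)

lemma simple_module_iso_model:
  fixes S :: "'k::alg_closed_field gmodule"
  assumes S: "simple_module S"
  obtains \<nu> where "module_iso S (simple_model \<nu>)"
proof -
  note M = simple_module_rational[OF S]
  have "{0\<^sub>v (gdim S)} \<noteq> (carrier_vec (gdim S) :: 'k vec set)"
  proof
    assume eq: "{0\<^sub>v (gdim S)} = (carrier_vec (gdim S) :: 'k vec set)"
    have "sdim (gdim S) ({0\<^sub>v (gdim S)} :: 'k vec set) = 0"
      using sdim_eq_0_iff[OF lin_subspace_zero] by blast
    then show False using S unfolding eq sdim_carrier by (simp add: simple_module_def)
  qed
  then have "{0\<^sub>v (gdim S)} \<subset> (carrier_vec (gdim S) :: 'k vec set)" by auto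
  then show thesis
    using simple_subquotient_is_model[OF M gsubmodule_zero[OF M] gsubmodule_carrier[OF M]] S that
    unfolding simple_module_def by blast
qed

lemma wdim_module_iso:
  fixes M :: "'k::alg_closed_field gmodule"
  assumes "module_iso M N" "rational_module M"
  shows "wdim M (carrier_vec (gdim M)) m = wdim N (carrier_vec (gdim N)) m"
  using wdim_quotient[OF assms(2) gsubmodule_carrier[OF assms(2)] assms(1), of m] wdim_zero[OF assms(2)] by simp

lemma highest_weight_unique:
  assumes "highest_weight M \<nu>" "highest_weight N \<nu>'" "\<And>m. is_weight M m \<longleftrightarrow> is_weight N m"
  shows "\<nu> = \<nu>'"
proof -
  have "dominance_le (int \<nu>) (int \<nu>')" "dominance_le (int \<nu>') (int \<nu>)"
    using assms by (auto simp: highest_weight_def)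
  then show ?thesis by (auto simp: dominance_le_def)
qed

lemma L_simple: "simple_module (L \<nu> :: 'k::alg_closed_field gmodule)"
  and L_highest_weight: "highest_weight (L \<nu> :: 'k::alg_closed_field gmodule) \<nu>"
proof -
  have "\<exists>M :: 'k gmodule. simple_module M \<and> highest_weight M \<nu>"
    using simple_simple_model highest_weight_simple_model by blast
  from someI_ex[OF this]
  show "simple_module (L \<nu> :: 'k gmodule)" "highest_weight (L \<nu> :: 'k gmodule) \<nu>"
    by (auto simp: L_def)
qed

lemma L_rational: "rational_module (L \<nu> :: 'k::alg_closed_field gmodule)"
  by (rule simple_module_rational[OF L_simple])

text \<open>\<open>L \<nu>\<close> is isomorphic to some model, and the highest weight identifies which one.\<close>

theorem L_iso_model: "module_iso (L \<nu> :: 'k::alg_closed_field gmodule) (simple_model \<nu>)"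
proof -
  obtain \<nu>' where iso: "module_iso (L \<nu> :: 'k gmodule) (simple_model \<nu>')"
    using simple_module_iso_model[OF L_simple] .
  have "\<nu> = \<nu>'"
  proof (rule highest_weight_unique)
    show "is_weight (L \<nu> :: 'k gmodule) m \<longleftrightarrow> is_weight (simple_model \<nu>' :: 'k gmodule) m" for m
      unfolding is_weight_iff_wdim[OF L_rational] is_weight_iff_wdim[OF rational_simple_model]
        wdim_module_iso[OF iso L_rational] ..
  qed (rule L_highest_weight highest_weight_simple_model)+
  then show ?thesis using iso by simp
qed

section \<open>Composition series\<close>

lemma maximal_submodule_exists:
  fixes M :: "'k::field gmodule"
  assumes M: "rational_module M" and W: "gsubmodule M W" and W0: "W \<noteq> {0\<^sub>v (gdim M)}"
  obtains U where "gsubmodule M U" "U \<subset> W"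
    "\<And>X. gsubmodule M X \<Longrightarrow> U \<subseteq> X \<Longrightarrow> X \<subseteq> W \<Longrightarrow> X = U \<or> X = W"
proof -
  let ?P = "\<lambda>U. gsubmodule M U \<and> U \<subset> W"
  have "?P {0\<^sub>v (gdim M)}"
    using gsubmodule_zero[OF M] lin_subspaceD(2)[OF gsubmoduleD(1)[OF W]] W0 by auto
  moreover have "\<forall>U. ?P U \<longrightarrow> sdim (gdim M) U < sdim (gdim M) W"
    using sdim_strict_mono[OF gsubmoduleD(1) gsubmoduleD(1)[OF W]] by blast
  ultimately have "\<exists>U. ?P U \<and> (\<forall>X. ?P X \<longrightarrow> sdim (gdim M) X \<le> sdim (gdim M) U)"
    by (rule ex_has_greatest_nat)
  then obtain U where U: "?P U" "\<And>X. ?P X \<Longrightarrow> sdim (gdim M) X \<le> sdim (gdim M) U" by auto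
  have "X = U \<or> X = W" if X: "gsubmodule M X" "U \<subseteq> X" "X \<subseteq> W" for X
  proof (rule ccontr)
    assume "\<not> ?thesis"
    then have "U \<subset> X" "X \<subset> W" using X by auto
    then show False
      using U(2)[of X] X(1) sdim_strict_mono[OF gsubmoduleD(1)[of M U] gsubmoduleD(1)[OF X(1)]] U(1) by force
  qed
  then show thesis using that U(1) by blast
qed

text \<open>Induction on the dimension. The factors are identified with explicit models, so no quotient module has to
be constructed.\<close>

lemma submodule_has_composition_series:
  fixes M :: "'k::alg_closed_field gmodule"
  assumes M: "rational_module M"
  shows "gsubmodule M W \<Longrightarrow> \<exists>Ws. Ws \<noteq> [] \<and> hd Ws = {0\<^sub>v (gdim M)} \<and> last Ws = W \<and>
     (\<forall>W\<in>set Ws. gsubmodule M W) \<and>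
     (\<forall>i. Suc i < length Ws \<longrightarrow> (\<exists>S. simple_module S \<and> quotient_iso M (Ws ! Suc i) (Ws ! i) S))"
proof (induction "sdim (gdim M) W" arbitrary: W rule: less_induct)
  case less
  show ?case
  proof (cases "W = {0\<^sub>v (gdim M)}")
    case True
    then show ?thesis using gsubmodule_zero[OF M] by (intro exI[of _ "[W]"]) auto
  next
    case False
    obtain U where U: "gsubmodule M U" "U \<subset> W"
        "\<And>X. gsubmodule M X \<Longrightarrow> U \<subseteq> X \<Longrightarrow> X \<subseteq> W \<Longrightarrow> X = U \<or> X = W"
      using maximal_submodule_exists[OF M less.prems False] by blast
    obtain \<nu> where \<nu>: "quotient_iso M W U (simple_model \<nu>)"
      using simple_subquotient_is_model[OF M U(1) less.prems U(2,3)] by blast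
    have "sdim (gdim M) U < sdim (gdim M) W"
      by (rule sdim_strict_mono[OF gsubmoduleD(1)[OF U(1)] gsubmoduleD(1)[OF less.prems] U(2)])
    from less.hyps[OF this U(1)] obtain Ws where Ws: "Ws \<noteq> []" "hd Ws = {0\<^sub>v (gdim M)}" "last Ws = U"
      "\<forall>W\<in>set Ws. gsubmodule M W"
      "\<forall>i. Suc i < length Ws \<longrightarrow> (\<exists>S. simple_module S \<and> quotient_iso M (Ws ! Suc i) (Ws ! i) S)"
      by blast
    show ?thesis
    proof (intro exI[of _ "Ws @ [W]"] conjI allI impI)
      fix i assume i: "Suc i < length (Ws @ [W])"
      show "\<exists>S. simple_module S \<and> quotient_iso M ((Ws @ [W]) ! Suc i) ((Ws @ [W]) ! i) S"
      proof (cases "Suc i < length Ws")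
        case True
        then show ?thesis using Ws(5) by (simp add: nth_append)
      next
        case False
        then have "Suc i = length Ws" using i by simp
        moreover from this have "i = length Ws - 1" by simp
        ultimately have "(Ws @ [W]) ! Suc i = W" "(Ws @ [W]) ! i = U"
          using Ws(1,3) by (simp_all add: nth_append last_conv_nth)
        then show ?thesis using \<nu> simple_simple_model by auto
      qed
    qed (use Ws less.prems in auto)
  qed
qed

lemma composition_series_exists:
  fixes M :: "'k::alg_closed_field gmodule"
  assumes "rational_module M"
  obtains Ws where "composition_series M Ws"
  using submodule_has_composition_series[OF assms gsubmodule_carrier[OF assms]]
  unfolding composition_series_def by blast

text \<open>The weight multiplicities of the simple module of highest weight \<open>\<nu>\<close>; they are all zero or one.\<close>

definition simple_wdim :: "nat \<Rightarrow> nat \<Rightarrow> int \<Rightarrow> nat" where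
  "simple_wdim p \<nu> m = card {i \<in> set (expts p \<nu>). int \<nu> - 2 * int i = m}"

lemma quotient_iso_model_unique:
  fixes M :: "'k::alg_closed_field gmodule"
  assumes M: "rational_module M" and W: "gsubmodule M W"
    and Q: "quotient_iso M W U (simple_model \<nu>)" "quotient_iso M W U (simple_model \<nu>')"
  shows "\<nu> = \<nu>'"
proof (rule highest_weight_unique)
  show "is_weight (simple_model \<nu> :: 'k gmodule) m \<longleftrightarrow> is_weight (simple_model \<nu>' :: 'k gmodule) m" for m
    unfolding is_weight_iff_wdim[OF rational_simple_model]
    using wdim_quotient[OF M W Q(1), of m] wdim_quotient[OF M W Q(2), of m] by simp
qed (rule highest_weight_simple_model)+

text \<open>The multiset \<open>A\<close> collects the highest weights of the factors of the series.\<close>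

lemma composition_series_highest_weights:
  fixes M :: "'k::alg_closed_field gmodule"
  assumes M: "rational_module M" and Ws: "composition_series M Ws"
  obtains A where "\<And>m. wdim M (carrier_vec (gdim M)) m = (\<Sum>\<nu>\<in>#A. simple_wdim CHAR('k) \<nu> m)"
    and "\<And>\<nu>. card {i. Suc i < length Ws \<and> quotient_iso M (Ws ! Suc i) (Ws ! i) (L \<nu>)} = count A \<nu>"
proof -
  have sub: "gsubmodule M (Ws ! i)" if "i < length Ws" for i
    using Ws that by (simp add: composition_series_def)
  have "\<exists>\<nu>. quotient_iso M (Ws ! Suc i) (Ws ! i) (simple_model \<nu>)" if i: "Suc i < length Ws" for i
  proof -
    obtain S :: "'k gmodule" where S: "simple_module S" "quotient_iso M (Ws ! Suc i) (Ws ! i) S"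
      using Ws i unfolding composition_series_def by blast
    obtain \<nu> where "module_iso S (simple_model \<nu>)" using simple_module_iso_model[OF S(1)] .
    from quotient_iso_trans[OF S(2) this sub[OF i]] show ?thesis ..
  qed
  then obtain n where n: "\<And>i. Suc i < length Ws \<Longrightarrow> quotient_iso M (Ws ! Suc i) (Ws ! i) (simple_model (n i))"
    by metis
  define r where "r = length Ws - 1"
  have len: "length Ws = Suc r" using Ws by (cases Ws) (auto simp: r_def composition_series_def)
  define A where "A = image_mset n (mset_set {..<r})"
  have "wdim M (Ws ! i) m = (\<Sum>j<i. simple_wdim CHAR('k) (n j) m)" if "i \<le> r" for i m
    using that
  proof (induction i)
    case 0
    then show ?case
      using Ws wdim_zero[OF M, of m] by (auto simp: composition_series_def hd_conv_nth)
  next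
    case (Suc i)
    then show ?case
      using wdim_quotient[OF M sub n[of i], of m] len by (simp add: wdim_simple_model simple_wdim_def)
  qed
  from this[of r] have 1: "wdim M (carrier_vec (gdim M)) m = (\<Sum>\<nu>\<in>#A. simple_wdim CHAR('k) \<nu> m)" for m
    using Ws len
    by (auto simp: composition_series_def last_conv_nth A_def sum_unfold_sum_mset image_mset.compositionality comp_def)
  have 2: "card {i. Suc i < length Ws \<and> quotient_iso M (Ws ! Suc i) (Ws ! i) (L \<nu>)} = count A \<nu>" for \<nu>
  proof -
    have "quotient_iso M (Ws ! Suc i) (Ws ! i) (L \<nu>) \<longleftrightarrow> n i = \<nu>" if i: "Suc i < length Ws" for i
    proof
      assume "quotient_iso M (Ws ! Suc i) (Ws ! i) (L \<nu>)"
      from quotient_iso_trans[OF this L_iso_model sub[OF i]]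
      show "n i = \<nu>" by (rule quotient_iso_model_unique[OF M sub[OF i] n[OF i]])
    next
      assume "n i = \<nu>"
      with quotient_iso_trans[OF n[OF i] module_iso_sym[OF L_iso_model L_rational rational_simple_model] sub[OF i]]
      show "quotient_iso M (Ws ! Suc i) (Ws ! i) (L \<nu>)" by simp
    qed
    then have "{i. Suc i < length Ws \<and> quotient_iso M (Ws ! Suc i) (Ws ! i) (L \<nu>)} = {i \<in> {..<r}. \<nu> = n i}"
      using len by auto
    also have "card \<dots> = count A \<nu>"
      by (simp add: A_def count_image_mset' sum.If_cases Int_def)
    finally show ?thesis .
  qed
  show thesis using that 1 2 .
qed

text \<open>The character of \<open>M\<close> alone determines \<open>A\<close>, by \<open>total_char_inject\<close> below; this is the form in which the
Jordan-Hoelder theorem enters.\<close>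

theorem composition_multiplicity_L:
  fixes M :: "'k::alg_closed_field gmodule"
  assumes M: "rational_module M"
  obtains A where "\<And>m. wdim M (carrier_vec (gdim M)) m = (\<Sum>\<nu>\<in>#A. simple_wdim CHAR('k) \<nu> m)"
    and "composition_multiplicity M (L \<nu>) = count A \<nu>"
proof -
  obtain Ws0 where "composition_series M Ws0" using composition_series_exists[OF M] .
  then have "\<exists>c Ws. composition_series M Ws \<and>
        c = card {i. Suc i < length Ws \<and> quotient_iso M (Ws ! Suc i) (Ws ! i) (L \<nu>)}"
    by blast
  from someI_ex[OF this] obtain Ws where Ws: "composition_series M Ws"
    "composition_multiplicity M (L \<nu>) =
       card {i. Suc i < length Ws \<and> quotient_iso M (Ws ! Suc i) (Ws ! i) (L \<nu>)}"
    unfolding composition_multiplicity_def by blast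
  obtain A where A: "\<And>m. wdim M (carrier_vec (gdim M)) m = (\<Sum>\<nu>\<in>#A. simple_wdim CHAR('k) \<nu> m)"
    "\<And>\<nu>. card {i. Suc i < length Ws \<and> quotient_iso M (Ws ! Suc i) (Ws ! i) (L \<nu>)} = count A \<nu>"
    using composition_series_highest_weights[OF M Ws(1)] by blast
  show thesis by (rule that[OF A(1)]) (simp only: Ws(2) A(2))
qed

section \<open>Tensor products\<close>

text \<open>The coordinates of a tensor product are indexed by \<open>r = i * b + j\<close>.\<close>

lemma sum_div_mod:
  fixes f :: "nat \<Rightarrow> nat \<Rightarrow> 'a::comm_monoid_add"
  shows "(\<Sum>r<a * b. f (r div b) (r mod b)) = (\<Sum>i<a. \<Sum>j<b. f i j)"
proof -
  have "(\<Sum>i<a. \<Sum>j<b. f i j) = (\<Sum>(i, j)\<in>{..<a} \<times> {..<b}. f i j)"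
    by (simp add: sum.cartesian_product)
  also have "\<dots> = (\<Sum>r<a * b. f (r div b) (r mod b))"
  proof (rule sum.reindex_bij_witness[of _ "\<lambda>r. (r div b, r mod b)" "\<lambda>(i, j). i * b + j"])
    fix r assume "r \<in> {..<a * b}"
    then show "(r div b, r mod b) \<in> {..<a} \<times> {..<b}"
      by (cases "b = 0") (auto simp: less_mult_imp_div_less)
  next
    fix x assume "x \<in> {..<a} \<times> {..<b}"
    then obtain i j where x: "x = (i, j)" "i < a" "j < b" by auto
    have "i * b + j < Suc i * b" using x by simp
    also have "\<dots> \<le> a * b" using x by (intro mult_right_mono) auto
    finally show "(case x of (i, j) \<Rightarrow> i * b + j) \<in> {..<a * b}" using x by simp
  qed auto
  finally show ?thesis ..
qed

lemma kronecker_carrier: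
  assumes "A \<in> carrier_mat a a'" "B \<in> carrier_mat b b'"
  shows "kronecker A B \<in> carrier_mat (a * b) (a' * b')"
  using assms by (auto simp: kronecker_def)

lemma kronecker_index:
  assumes "A \<in> carrier_mat a a'" "B \<in> carrier_mat b b'" "r < a * b" "c < a' * b'"
  shows "kronecker A B $$ (r, c) = A $$ (r div b, c div b') * B $$ (r mod b, c mod b')"
  using assms by (auto simp: kronecker_def)

lemma less_mult_div_mod: "r < a * b \<Longrightarrow> r div b < a \<and> r mod b < (b::nat)"
  by (cases "b = 0") (auto simp: less_mult_imp_div_less)

lemma kronecker_mult:
  fixes A :: "'k::field mat"
  assumes A: "A \<in> carrier_mat a a'" "A' \<in> carrier_mat a' a''" and B: "B \<in> carrier_mat b b'" "B' \<in> carrier_mat b' b''"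
  shows "kronecker A B * kronecker A' B' = kronecker (A * A') (B * B')"
proof (rule eq_matI)
  note AB = kronecker_carrier[OF A(1) B(1)] and AB' = kronecker_carrier[OF A(2) B(2)]
  have AA: "A * A' \<in> carrier_mat a a''" and BB: "B * B' \<in> carrier_mat b b''" using A B by auto
  fix r c assume "r < dim_row (kronecker (A * A') (B * B'))" "c < dim_col (kronecker (A * A') (B * B'))"
  then have rc: "r < a * b" "c < a'' * b''" using A B by (auto simp: kronecker_def)
  note r = less_mult_div_mod[OF rc(1)] and c = less_mult_div_mod[OF rc(2)]
  have "(kronecker A B * kronecker A' B') $$ (r, c) = (\<Sum>s<a' * b'. kronecker A B $$ (r, s) * kronecker A' B' $$ (s, c))"
    using rc AB AB' by (simp add: scalar_prod_def atLeast0LessThan)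
  also have "\<dots> = (\<Sum>s<a' * b'. (A $$ (r div b, s div b') * B $$ (r mod b, s mod b')) *
      (A' $$ (s div b', c div b'') * B' $$ (s mod b', c mod b'')))"
    using rc by (intro sum.cong refl) (simp add: kronecker_index[OF A(1) B(1)] kronecker_index[OF A(2) B(2)])
  also have "\<dots> = (\<Sum>i<a'. \<Sum>j<b'. (A $$ (r div b, i) * B $$ (r mod b, j)) * (A' $$ (i, c div b'') * B' $$ (j, c mod b'')))"
    by (rule sum_div_mod)
  also have "\<dots> = (\<Sum>i<a'. A $$ (r div b, i) * A' $$ (i, c div b'')) * (\<Sum>j<b'. B $$ (r mod b, j) * B' $$ (j, c mod b''))"
    by (simp add: sum_product mult_ac)
  also have "\<dots> = (A * A') $$ (r div b, c div b'') * (B * B') $$ (r mod b, c mod b'')"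
    using A B r c by (simp add: scalar_prod_def atLeast0LessThan)
  also have "\<dots> = kronecker (A * A') (B * B') $$ (r, c)"
    by (rule kronecker_index[OF AA BB rc, symmetric])
  finally show "(kronecker A B * kronecker A' B') $$ (r, c) = kronecker (A * A') (B * B') $$ (r, c)" .
qed (use A B in \<open>auto simp: kronecker_def\<close>)

lemma div_mod_eq_iff: "(r::nat) = c \<longleftrightarrow> r div b = c div b \<and> r mod b = c mod b"
  by (metis div_mult_mod_eq)

lemma kronecker_one: "kronecker (1\<^sub>m a) (1\<^sub>m b) = (1\<^sub>m (a * b) :: 'k::field mat)"
proof (rule eq_matI)
  fix r c assume "r < dim_row (1\<^sub>m (a * b) :: 'k mat)" "c < dim_col (1\<^sub>m (a * b) :: 'k mat)"
  then have rc: "r < a * b" "c < a * b" by auto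
  show "kronecker (1\<^sub>m a) (1\<^sub>m b) $$ (r, c) = (1\<^sub>m (a * b) :: 'k mat) $$ (r, c)"
    using less_mult_div_mod[OF rc(1)] less_mult_div_mod[OF rc(2)] rc div_mod_eq_iff[of r c b]
    by (auto simp: kronecker_index[OF one_carrier_mat one_carrier_mat rc])
qed (auto simp: kronecker_def)

lemma tensor_simps:
  "gdim (tensor M N) = gdim M * gdim N" "act (tensor M N) g = kronecker (act M g) (act N g)"
  by (auto simp: tensor_def)

lemma rational_tensor:
  fixes M N :: "'k::field gmodule"
  assumes M: "rational_module M" and N: "rational_module N"
  shows "rational_module (tensor M N)"
proof (rule rational_moduleI)
  note CM = rational_moduleD(1)[OF M] and CN = rational_moduleD(1)[OF N]
  show "act (tensor M N) g \<in> carrier_mat (gdim (tensor M N)) (gdim (tensor M N))" if "g \<in> carrier SL2" for g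
    unfolding tensor_simps by (rule kronecker_carrier[OF CM[OF that] CN[OF that]])
  show "act (tensor M N) (g * h) = act (tensor M N) g * act (tensor M N) h"
    if "g \<in> carrier SL2" "h \<in> carrier SL2" for g h
    unfolding tensor_simps kronecker_mult[OF CM[OF that(1)] CM[OF that(2)] CN[OF that(1)] CN[OF that(2)]]
    using that by (simp add: rational_moduleD(2)[OF M] rational_moduleD(2)[OF N])
  show "act (tensor M N) (1\<^sub>m 2) = 1\<^sub>m (gdim (tensor M N))"
    unfolding tensor_simps rational_moduleD(3)[OF M] rational_moduleD(3)[OF N] by (rule kronecker_one)
  fix i j assume "i < gdim (tensor M N)" "j < gdim (tensor M N)"
  then have ij: "i < gdim M * gdim N" "j < gdim M * gdim N" by (simp_all add: tensor_simps)
  note i = less_mult_div_mod[OF ij(1)] and j = less_mult_div_mod[OF ij(2)]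
  obtain f where f: "f \<in> regular_functions"
    "\<And>g. g \<in> carrier SL2 \<Longrightarrow> act M g $$ (i div gdim N, j div gdim N) = f g"
    using M i j unfolding rational_module_def by metis
  obtain h where h: "h \<in> regular_functions"
    "\<And>g. g \<in> carrier SL2 \<Longrightarrow> act N g $$ (i mod gdim N, j mod gdim N) = h g"
    using N i j unfolding rational_module_def by metis
  show "\<exists>f\<in>regular_functions. \<forall>g\<in>carrier SL2. act (tensor M N) g $$ (i, j) = f g"
    using f h kronecker_index[OF CM CN ij]
    by (intro bexI[OF _ regular_functions.mult[OF f(1) h(1)]]) (simp add: tensor_simps)
qed

lemma tensor_iso:
  fixes M N M' N' :: "'k::field gmodule"
  assumes rat: "rational_module M" "rational_module N" "rational_module M'" "rational_module N'"
    and iso: "module_iso M M'" "module_iso N N'"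
  shows "module_iso (tensor M N) (tensor M' N')"
proof -
  obtain A B where A: "A \<in> carrier_mat (gdim M') (gdim M)" "B \<in> carrier_mat (gdim M) (gdim M')"
    "A * B = 1\<^sub>m (gdim M')" "B * A = 1\<^sub>m (gdim M)" "\<And>g. g \<in> carrier SL2 \<Longrightarrow> A * act M g = act M' g * A"
    using module_isoE[OF iso(1) rat(1,3)] by metis
  obtain C D where C: "C \<in> carrier_mat (gdim N') (gdim N)" "D \<in> carrier_mat (gdim N) (gdim N')"
    "C * D = 1\<^sub>m (gdim N')" "D * C = 1\<^sub>m (gdim N)" "\<And>g. g \<in> carrier SL2 \<Longrightarrow> C * act N g = act N' g * C"
    using module_isoE[OF iso(2) rat(2,4)] by metis
  show ?thesis
  proof (rule module_isoI[OF rational_tensor[OF rat(1,2)] rational_tensor[OF rat(3,4)]], unfold tensor_simps)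
    show "kronecker A C \<in> carrier_mat (gdim M' * gdim N') (gdim M * gdim N)"
      by (rule kronecker_carrier[OF A(1) C(1)])
    show "kronecker B D \<in> carrier_mat (gdim M * gdim N) (gdim M' * gdim N')"
      by (rule kronecker_carrier[OF A(2) C(2)])
    show "kronecker A C * kronecker B D = 1\<^sub>m (gdim M' * gdim N')"
      by (simp add: kronecker_mult[OF A(1,2) C(1,2)] A(3) C(3) kronecker_one)
    show "kronecker B D * kronecker A C = 1\<^sub>m (gdim M * gdim N)"
      by (simp add: kronecker_mult[OF A(2,1) C(2,1)] A(4) C(4) kronecker_one)
    fix g :: "'k mat" assume g: "g \<in> carrier SL2"
    show "kronecker A C * kronecker (act M g) (act N g) = kronecker (act M' g) (act N' g) * kronecker A C"
      using A(5)[OF g] C(5)[OF g]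
      by (simp add: kronecker_mult[OF A(1) rational_moduleD(1)[OF rat(1) g] C(1) rational_moduleD(1)[OF rat(2) g]]
          kronecker_mult[OF rational_moduleD(1)[OF rat(3) g] A(1) rational_moduleD(1)[OF rat(4) g] C(1)])
  qed
qed

lemma act_torus_simple_model_index:
  assumes t: "t \<noteq> 0" and r: "r < gdim (simple_model \<nu> :: 'k::alg_closed_field gmodule)"
    and c: "c < gdim (simple_model \<nu> :: 'k gmodule)"
  shows "act (simple_model \<nu> :: 'k gmodule) (torus t) $$ (r, c) =
    (if r = c then t powi (int \<nu> - 2 * int (expts CHAR('k) \<nu> ! r)) else 0)"
proof -
  have "(act (simple_model \<nu> :: 'k gmodule) (torus t) *\<^sub>v unit_vec (gdim (simple_model \<nu> :: 'k gmodule)) c) $ r =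
      act (simple_model \<nu> :: 'k gmodule) (torus t) $$ (r, c)"
    using r c act_simple_model_carrier[of \<nu> "torus t"] by (simp add: scalar_prod_right_unit)
  then show ?thesis
    using act_torus_simple_model[OF t unit_vec_carrier r, of c] r c by (simp add: unit_vec_def)
qed

lemma wdim_tensor_simple_models:
  "wdim (tensor (simple_model \<kappa>) (simple_model \<mu>) :: 'k::alg_closed_field gmodule)
     (carrier_vec (gdim (tensor (simple_model \<kappa>) (simple_model \<mu>) :: 'k gmodule))) m =
   card {(i, j). i \<in> set (expts CHAR('k) \<kappa>) \<and> j \<in> set (expts CHAR('k) \<mu>) \<and>
     (int \<kappa> - 2 * int i) + (int \<mu> - 2 * int j) = m}"
proof -
  let ?E = "simple_model \<kappa> :: 'k gmodule" and ?F = "simple_model \<mu> :: 'k gmodule"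
  let ?e = "expts CHAR('k) \<kappa>" and ?f = "expts CHAR('k) \<mu>"
  let ?a = "gdim ?E" and ?b = "gdim ?F"
  define w where "w = (\<lambda>r. (int \<kappa> - 2 * int (?e ! (r div ?b))) + (int \<mu> - 2 * int (?f ! (r mod ?b))))"
  have rat: "rational_module (tensor ?E ?F)" by (intro rational_tensor rational_simple_model)
  have "(act (tensor ?E ?F) (torus t) *\<^sub>v v) $ r = t powi w r * v $ r"
    if t: "t \<noteq> 0" and v: "v \<in> carrier_vec (gdim (tensor ?E ?F))" and r: "r < gdim (tensor ?E ?F)" for t v r
  proof -
    have r': "r < ?a * ?b" using r by (simp add: tensor_simps)
    note C = kronecker_carrier[OF act_simple_model_carrier[of \<kappa> "torus t"] act_simple_model_carrier[of \<mu> "torus t"]]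
    have "(act (tensor ?E ?F) (torus t) *\<^sub>v v) $ r =
        (\<Sum>c<?a * ?b. kronecker (act ?E (torus t)) (act ?F (torus t)) $$ (r, c) * v $ c)"
      using C r' v by (simp add: tensor_simps scalar_prod_def atLeast0LessThan)
    also have "\<dots> = (\<Sum>c<?a * ?b. if c = r then t powi w r * v $ r else 0)"
    proof (intro sum.cong refl)
      fix c assume "c \<in> {..<?a * ?b}"
      then have c: "c < ?a * ?b" by simp
      show "kronecker (act ?E (torus t)) (act ?F (torus t)) $$ (r, c) * v $ c = (if c = r then t powi w r * v $ r else 0)"
        unfolding kronecker_index[OF act_simple_model_carrier act_simple_model_carrier r' c]
        using less_mult_div_mod[OF r'] less_mult_div_mod[OF c] div_mod_eq_iff[of r c ?b] t
        by (auto simp: act_torus_simple_model_index[OF t] w_def power_int_add)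
    qed
    finally show ?thesis using r' by simp
  qed
  from wdim_diagonal[OF this rat]
  have "wdim (tensor ?E ?F) (carrier_vec (gdim (tensor ?E ?F))) m = card {r. r < ?a * ?b \<and> w r = m}"
    by (simp add: tensor_simps)
  also have "\<dots> = (\<Sum>r<?a * ?b. of_bool (w r = m))"
    by (simp add: sum.If_cases Int_def of_bool_def)
  also have "\<dots> = (\<Sum>s<?a. \<Sum>u<?b. of_bool ((int \<kappa> - 2 * int (?e ! s)) + (int \<mu> - 2 * int (?f ! u)) = m))"
    unfolding w_def by (rule sum_div_mod)
  also have "\<dots> = (\<Sum>i\<in>set ?e. \<Sum>j\<in>set ?f. of_bool ((int \<kappa> - 2 * int i) + (int \<mu> - 2 * int j) = m))"
    unfolding gdim_simple_model sum_expts[symmetric] ..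
  also have "\<dots> = (\<Sum>ij\<in>set ?e \<times> set ?f. of_bool ((int \<kappa> - 2 * int (fst ij)) + (int \<mu> - 2 * int (snd ij)) = m))"
    by (simp only: sum.cartesian_product case_prod_unfold)
  also have "\<dots> = card {(i, j). i \<in> set ?e \<and> j \<in> set ?f \<and> (int \<kappa> - 2 * int i) + (int \<mu> - 2 * int j) = m}"
    by (simp add: sum.If_cases of_bool_def) (intro arg_cong[of _ _ card], auto)
  finally show ?thesis .
qed

lemma wdim_tensor_L:
  "wdim (tensor (L \<kappa>) (L \<mu>) :: 'k::alg_closed_field gmodule)
     (carrier_vec (gdim (tensor (L \<kappa>) (L \<mu>) :: 'k gmodule))) m =
   card {(i, j). i \<in> set (expts CHAR('k) \<kappa>) \<and> j \<in> set (expts CHAR('k) \<mu>) \<and>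
     (int \<kappa> - 2 * int i) + (int \<mu> - 2 * int j) = m}"
  unfolding wdim_tensor_simple_models[symmetric]
  by (intro wdim_module_iso tensor_iso rational_tensor L_rational rational_simple_model L_iso_model)

section \<open>Characters as real functions\<close>

text \<open>Characters are treated as functions of a real variable \<open>x\<close>, with \<open>x\<close> to the power \<open>m\<close> standing for the
weight \<open>m\<close>: products of characters are then products of functions, the Frobenius twist is \<open>x \<mapsto> x\<^sup>p\<close>, and
leading terms are limits at infinity. Most identities are stated
for \<open>x > 1\<close>, where \<open>x - inverse x\<close> can be cancelled.\<close>

definition simple_char :: "nat \<Rightarrow> nat \<Rightarrow> real \<Rightarrow> real" where
  "simple_char p \<nu> x = (\<Sum>i\<in>set (expts p \<nu>). x powi (int \<nu> - 2 * int i))"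

definition total_char :: "nat \<Rightarrow> nat multiset \<Rightarrow> real \<Rightarrow> real" where
  "total_char p A x = (\<Sum>\<nu>\<in>#A. simple_char p \<nu> x)"

lemma total_char_simps [simp]:
  "total_char p {#} x = 0"
  "total_char p (add_mset \<nu> A) x = simple_char p \<nu> x + total_char p A x"
  "total_char p (A + B) x = total_char p A x + total_char p B x"
  by (simp_all add: total_char_def)

lemma zero_in_expts: "p \<noteq> 1 \<Longrightarrow> 0 \<in> set (expts p \<nu>)"
  by (simp add: set_expts)

lemma simple_char_pos:
  assumes "p \<noteq> 1" "x > 0"
  shows "simple_char p \<nu> x > 0"
  unfolding simple_char_def using assms zero_in_expts[OF assms(1), of \<nu>] by (intro sum_pos) auto

lemma total_char_tendsto:
  assumes p: "p \<noteq> 1" and A: "\<And>\<nu>'. \<nu>' \<in># A \<Longrightarrow> \<nu>' \<le> \<nu>"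
  shows "((\<lambda>x. total_char p A x * x powi (- int \<nu>)) \<longlongrightarrow> real (count A \<nu>)) at_top"
  using A
proof (induction A)
  case empty
  then show ?case by simp
next
  case (add \<nu>' A)
  have powi: "((\<lambda>x::real. x powi e) \<longlongrightarrow> (if e = 0 then 1 else 0)) at_top" if "e \<le> 0" for e
  proof (cases "e = 0")
    case False
    then have n: "nat (- e) > 0" using that by simp
    have "((\<lambda>x::real. inverse (x ^ nat (- e))) \<longlongrightarrow> 0) at_top"
      by (intro tendsto_inverse_0_at_top filterlim_pow_at_top n filterlim_ident)
    then show ?thesis using False that by (simp add: power_int_def power_inverse)
  qed simp
  have lim: "((\<lambda>x::real. \<Sum>i\<in>set (expts p \<nu>'). x powi (int \<nu>' - 2 * int i - int \<nu>)) \<longlongrightarrow>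
      (\<Sum>i\<in>set (expts p \<nu>'). if int \<nu>' - 2 * int i - int \<nu> = 0 then 1 else 0)) at_top"
    by (intro tendsto_sum powi) (use add.prems in force)
  have "(\<Sum>i\<in>set (expts p \<nu>'). if int \<nu>' - 2 * int i - int \<nu> = 0 then 1 else (0::real)) =
      (\<Sum>i\<in>set (expts p \<nu>'). if i = 0 then (if \<nu>' = \<nu> then 1 else 0) else 0)"
    using add.prems[of \<nu>'] by (intro sum.cong refl) auto
  then have val: "(\<Sum>i\<in>set (expts p \<nu>'). if int \<nu>' - 2 * int i - int \<nu> = 0 then 1 else 0) =
      (if \<nu>' = \<nu> then 1 else (0::real))"
    using zero_in_expts[OF p, of \<nu>'] by simp
  have ev: "\<forall>\<^sub>F x in at_top. (\<Sum>i\<in>set (expts p \<nu>'). x powi (int \<nu>' - 2 * int i - int \<nu>)) =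
      simple_char p \<nu>' x * x powi (- int \<nu>)"
    using eventually_gt_at_top[of 0]
  proof eventually_elim
    case (elim x)
    then show ?case
      unfolding simple_char_def sum_distrib_right
      by (intro sum.cong refl) (simp flip: power_int_add)
  qed
  have "((\<lambda>x. simple_char p \<nu>' x * x powi (- int \<nu>)) \<longlongrightarrow> (if \<nu>' = \<nu> then 1 else 0)) at_top"
    using Lim_transform_eventually[OF lim ev] unfolding val .
  moreover have "((\<lambda>x. total_char p A x * x powi (- int \<nu>)) \<longlongrightarrow> real (count A \<nu>)) at_top"
    by (rule add.IH) (use add.prems in auto)
  ultimately have "((\<lambda>x. simple_char p \<nu>' x * x powi (- int \<nu>) + total_char p A x * x powi (- int \<nu>)) \<longlongrightarrow>
      (if \<nu>' = \<nu> then 1 else 0) + real (count A \<nu>)) at_top"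
    by (rule tendsto_add)
  then show ?case by (simp add: distrib_right split: if_splits)
qed

text \<open>The characters of the simple modules are linearly independent, because their leading terms differ: the
largest highest weight in a multiset, with its multiplicity, is found as a limit.\<close>

lemma total_char_inject:
  assumes p: "p \<noteq> 1" and eq: "\<And>x. x > 1 \<Longrightarrow> total_char p A x = total_char p B x"
  shows "A = B"
  using eq
proof (induction "size A" arbitrary: A B rule: less_induct)
  case less
  have top: "count A \<nu> = count B \<nu>" if "\<And>\<nu>'. \<nu>' \<in># A + B \<Longrightarrow> \<nu>' \<le> \<nu>" for \<nu>
  proof -
    have ev: "\<forall>\<^sub>F x in at_top. total_char p A x * x powi (- int \<nu>) = total_char p B x * x powi (- int \<nu>)"
      using eventually_gt_at_top[of 1] by eventually_elim (simp add: less.prems)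
    have "((\<lambda>x. total_char p A x * x powi (- int \<nu>)) \<longlongrightarrow> real (count A \<nu>)) at_top"
      by (rule total_char_tendsto[OF p]) (use that in auto)
    moreover have "((\<lambda>x. total_char p B x * x powi (- int \<nu>)) \<longlongrightarrow> real (count B \<nu>)) at_top"
      by (rule total_char_tendsto[OF p]) (use that in auto)
    ultimately have "real (count A \<nu>) = real (count B \<nu>)"
      using tendsto_unique[OF trivial_limit_at_top_linorder] unfolding tendsto_cong[OF ev] by blast
    then show ?thesis by simp
  qed
  show ?case
  proof (cases "A + B = {#}")
    case False
    define \<nu> where "\<nu> = Max (set_mset (A + B))"
    have \<nu>: "\<nu> \<in># A + B" unfolding \<nu>_def by (rule Max_in) (use False in auto)
    have "count A \<nu> = count B \<nu>"
      by (rule top) (auto simp: \<nu>_def intro: Max_ge)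
    then have mem: "\<nu> \<in># A" "\<nu> \<in># B" using \<nu> by (auto simp flip: count_greater_zero_iff)
    obtain A' B' where AB: "A = add_mset \<nu> A'" "B = add_mset \<nu> B'"
      using multi_member_split[OF mem(1)] multi_member_split[OF mem(2)] by blast
    have "A' = B'" by (rule less.hyps) (use less.prems AB in auto)
    then show ?thesis using AB by simp
  qed auto
qed

lemma sum_by_value:
  fixes f :: "int \<Rightarrow> real"
  assumes "finite I" "finite K" "w ` I \<subseteq> K"
  shows "(\<Sum>i\<in>I. f (w i)) = (\<Sum>m\<in>K. real (card {i \<in> I. w i = m}) * f m)"
proof -
  have "(\<Sum>i\<in>I. f (w i)) = (\<Sum>m\<in>K. \<Sum>i\<in>{i \<in> I. w i = m}. f (w i))"
    by (rule sum.group [symmetric]) (use assms in auto)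
  also have "\<dots> = (\<Sum>m\<in>K. real (card {i \<in> I. w i = m}) * f m)"
    by (intro sum.cong refl) simp
  finally show ?thesis .
qed

lemma product_char_eq_total_char:
  assumes eq: "\<And>m. card {(i, j). i \<in> set (expts p \<kappa>) \<and> j \<in> set (expts p \<mu>) \<and>
      (int \<kappa> - 2 * int i) + (int \<mu> - 2 * int j) = m} = (\<Sum>\<nu>\<in>#A. simple_wdim p \<nu> m)"
    and x: "x > 0"
  shows "simple_char p \<kappa> x * simple_char p \<mu> x = total_char p A x"
proof -
  let ?I = "set (expts p \<kappa>) \<times> set (expts p \<mu>)"
  define w where "w = (\<lambda>(i, j). (int \<kappa> - 2 * int i) + (int \<mu> - 2 * int j))"
  define K where "K = w ` ?I \<union> (\<Union>\<nu>\<in>set_mset A. (\<lambda>i. int \<nu> - 2 * int i) ` set (expts p \<nu>))"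
  have K: "finite K" by (simp add: K_def)
  have "simple_char p \<kappa> x * simple_char p \<mu> x = (\<Sum>ij\<in>?I. x powi w ij)"
    unfolding simple_char_def sum_product sum.cartesian_product w_def
    using x by (intro sum.cong refl) (auto simp: power_int_add)
  also have "\<dots> = (\<Sum>m\<in>K. real (card {ij \<in> ?I. w ij = m}) * x powi m)"
    by (rule sum_by_value) (use K in \<open>auto simp: K_def\<close>)
  also have "\<dots> = (\<Sum>m\<in>K. real (\<Sum>\<nu>\<in>#A. simple_wdim p \<nu> m) * x powi m)"
  proof (intro sum.cong refl)
    fix m
    have "{ij \<in> ?I. w ij = m} = {(i, j). i \<in> set (expts p \<kappa>) \<and> j \<in> set (expts p \<mu>) \<and>
        (int \<kappa> - 2 * int i) + (int \<mu> - 2 * int j) = m}"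
      by (auto simp: w_def)
    then show "real (card {ij \<in> ?I. w ij = m}) * x powi m = real (\<Sum>\<nu>\<in>#A. simple_wdim p \<nu> m) * x powi m"
      using eq by simp
  qed
  also have "\<dots> = (\<Sum>\<nu>\<in>#A. \<Sum>m\<in>K. real (simple_wdim p \<nu> m) * x powi m)"
    by (induction A) (simp_all add: distrib_right sum.distrib)
  also have "\<dots> = total_char p A x"
    unfolding total_char_def
  proof (intro arg_cong[of _ _ sum_mset] image_mset_cong)
    fix \<nu> assume \<nu>: "\<nu> \<in># A"
    have "simple_char p \<nu> x = (\<Sum>m\<in>K. real (card {i \<in> set (expts p \<nu>). int \<nu> - 2 * int i = m}) * x powi m)"
      unfolding simple_char_def by (rule sum_by_value) (use K \<nu> in \<open>auto simp: K_def\<close>)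
    then show "(\<Sum>m\<in>K. real (simple_wdim p \<nu> m) * x powi m) = simple_char p \<nu> x"
      by (simp add: simple_wdim_def)
  qed
  finally show ?thesis .
qed

section \<open>Lucas' theorem and Steinberg's factorisation of the characters\<close>

text \<open>Compare coefficients in \<open>(1 + X)\<^sup>r\<^sup>+\<^sup>p\<^sup>n = (1 + X)\<^sup>r (1 + X\<^sup>p)\<^sup>n\<close>, which holds in characteristic \<open>p\<close>.\<close>

lemma lucas_digit:
  assumes p: "prime CHAR('k::field)" and rs: "r < CHAR('k)" "s < CHAR('k)"
  shows "of_nat ((r + CHAR('k) * n) choose (s + CHAR('k) * j)) = (of_nat (r choose s) * of_nat (n choose j) :: 'k)"
proof -
  let ?p = "CHAR('k)"
  let ?X = "[:1, 1:] :: 'k poly"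
  have coeffX: "coeff (?X ^ m) i = of_nat (m choose i)" for m i
  proof (cases "i \<le> m")
    case False
    have "degree (?X ^ m) \<le> m" using degree_power_le[of ?X m] by simp
    then show ?thesis using False by (simp add: coeff_eq_0 binomial_eq_0)
  qed (simp add: coeff_linear_poly_power)
  have X: "?X = 1 + monom 1 1" by (simp add: monom_altdef one_pCons)
  have "(1 + monom 1 1 :: 'k poly) ^ ?p = 1 ^ ?p + monom 1 1 ^ ?p"
    by (rule freshmans_dream) (use p in simp_all)
  then have "?X ^ ?p = 1 + monom 1 ?p" unfolding X by (simp add: monom_power)
  then have "?X ^ (?p * n) = (1 + monom 1 ?p) ^ n" by (simp add: power_mult)
  also have "\<dots> = (monom 1 ?p + 1) ^ n" by (simp add: add.commute)
  also have "\<dots> = (\<Sum>i\<le>n. of_nat (n choose i) * monom 1 ?p ^ i * 1 ^ (n - i))" by (rule binomial_ring)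
  also have "\<dots> = (\<Sum>i\<le>n. monom (of_nat (n choose i)) (?p * i))"
    by (intro sum.cong refl) (simp add: monom_power of_nat_poly smult_monom)
  finally have pow: "?X ^ (?p * n) = (\<Sum>i\<le>n. monom (of_nat (n choose i)) (?p * i))" .
  have "of_nat ((r + ?p * n) choose (s + ?p * j)) = coeff (?X ^ (?p * n) * ?X ^ r) (s + ?p * j)"
    by (subst power_add[symmetric]) (simp only: coeffX add.commute)
  also have "\<dots> = (\<Sum>i\<le>n. coeff (monom (of_nat (n choose i)) (?p * i) * ?X ^ r) (s + ?p * j))"
    by (simp only: pow sum_distrib_right coeff_sum)
  also have "\<dots> = (\<Sum>i\<le>n. if i = j then of_nat (n choose j) * of_nat (r choose s) else 0)"
  proof (intro sum.cong refl)
    fix i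
    consider "i = j" | "i < j" | "i > j" by linarith
    then show "coeff (monom (of_nat (n choose i)) (?p * i) * ?X ^ r) (s + ?p * j) =
        (if i = j then of_nat (n choose j) * of_nat (r choose s) else 0)"
    proof cases
      case 2
      then obtain d where "j = Suc (i + d)" using less_iff_Suc_add by auto
      then have "s + ?p * j - ?p * i > r" using rs by (simp add: algebra_simps)
      then show ?thesis using 2 by (simp add: coeff_monom_mult coeffX binomial_eq_0)
    next
      case 3
      then obtain d where "i = Suc (j + d)" using less_iff_Suc_add by auto
      then have "\<not> ?p * i \<le> s + ?p * j" using rs by (simp add: algebra_simps)
      then show ?thesis using 3 by (simp add: coeff_monom_mult)
    qed (simp add: coeff_monom_mult coeffX)
  qed
  also have "\<dots> = of_nat (r choose s) * of_nat (n choose j)"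
    by (simp add: binomial_eq_0 mult.commute)
  finally show ?thesis .
qed

lemma prime_not_dvd_choose:
  assumes "prime p" "r < p" "s \<le> (r::nat)"
  shows "\<not> p dvd (r choose s)"
proof
  assume "p dvd (r choose s)"
  then have "p dvd fact s * fact (r - s) * (r choose s)" by simp
  then have "p dvd fact r" using binomial_fact_lemma[OF assms(3)] by simp
  then show False using assms prime_dvd_fact_iff by auto
qed

lemma expts_below:
  assumes "prime p" "r < p"
  shows "set (expts p r) = {..r}"
  using prime_not_dvd_choose[OF assms] by (auto simp: set_expts)

lemma expts_digit:
  assumes p: "prime CHAR('k::field)" and r: "r < CHAR('k)"
  shows "set (expts CHAR('k) (r + CHAR('k) * n)) =
    (\<lambda>(s, j). s + CHAR('k) * j) ` ({..r} \<times> set (expts CHAR('k) n))"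
proof -
  let ?p = "CHAR('k)"
  have dvd: "?p dvd ((r + ?p * n) choose (s + ?p * j)) \<longleftrightarrow> \<not> s \<le> r \<or> ?p dvd (n choose j)" if "s < ?p" for s j
  proof -
    have "?p dvd ((r + ?p * n) choose (s + ?p * j)) \<longleftrightarrow> (of_nat (r choose s) * of_nat (n choose j) :: 'k) = 0"
      unfolding lucas_digit[OF p r that, of n j, symmetric] by (simp only: of_nat_eq_0_iff_char_dvd)
    also have "\<dots> \<longleftrightarrow> ?p dvd (r choose s) \<or> ?p dvd (n choose j)" by (simp add: of_nat_eq_0_iff_char_dvd)
    also have "?p dvd (r choose s) \<longleftrightarrow> \<not> s \<le> r"
      using prime_not_dvd_choose[OF p r] by (auto simp: binomial_eq_0)
    finally show ?thesis .
  qed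
  have mem: "i \<in> set (expts ?p \<nu>) \<longleftrightarrow> \<not> ?p dvd (\<nu> choose i)" for i \<nu>
    by (cases "i \<le> \<nu>") (auto simp: set_expts binomial_eq_0)
  show ?thesis
  proof (intro equalityI subsetI)
    fix i assume i: "i \<in> set (expts ?p (r + ?p * n))"
    have "i = i mod ?p + ?p * (i div ?p)" by simp
    moreover have "i mod ?p < ?p" using r by simp
    ultimately have "i mod ?p \<le> r" "i div ?p \<in> set (expts ?p n)"
      using i dvd[of "i mod ?p" "i div ?p"] unfolding mem by auto
    then show "i \<in> (\<lambda>(s, j). s + ?p * j) ` ({..r} \<times> set (expts ?p n))"
      by (intro image_eqI[of _ _ "(i mod ?p, i div ?p)"]) auto
  next
    fix i assume "i \<in> (\<lambda>(s, j). s + ?p * j) ` ({..r} \<times> set (expts ?p n))"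
    then obtain s j where "i = s + ?p * j" "s \<le> r" "j \<in> set (expts ?p n)" by auto
    then show "i \<in> set (expts ?p (r + ?p * n))" using dvd[of s j] r unfolding mem by auto
  qed
qed

text \<open>The character of the module of all binary forms of degree \<open>m\<close>.\<close>

definition weyl_char :: "nat \<Rightarrow> real \<Rightarrow> real" where
  "weyl_char m x = (\<Sum>i\<le>m. x powi (int m - 2 * int i))"

lemma weyl_char_telescope:
  assumes "x > (0::real)"
  shows "(x - inverse x) * weyl_char m x = x powi (int m + 1) - x powi (- int m - 1)"
proof -
  have "(x - inverse x) * weyl_char m x =
      (\<Sum>i\<le>m. x powi (int m + 1 - 2 * int i) - x powi (int m + 1 - 2 * int (Suc i)))"
    unfolding weyl_char_def sum_distrib_left
  proof (intro sum.cong refl)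
    fix i
    have "x powi (int m + 1 - 2 * int i) = x * x powi (int m - 2 * int i)"
      using assms power_int_add[of x 1 "int m - 2 * int i"] by (simp add: algebra_simps)
    moreover have "x powi (int m + 1 - 2 * int (Suc i)) = inverse x * x powi (int m - 2 * int i)"
      using assms power_int_add[of x "- 1" "int m - 2 * int i"] by (simp add: power_int_minus algebra_simps)
    ultimately show "(x - inverse x) * x powi (int m - 2 * int i) =
        x powi (int m + 1 - 2 * int i) - x powi (int m + 1 - 2 * int (Suc i))"
      by (simp add: left_diff_distrib)
  qed
  also have "\<dots> = x powi (int m + 1) - x powi (int m + 1 - 2 * int (Suc m))"
    by (subst sum_telescope) simp
  also have "int m + 1 - 2 * int (Suc m) = - int m - 1" by simp
  finally show ?thesis .
qed

text \<open>After multiplication by \<open>x - inverse x\<close> the characters of binary forms telescope, and expanding only the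
factor of degree \<open>b\<close> gives the terms on the right.\<close>

lemma clebsch_gordan:
  assumes "x > 1" "b \<le> a"
  shows "weyl_char a x * weyl_char b x = (\<Sum>c\<le>b. weyl_char (a + b - 2 * c) x)"
proof -
  have "inverse x < 1" using assms(1) by (simp add: field_simps)
  then have x: "x > 0" "x - inverse x \<noteq> 0" using assms(1) by auto
  have "(x - inverse x) * (weyl_char a x * weyl_char b x) =
      (x powi (int a + 1) - x powi (- int a - 1)) * weyl_char b x"
    using weyl_char_telescope[OF x(1), of a] by (simp flip: mult.assoc)
  also have "\<dots> = (\<Sum>c\<le>b. x powi (int a + int b + 1 - 2 * int c)) - (\<Sum>c\<le>b. x powi (- int a - 1 + int b - 2 * int c))"
    unfolding left_diff_distrib weyl_char_def sum_distrib_left sum_subtractf[symmetric]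
    by (intro sum.cong refl arg_cong2[of _ _ _ _ minus])
      (use x(1) in \<open>simp_all add: algebra_simps flip: power_int_add\<close>)
  also have "(\<Sum>c\<le>b. x powi (- int a - 1 + int b - 2 * int c)) = (\<Sum>c\<le>b. x powi (- (int a + int b + 1 - 2 * int c)))"
    by (rule sum.reindex_bij_witness[of _ "\<lambda>c. b - c" "\<lambda>c. b - c"]) (auto simp: of_nat_diff algebra_simps)
  also have "(\<Sum>c\<le>b. x powi (int a + int b + 1 - 2 * int c)) - \<dots> =
      (\<Sum>c\<le>b. (x - inverse x) * weyl_char (a + b - 2 * c) x)"
    unfolding sum_subtractf[symmetric] weyl_char_telescope[OF x(1)]
    by (intro sum.cong refl) (use assms(2) in \<open>auto simp: of_nat_diff algebra_simps\<close>)
  finally show ?thesis using x(2) by (simp flip: sum_distrib_left)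
qed

context
  fixes p :: nat
  assumes char: "CHAR('k::alg_closed_field) = p" and pos: "p > 0"
begin

lemma prime_p: "prime p"
  using prime_CHAR_semidom[where ?'a = 'k] char pos by simp

lemma p_ge_2: "p \<ge> 2" and p_ne_1: "p \<noteq> 1"
  using prime_p prime_ge_2_nat by auto

lemma simple_char_below: "r < p \<Longrightarrow> simple_char p r x = weyl_char r x"
  by (simp add: simple_char_def weyl_char_def expts_below[OF prime_p])

text \<open>The character version of Steinberg's tensor product theorem.\<close>

lemma simple_char_digit:
  assumes r: "r < p" and x: "x > 0"
  shows "simple_char p (r + p * n) x = simple_char p r x * simple_char p n (x ^ p)"
proof -
  have set: "set (expts p (r + p * n)) = (\<lambda>(s, j). s + p * j) ` ({..r} \<times> set (expts p n))"
    using expts_digit[where ?'k = 'k, of r n] prime_p r char by simp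
  have inj: "inj_on (\<lambda>(s, j). s + p * j) ({..r} \<times> set (expts p n))"
  proof (rule inj_onI)
    fix a b assume ab: "a \<in> {..r} \<times> set (expts p n)" "b \<in> {..r} \<times> set (expts p n)"
      "(case a of (s, j) \<Rightarrow> s + p * j) = (case b of (s, j) \<Rightarrow> s + p * j)"
    obtain s j s' j' where "a = (s, j)" "b = (s', j')" by fastforce
    with ab have e: "s < p" "s' < p" "s + p * j = s' + p * j'" using r by auto
    have "(s + p * j) mod p = s" "(s + p * j) div p = j" using e(1) by simp_all
    moreover have "(s' + p * j') mod p = s'" "(s' + p * j') div p = j'" using e(2) by simp_all
    ultimately show "a = b" using e(3) \<open>a = (s, j)\<close> \<open>b = (s', j')\<close> by simp
  qed
  have "simple_char p (r + p * n) x =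
      (\<Sum>(s, j)\<in>{..r} \<times> set (expts p n). x powi (int (r + p * n) - 2 * int (s + p * j)))"
    unfolding simple_char_def set by (subst sum.reindex[OF inj]) (simp add: case_prod_unfold)
  also have "\<dots> = (\<Sum>(s, j)\<in>{..r} \<times> set (expts p n). x powi (int r - 2 * int s) * (x ^ p) powi (int n - 2 * int j))"
  proof (intro sum.cong refl, clarify)
    fix s j
    have "(x ^ p) powi (int n - 2 * int j) = x powi (int p * (int n - 2 * int j))"
      by (simp add: power_int_mult)
    then show "x powi (int (r + p * n) - 2 * int (s + p * j)) = x powi (int r - 2 * int s) * (x ^ p) powi (int n - 2 * int j)"
      using x by (simp add: algebra_simps flip: power_int_add)
  qed
  also have "\<dots> = simple_char p r x * simple_char p n (x ^ p)"
    by (simp add: simple_char_def expts_below[OF prime_p r] sum_product sum.cartesian_product)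
  finally show ?thesis .
qed

lemma power_p_gt_1: "x > 1 \<Longrightarrow> x ^ p > (1::real)"
  using pos by (simp add: one_less_power)

subsection \<open>Sums of simple characters\<close>

text \<open>Closure of this class under sums, products and twists replaces bookkeeping of the composition factors that
the proof does not exhibit.\<close>

definition is_char :: "(real \<Rightarrow> real) \<Rightarrow> bool" where
  "is_char f \<longleftrightarrow> (\<exists>A. \<forall>x>1. f x = total_char p A x)"

lemma is_char_cong: "(\<And>x. x > 1 \<Longrightarrow> f x = h x) \<Longrightarrow> is_char h \<Longrightarrow> is_char f"
  by (auto simp: is_char_def)

lemma is_char_zero: "is_char (\<lambda>_. 0)"
  unfolding is_char_def by (intro exI[of _ "{#}"]) simp

lemma is_char_simple: "is_char (simple_char p \<nu>)"
  unfolding is_char_def by (intro exI[of _ "{#\<nu>#}"]) simp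

lemma is_char_add:
  assumes "is_char f" "is_char h"
  shows "is_char (\<lambda>x. f x + h x)"
proof -
  obtain A B where "\<forall>x>1. f x = total_char p A x" "\<forall>x>1. h x = total_char p B x"
    using assms unfolding is_char_def by blast
  then show ?thesis unfolding is_char_def by (intro exI[of _ "A + B"]) simp
qed

lemma is_char_sum:
  "(\<And>i. i \<in> I \<Longrightarrow> is_char (f i)) \<Longrightarrow> is_char (\<lambda>x. \<Sum>i\<in>I. f i x)"
proof (induction I rule: infinite_finite_induct)
  case (insert i I)
  then show ?case using is_char_add[of "f i" "\<lambda>x. \<Sum>i\<in>I. f i x"] by simp
qed (simp_all add: is_char_zero)

text \<open>A product of simple characters is the character of a tensor product, which has a composition
  series.\<close>

lemma tensor_composition_multiplicity:
  obtains A where "\<And>x. x > 0 \<Longrightarrow> simple_char p \<kappa> x * simple_char p \<mu> x = total_char p A x"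
    and "composition_multiplicity (tensor (L \<kappa>) (L \<mu>) :: 'k gmodule) (L \<nu>) = count A \<nu>"
proof -
  obtain A where A: "\<And>m. wdim (tensor (L \<kappa>) (L \<mu>) :: 'k gmodule)
        (carrier_vec (gdim (tensor (L \<kappa>) (L \<mu>) :: 'k gmodule))) m = (\<Sum>\<nu>\<in>#A. simple_wdim p \<nu> m)"
    "composition_multiplicity (tensor (L \<kappa>) (L \<mu>) :: 'k gmodule) (L \<nu>) = count A \<nu>"
    using composition_multiplicity_L[OF rational_tensor[OF L_rational L_rational]] char by metis
  show thesis
    using that product_char_eq_total_char[OF A(1)[unfolded wdim_tensor_L char]] A(2) by blast
qed

lemma is_char_simple_mult: "is_char (\<lambda>x. simple_char p \<kappa> x * simple_char p \<mu> x)"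
proof -
  obtain A where "\<And>x. x > 0 \<Longrightarrow> simple_char p \<kappa> x * simple_char p \<mu> x = total_char p A x"
    using tensor_composition_multiplicity by metis
  then show ?thesis unfolding is_char_def by (intro exI[of _ A]) simp
qed

lemma is_char_mult:
  assumes "is_char f" "is_char h"
  shows "is_char (\<lambda>x. f x * h x)"
proof -
  obtain A B where AB: "\<forall>x>1. f x = total_char p A x" "\<forall>x>1. h x = total_char p B x"
    using assms unfolding is_char_def by blast
  have 1: "is_char (\<lambda>x. simple_char p \<nu> x * total_char p B x)" for \<nu>
  proof (induction B)
    case (add \<mu> B)
    show ?case
      by (rule is_char_cong[OF _ is_char_add[OF is_char_simple_mult[of \<nu> \<mu>] add]]) (simp add: distrib_left)
  qed (simp add: is_char_zero)
  have "is_char (\<lambda>x. total_char p A x * total_char p B x)"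
  proof (induction A)
    case (add \<nu> A)
    show ?case
      by (rule is_char_cong[OF _ is_char_add[OF 1[of \<nu>] add]]) (simp add: distrib_right)
  qed (simp add: is_char_zero)
  then show ?thesis by (rule is_char_cong[rotated]) (simp add: AB)
qed

lemma is_char_twist:
  assumes r: "r < p" and f: "is_char f"
  shows "is_char (\<lambda>x. simple_char p r x * f (x ^ p))"
proof -
  obtain A where A: "\<forall>x>1. f x = total_char p A x" using f unfolding is_char_def by blast
  have "is_char (\<lambda>x. simple_char p r x * total_char p A (x ^ p))"
  proof (induction A)
    case (add \<nu> A)
    show ?case
      by (rule is_char_cong[OF _ is_char_add[OF is_char_simple[of "r + p * \<nu>"] add]])
        (simp add: distrib_left simple_char_digit[OF r])
  qed (simp add: is_char_zero)
  then show ?thesis by (rule is_char_cong[rotated]) (use A power_p_gt_1 in auto)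
qed

text \<open>The first summand is the simple character of highest weight \<open>m = (m - p) + p * 1\<close>. It is kept as a product,
ready for multiplication by a function of \<open>x\<^sup>p\<close>.\<close>

lemma weyl_char_above:
  assumes x: "x > 1" and m: "p \<le> m" "m \<le> 2 * p - 2"
  shows "weyl_char m x = simple_char p (m - p) x * simple_char p 1 (x ^ p) + simple_char p (2 * p - 2 - m) x"
proof -
  define r where "r = m - p"
  have mr: "m = p + r" "r + 2 \<le> p" using m p_ge_2 by (auto simp: r_def)
  have x0: "x > 0" using x by simp
  have "inverse x < 1" using x by (simp add: field_simps)
  then have nz: "x - inverse x \<noteq> 0" using x by auto
  have one: "simple_char p 1 (x ^ p) = x powi int p + x powi (- int p)"
    using p_ge_2 simple_char_below[of 1 "x ^ p"]
    by (simp add: weyl_char_def power_int_minus numeral_2_eq_2 flip: power_int_of_nat)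
  have "(x - inverse x) * weyl_char m x =
      ((x - inverse x) * weyl_char r x) * simple_char p 1 (x ^ p) + (x - inverse x) * weyl_char (p - 2 - r) x"
  proof -
    have e: "int m + 1 = (int r + 1) + int p" "- int m - 1 = (- int r - 1) + - int p"
      "int (p - 2 - r) + 1 = (- int r - 1) + int p" "- int (p - 2 - r) - 1 = (int r + 1) + - int p"
      using mr by (simp_all add: of_nat_diff)
    have add: "x powi (i + j) = x powi i * x powi j" for i j using x0 by (simp add: power_int_add)
    show ?thesis
      unfolding weyl_char_telescope[OF x0] one e add by (simp only: distrib_left left_diff_distrib)
  qed
  also have "\<dots> = (x - inverse x) * (weyl_char r x * simple_char p 1 (x ^ p) + weyl_char (p - 2 - r) x)"
    by (simp add: algebra_simps)
  finally have "weyl_char m x = weyl_char r x * simple_char p 1 (x ^ p) + weyl_char (p - 2 - r) x"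
    using nz by simp
  moreover have "2 * p - 2 - m = p - 2 - r" using mr by simp
  moreover have "simple_char p r x = weyl_char r x" "simple_char p (p - 2 - r) x = weyl_char (p - 2 - r) x"
    using mr(2) by (simp_all add: simple_char_below)
  ultimately show ?thesis unfolding r_def[symmetric] by simp
qed

text \<open>The characters of binary forms of degree at most \<open>2 p - 2\<close> are the ones that occur in the product of two
digits.\<close>

lemma is_char_weyl_twist:
  assumes m: "m \<le> 2 * p - 2" and f: "is_char f"
  shows "is_char (\<lambda>x. weyl_char m x * f (x ^ p))"
proof (cases "m < p")
  case True
  show ?thesis
    by (rule is_char_cong[OF _ is_char_twist[OF True f]]) (simp add: simple_char_below[OF True])
next
  case False
  then have mp: "m - p < p" "2 * p - 2 - m < p" using m p_ge_2 by auto
  show ?thesis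
    by (rule is_char_cong[OF _ is_char_add[OF is_char_twist[OF mp(1) is_char_mult[OF is_char_simple[of 1] f]] is_char_twist[OF mp(2) f]]])
      (use False m in \<open>simp add: weyl_char_above algebra_simps\<close>)
qed

subsection \<open>Multiplicities\<close>

definition has_double_factor :: "(real \<Rightarrow> real) \<Rightarrow> bool" where
  "has_double_factor f \<longleftrightarrow> (\<exists>\<nu> d. is_char d \<and> (\<forall>x>1. f x = 2 * simple_char p \<nu> x + d x))"

text \<open>A nonzero tensor product has at least one composition factor.\<close>

lemma simple_char_mult_nonzero:
  obtains \<nu> d where "is_char d" "\<And>x. x > 1 \<Longrightarrow> simple_char p \<kappa> x * simple_char p \<mu> x = simple_char p \<nu> x + d x"
proof -
  obtain A where A: "\<forall>x>1. simple_char p \<kappa> x * simple_char p \<mu> x = total_char p A x"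
    using is_char_simple_mult[of \<kappa> \<mu>] unfolding is_char_def by blast
  have "simple_char p \<kappa> 2 * simple_char p \<mu> 2 > 0" by (intro mult_pos_pos simple_char_pos p_ne_1) auto
  then have "A \<noteq> {#}" using A[rule_format, of 2] by auto
  then obtain \<nu> B where B: "A = add_mset \<nu> B" by (meson multiset_cases)
  show thesis
    by (rule that[of "total_char p B" \<nu>]) (use A B in \<open>auto simp: is_char_def\<close>)
qed

text \<open>The weight \<open>q = 2 p - 2 - (r + s)\<close> is the degree of the Clebsch-Gordan summand with index
\<open>c0 = r + s + 1 - p\<close>, and it is also the highest weight of the second factor of the summand of degree
\<open>r + s\<close>. Picking any factor \<open>\<nu>\<close> of the product of the remaining digits, the simple module of highest
weight \<open>q + p * \<nu>\<close> occurs twice.\<close>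

lemma double_factor_carry:
  assumes rs: "r < p" "s < p" "p \<le> r + s"
  shows "has_double_factor (\<lambda>x. simple_char p (r + p * \<kappa>) x * simple_char p (s + p * \<mu>) x)"
proof -
  define a where "a = max r s"
  define b where "b = min r s"
  have ab: "b \<le> a" "a < p" "a + b = r + s" using rs by (auto simp: a_def b_def)
  define q where "q = 2 * p - 2 - (r + s)"
  define c0 where "c0 = r + s + 1 - p"
  have c0: "0 < c0" "c0 \<le> b" "a + b - 2 * c0 = q" and q: "q < p"
    using rs ab by (auto simp: c0_def q_def)
  define h where "h = (\<lambda>x. simple_char p \<kappa> x * simple_char p \<mu> x)"
  have h: "is_char h" unfolding h_def by (rule is_char_simple_mult)
  \<comment> \<open>The summands with index \<open>0\<close> and \<open>c0\<close> are used explicitly, the others only as characters.\<close>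
  define C where "C = {..b} - {0, c0}"
  have CG: "simple_char p r x * simple_char p s x =
      2 * simple_char p q x + (simple_char p (r + s - p) x * simple_char p 1 (x ^ p) + (\<Sum>c\<in>C. weyl_char (a + b - 2 * c) x))"
    if x: "x > 1" for x
  proof -
    have "simple_char p r x * simple_char p s x = weyl_char a x * weyl_char b x"
      using rs simple_char_below by (simp add: a_def b_def max_def min_def)
    also have "\<dots> = (\<Sum>c\<in>insert 0 (insert c0 C). weyl_char (a + b - 2 * c) x)"
      unfolding clebsch_gordan[OF x ab(1)] using c0 by (intro sum.cong) (auto simp: C_def)
    also have "\<dots> = weyl_char (r + s) x + (weyl_char q x + (\<Sum>c\<in>C. weyl_char (a + b - 2 * c) x))"
      using c0 ab by (simp add: C_def)
    also have "weyl_char (r + s) x = simple_char p (r + s - p) x * simple_char p 1 (x ^ p) + simple_char p q x"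
      unfolding q_def by (rule weyl_char_above[OF x rs(3)]) (use rs in auto)
    finally show ?thesis using simple_char_below[OF q] by simp
  qed
  obtain \<nu> d where d: "is_char d" "\<And>x. x > 1 \<Longrightarrow> h x = simple_char p \<nu> x + d x"
    unfolding h_def using simple_char_mult_nonzero by metis
  define e where "e = (\<lambda>x. (simple_char p q x * d (x ^ p) + simple_char p q x * d (x ^ p)) +
    (simple_char p (r + s - p) x * (simple_char p 1 (x ^ p) * h (x ^ p)) + (\<Sum>c\<in>C. weyl_char (a + b - 2 * c) x * h (x ^ p))))"
  have "is_char e"
    unfolding e_def
    by (intro is_char_add is_char_twist[OF q d(1)] is_char_sum is_char_weyl_twist h
        is_char_twist[of "r + s - p" "\<lambda>x. simple_char p 1 x * h x"] is_char_mult is_char_simple)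
      (use rs ab in auto)
  moreover have "simple_char p (r + p * \<kappa>) x * simple_char p (s + p * \<mu>) x = 2 * simple_char p (q + p * \<nu>) x + e x"
    if x: "x > 1" for x
  proof -
    have x0: "x > 0" using x by simp
    have "simple_char p (r + p * \<kappa>) x * simple_char p (s + p * \<mu>) x = (simple_char p r x * simple_char p s x) * h (x ^ p)"
      using x rs by (simp add: simple_char_digit h_def)
    also have "\<dots> = 2 * simple_char p q x * h (x ^ p) + (simple_char p (r + s - p) x * (simple_char p 1 (x ^ p) * h (x ^ p)) +
        (\<Sum>c\<in>C. weyl_char (a + b - 2 * c) x * h (x ^ p)))"
      unfolding CG[OF x] by (simp add: algebra_simps sum_distrib_left sum_distrib_right)
    also have "2 * simple_char p q x * h (x ^ p) = 2 * simple_char p (q + p * \<nu>) x + (simple_char p q x * d (x ^ p) + simple_char p q x * d (x ^ p))"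
      unfolding d(2)[OF power_p_gt_1[OF x]] simple_char_digit[OF q x0] by (simp add: algebra_simps)
    finally show ?thesis by (simp add: e_def)
  qed
  ultimately show ?thesis unfolding has_double_factor_def by blast
qed

lemma no_carry_mult:
  assumes rs: "r + s < p" and x: "x > 1"
  shows "simple_char p (r + p * \<kappa>) x * simple_char p (s + p * \<mu>) x =
    (\<Sum>c\<le>min r s. simple_char p (r + s - 2 * c) x * (simple_char p \<kappa> (x ^ p) * simple_char p \<mu> (x ^ p)))"
proof -
  define a where "a = max r s"
  define b where "b = min r s"
  have ab: "b \<le> a" "a + b = r + s" by (auto simp: a_def b_def)
  have "simple_char p r x * simple_char p s x = weyl_char a x * weyl_char b x"
    using rs simple_char_below by (simp add: a_def b_def max_def min_def)
  also have "\<dots> = (\<Sum>c\<le>min r s. simple_char p (r + s - 2 * c) x)"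
    unfolding clebsch_gordan[OF x ab(1)] ab(2) b_def[symmetric]
    by (intro sum.cong refl simple_char_below[symmetric]) (use rs in auto)
  finally have *: "simple_char p r x * simple_char p s x = (\<Sum>c\<le>min r s. simple_char p (r + s - 2 * c) x)" .
  have "simple_char p (r + p * \<kappa>) x * simple_char p (s + p * \<mu>) x =
      (simple_char p r x * simple_char p s x) * (simple_char p \<kappa> (x ^ p) * simple_char p \<mu> (x ^ p))"
    using x rs by (simp add: simple_char_digit)
  then show ?thesis unfolding * sum_distrib_right .
qed

text \<open>A repeated factor \<open>\<nu>\<close> for the higher digits gives the repeated factor \<open>r + s + p * \<nu>\<close>.\<close>

lemma double_factor_no_carry:
  assumes rs: "r + s < p" and h: "has_double_factor (\<lambda>x. simple_char p \<kappa> x * simple_char p \<mu> x)"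
  shows "has_double_factor (\<lambda>x. simple_char p (r + p * \<kappa>) x * simple_char p (s + p * \<mu>) x)"
proof -
  obtain \<nu> d where d: "is_char d" "\<And>x. x > 1 \<Longrightarrow> simple_char p \<kappa> x * simple_char p \<mu> x = 2 * simple_char p \<nu> x + d x"
    using h unfolding has_double_factor_def by blast
  define e where "e = (\<lambda>x. simple_char p (r + s) x * d (x ^ p) +
    (\<Sum>c\<in>{..min r s} - {0}. simple_char p (r + s - 2 * c) x * (simple_char p \<kappa> (x ^ p) * simple_char p \<mu> (x ^ p))))"
  have "is_char e"
    unfolding e_def
    by (intro is_char_add is_char_twist[OF rs d(1)] is_char_sum
        is_char_twist[of _ "\<lambda>x. simple_char p \<kappa> x * simple_char p \<mu> x"] is_char_simple_mult)
      (use rs in auto)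
  moreover have "simple_char p (r + p * \<kappa>) x * simple_char p (s + p * \<mu>) x = 2 * simple_char p (r + s + p * \<nu>) x + e x"
    if x: "x > 1" for x
  proof -
    have "simple_char p (r + p * \<kappa>) x * simple_char p (s + p * \<mu>) x =
      simple_char p (r + s) x * (simple_char p \<kappa> (x ^ p) * simple_char p \<mu> (x ^ p)) +
      (\<Sum>c\<in>{..min r s} - {0}. simple_char p (r + s - 2 * c) x * (simple_char p \<kappa> (x ^ p) * simple_char p \<mu> (x ^ p)))"
      unfolding no_carry_mult[OF rs x] by (subst sum.remove[of _ 0]) auto
    moreover have "x > 0" using x by simp
    ultimately show ?thesis
      unfolding e_def simple_char_digit[OF rs \<open>x > 0\<close>] d(2)[OF power_p_gt_1[OF x]] by (simp add: distrib_left)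
  qed
  ultimately show ?thesis unfolding has_double_factor_def by blast
qed

lemma digit_sum_Suc: "(\<Sum>i\<le>Suc n. p ^ i * l i) = l 0 + p * (\<Sum>i\<le>n. p ^ i * l (Suc i))"
  by (subst sum.atMost_Suc_shift) (simp add: sum_distrib_left mult.assoc)

lemma double_factor_exists:
  assumes "\<forall>i\<le>n. l i < p" "\<forall>i\<le>n. m i < p" "\<exists>i\<le>n. p \<le> l i + m i"
  shows "has_double_factor (\<lambda>x. simple_char p (\<Sum>i\<le>n. p ^ i * l i) x * simple_char p (\<Sum>i\<le>n. p ^ i * m i) x)"
  using assms
proof (induction n arbitrary: l m)
  case 0
  then show ?case using double_factor_carry[of "l 0" "m 0" 0 0] by simp
next
  case (Suc n)
  show ?case
  proof (cases "p \<le> l 0 + m 0")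
    case True
    then show ?thesis unfolding digit_sum_Suc by (intro double_factor_carry) (use Suc.prems in auto)
  next
    case False
    obtain i where i: "i \<le> Suc n" "p \<le> l i + m i" using Suc.prems(3) by auto
    with False obtain j where j: "i = Suc j" by (cases i) auto
    have "has_double_factor (\<lambda>x. simple_char p (\<Sum>i\<le>n. p ^ i * l (Suc i)) x * simple_char p (\<Sum>i\<le>n. p ^ i * m (Suc i)) x)"
      by (rule Suc.IH) (use Suc.prems i j in auto)
    then show ?thesis unfolding digit_sum_Suc using False by (intro double_factor_no_carry) auto
  qed
qed

text \<open>Without carries the highest weights of the factors are \<open>(r + s - 2 * c) + p * \<nu>\<close>, with \<open>\<nu>\<close> a highest
weight for the higher digits. As \<open>r + s - 2 * c < p\<close>, division by \<open>p\<close> recovers \<open>\<nu>\<close> and \<open>c\<close>, so there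
are no repetitions.\<close>

lemma multiplicity_free_no_carry:
  assumes "\<forall>i\<le>n. l i + m i < p"
  shows "\<exists>F. finite F \<and> (\<forall>x>1. simple_char p (\<Sum>i\<le>n. p ^ i * l i) x * simple_char p (\<Sum>i\<le>n. p ^ i * m i) x =
    (\<Sum>\<nu>\<in>F. simple_char p \<nu> x))"
proof -
  have step: "\<exists>F. finite F \<and> (\<forall>x>1. simple_char p (r + p * \<kappa>) x * simple_char p (s + p * \<mu>) x = (\<Sum>\<nu>\<in>F. simple_char p \<nu> x))"
    if rs: "r + s < p" and F: "finite F" "\<forall>x>1. simple_char p \<kappa> x * simple_char p \<mu> x = (\<Sum>\<nu>\<in>F. simple_char p \<nu> x)"
    for r s \<kappa> \<mu> F
  proof (intro exI[of _ "(\<lambda>(c, \<nu>). (r + s - 2 * c) + p * \<nu>) ` ({..min r s} \<times> F)"] conjI allI impI)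
    have inj: "inj_on (\<lambda>(c, \<nu>). (r + s - 2 * c) + p * \<nu>) ({..min r s} \<times> F)"
    proof (rule inj_onI)
      fix a b assume ab: "a \<in> {..min r s} \<times> F" "b \<in> {..min r s} \<times> F"
        "(case a of (c, \<nu>) \<Rightarrow> (r + s - 2 * c) + p * \<nu>) = (case b of (c, \<nu>) \<Rightarrow> (r + s - 2 * c) + p * \<nu>)"
      obtain c \<nu> c' \<nu>' where cc: "a = (c, \<nu>)" "b = (c', \<nu>')" by fastforce
      define u where "u = r + s - 2 * c"
      define u' where "u' = r + s - 2 * c'"
      have u: "u < p" "u' < p" using rs by (auto simp: u_def u'_def)
      have e: "u + p * \<nu> = u' + p * \<nu>'" using ab(3) cc by (simp add: u_def u'_def)
      have "(u + p * \<nu>) mod p = u" "(u + p * \<nu>) div p = \<nu>" using u(1) by simp_all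
      moreover have "(u' + p * \<nu>') mod p = u'" "(u' + p * \<nu>') div p = \<nu>'" using u(2) by simp_all
      ultimately have "u = u'" "\<nu> = \<nu>'" using e by simp_all
      moreover have "c \<le> min r s" "c' \<le> min r s" using ab cc by auto
      ultimately show "a = b" using cc by (auto simp: u_def u'_def)
    qed
    fix x :: real assume x: "x > 1"
    have "simple_char p (r + p * \<kappa>) x * simple_char p (s + p * \<mu>) x =
        (\<Sum>c\<le>min r s. \<Sum>\<nu>\<in>F. simple_char p (r + s - 2 * c) x * simple_char p \<nu> (x ^ p))"
      unfolding no_carry_mult[OF rs x] using F(2) power_p_gt_1[OF x] by (simp add: sum_distrib_left)
    also have "\<dots> = (\<Sum>c\<le>min r s. \<Sum>\<nu>\<in>F. simple_char p ((r + s - 2 * c) + p * \<nu>) x)"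
      by (intro sum.cong refl simple_char_digit[symmetric]) (use rs x in auto)
    also have "\<dots> = (\<Sum>\<nu>\<in>(\<lambda>(c, \<nu>). (r + s - 2 * c) + p * \<nu>) ` ({..min r s} \<times> F). simple_char p \<nu> x)"
      by (subst sum.reindex[OF inj]) (simp only: sum.cartesian_product case_prod_unfold comp_def)
    finally show "simple_char p (r + p * \<kappa>) x * simple_char p (s + p * \<mu>) x =
      (\<Sum>\<nu>\<in>(\<lambda>(c, \<nu>). (r + s - 2 * c) + p * \<nu>) ` ({..min r s} \<times> F). simple_char p \<nu> x)" .
  qed (use F in auto)
  show ?thesis
    using assms
  proof (induction n arbitrary: l m)
    case 0
    have "simple_char p 0 x = 1" for x using simple_char_below[of 0] pos by (simp add: weyl_char_def)
    then show ?case using step[of "l 0" "m 0" "{0}" 0 0] 0 by simp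
  next
    case (Suc n)
    have "\<exists>F. finite F \<and> (\<forall>x>1. simple_char p (\<Sum>i\<le>n. p ^ i * l (Suc i)) x * simple_char p (\<Sum>i\<le>n. p ^ i * m (Suc i)) x =
        (\<Sum>\<nu>\<in>F. simple_char p \<nu> x))"
      by (rule Suc.IH) (use Suc.prems in auto)
    then obtain F where "finite F" "\<forall>x>1. simple_char p (\<Sum>i\<le>n. p ^ i * l (Suc i)) x *
        simple_char p (\<Sum>i\<le>n. p ^ i * m (Suc i)) x = (\<Sum>\<nu>\<in>F. simple_char p \<nu> x)"
      by blast
    then show ?case unfolding digit_sum_Suc using Suc.prems by (intro step) auto
  qed
qed

end

section \<open>Multiplicity-free tensor products\<close>

theorem theorem4p4:
  fixes p n lam mu :: nat and l m :: "nat \<Rightarrow> nat"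
  assumes "CHAR('k::alg_closed_field) = p" and "p > 0"
    and "\<forall>i\<le>n. restricted p (l i)" and "\<forall>i\<le>n. restricted p (m i)"
    and "lam = (\<Sum>i\<le>n. p ^ i * l i)" and "mu = (\<Sum>i\<le>n. p ^ i * m i)"
  shows "multiplicity_free (tensor (L lam) (L mu) :: 'k gmodule) \<longleftrightarrow>
         (\<forall>i\<le>n. restricted p (l i + m i))"
proof
  assume mf: "multiplicity_free (tensor (L lam) (L mu) :: 'k gmodule)"
  show "\<forall>i\<le>n. restricted p (l i + m i)"
  proof (rule ccontr)
    assume "\<not> ?thesis"
    then have "\<exists>i\<le>n. p \<le> l i + m i" by (auto simp: restricted_def not_less)
    then have "has_double_factor p (\<lambda>x. simple_char p lam x * simple_char p mu x)"
      using double_factor_exists[OF assms(1,2)] assms(3-6) by (simp add: restricted_def)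
    then obtain \<nu> B where B: "\<And>x. x > 1 \<Longrightarrow>
        simple_char p lam x * simple_char p mu x = 2 * simple_char p \<nu> x + total_char p B x"
      unfolding has_double_factor_def[OF assms(1,2)] is_char_def[OF assms(1,2)] by auto
    obtain A where A: "\<And>x. x > 0 \<Longrightarrow> simple_char p lam x * simple_char p mu x = total_char p A x"
      "composition_multiplicity (tensor (L lam) (L mu) :: 'k gmodule) (L \<nu>) = count A \<nu>"
      using tensor_composition_multiplicity[OF assms(1,2)] by metis
    have "A = add_mset \<nu> (add_mset \<nu> B)"
      by (rule total_char_inject[OF p_ne_1[OF assms(1,2)]]) (use A(1) B in \<open>simp flip: A(1)\<close>)
    then have "composition_multiplicity (tensor (L lam) (L mu) :: 'k gmodule) (L \<nu>) \<ge> 2" using A(2) by simp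
    moreover have "composition_multiplicity (tensor (L lam) (L mu) :: 'k gmodule) (L \<nu>) \<le> 1"
      using mf by (simp add: multiplicity_free_def)
    ultimately show False by simp
  qed
next
  assume "\<forall>i\<le>n. restricted p (l i + m i)"
  then obtain F where F: "finite F" "\<And>x. x > 1 \<Longrightarrow>
      simple_char p lam x * simple_char p mu x = (\<Sum>\<nu>\<in>F. simple_char p \<nu> x)"
    using multiplicity_free_no_carry[OF assms(1,2), of n l m] assms(5,6) by (auto simp: restricted_def)
  have "composition_multiplicity (tensor (L lam) (L mu) :: 'k gmodule) (L \<nu>) \<le> 1" for \<nu>
  proof -
    obtain A where A: "\<And>x. x > 0 \<Longrightarrow> simple_char p lam x * simple_char p mu x = total_char p A x"
      "composition_multiplicity (tensor (L lam) (L mu) :: 'k gmodule) (L \<nu>) = count A \<nu>"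
      using tensor_composition_multiplicity[OF assms(1,2)] by metis
    have "A = mset_set F"
      by (rule total_char_inject[OF p_ne_1[OF assms(1,2)]])
        (use F(2) in \<open>simp add: total_char_def[of _ "mset_set F"] flip: A(1) sum_unfold_sum_mset\<close>)
    then show ?thesis using A(2) F(1) by (simp add: count_mset_set')
  qed
  then show "multiplicity_free (tensor (L lam) (L mu) :: 'k gmodule)"
    by (simp add: multiplicity_free_def)
qed

end
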